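(* Let $T$ be the $(d_0,d_1)$-semiregular tree and let $F_0\leq\mathrm{Sym}(d_0)$ and $F_1\leq\mathrm{Sym}(d_1)$. Let $H\in\mathcal{H}_T^+$ be such that $\underline{H}(x)\cong F_0$ for each $x\in V_0(T)$ and $\underline{H}(y)\cong F_1$ for each $y\in V_1(T)$. Suppose that, for each $t\in\{0,1\}$, the stabilizer $F_t(1)$ of $1$ in $F_t$ is simple non-abelian. Then there exists a legal coloring $i$ of $T$ such that $H$ is equal to the group $$U_{(i)}^+(F_0,F_1):=\{g\in\mathrm{Aut}(T)^+ : \sigma_{(i)}(g,x)\in F_0 \text{ for each } x\in V_0(T),\ \sigma_{(i)}(g,y)\in F_1\text{ for each } y\in V_1(T)\}.$$
   Context: The $(d_0,d_1)$-semiregular tree $T$ is the tree whose vertex set has a bipartition $V(T)=V_0(T)\sqcup V_1(T)$ such that every edge joins $V_0(T)$ to $V_1(T)$ and each vertex of type $t$ (i.e. in $V_t(T)$) is incident to exactly $d_t$ edges. $\mathrm{Aut}(T)$ carries the topology of pointwise convergence on vertices; $\mathrm{Aut}(T)^+$ is the subgroup of automorphisms preserving $V_0(T)$ and $V_1(T)$. $\partial T$ is the set of ends of $T$. $\mathcal{H}_T^+$ is the set of closed subgroups of $\mathrm{Aut}(T)$ that are contained in $\mathrm{Aut}(T)^+$ and $2$-transitive on $\partial T$. For $v\in V(T)$, $\underline{H}(v)\leq\mathrm{Sym}(E(v))$ is the permutation group induced by the stabilizer $H(v)$ of $v$ on the set $E(v)$ of edges incident to $v$; $\cong$ between finite permutation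 groups means permutation isomorphic. $S(v,r)$ is the set of vertices at distance exactly $r$ from $v$. A legal coloring $i$ of $T$ is a map on $V(T)$ given by $i_0\colon V_0(T)\to\{1,\dots,d_1\}$ and $i_1\colon V_1(T)\to\{1,\dots,d_0\}$ such that for each $v\in V_1(T)$ the restriction $i_0|_{S(v,1)}$ is a bijection onto $\{1,\dots,d_1\}$, and for each $v\in V_0(T)$ the restriction $i_1|_{S(v,1)}$ is a bijection onto $\{1,\dots,d_0\}$. For $g\in\mathrm{Aut}(T)$ and $v\in V(T)$ put $\sigma_{(i)}(g,v)=i|_{S(g(v),1)}\circ g\circ i|_{S(v,1)}^{-1}$, a permutation in $\mathrm{Sym}(d_t)$ where $t$ is the type of $v$. *)

theory Defs
  imports "HOL-Analysis.Analysis" "HOL-Algebra.Bij" "HOL-Algebra.SimpleGroups"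
begin

section \<open>Trees\<close>

text \<open>A simple undirected graph is given by a vertex set and a set of unordered pairs. The notion of
  tree in the AFP entry on directed graphs is not usable here: it forbids directed cycles only, so
  that in a symmetric digraph already an edge traversed back and forth counts as a cycle.\<close>

definition simple_graph :: "'a set \<Rightarrow> 'a set set \<Rightarrow> bool" where
  "simple_graph V E \<longleftrightarrow> E \<subseteq> {{x, y} |x y. x \<in> V \<and> y \<in> V \<and> x \<noteq> y}"

definition graph_walk :: "'a set \<Rightarrow> 'a set set \<Rightarrow> 'a list \<Rightarrow> bool" where
  "graph_walk V E xs \<longleftrightarrow> xs \<noteq> [] \<and> set xs \<subseteq> V \<and> successively (\<lambda>x y. {x, y} \<in> E) xs"

definition graph_connected :: "'a set \<Rightarrow> 'a set set \<Rightarrow> bool" where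
  "graph_connected V E \<longleftrightarrow> (\<forall>x\<in>V. \<forall>y\<in>V. \<exists>xs. graph_walk V E xs \<and> hd xs = x \<and> last xs = y)"

definition graph_cycle :: "'a set \<Rightarrow> 'a set set \<Rightarrow> 'a list \<Rightarrow> bool" where
  "graph_cycle V E xs \<longleftrightarrow>
     graph_walk V E xs \<and> distinct xs \<and> length xs \<ge> 3 \<and> {last xs, hd xs} \<in> E"

definition graph_tree :: "'a set \<Rightarrow> 'a set set \<Rightarrow> bool" where
  "graph_tree V E \<longleftrightarrow>
     simple_graph V E \<and> V \<noteq> {} \<and> graph_connected V E \<and> (\<nexists>xs. graph_cycle V E xs)"

definition graph_dist :: "'a set \<Rightarrow> 'a set set \<Rightarrow> 'a \<Rightarrow> 'a \<Rightarrow> nat" where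
  "graph_dist V E x y =
     (LEAST n. \<exists>xs. graph_walk V E xs \<and> hd xs = x \<and> last xs = y \<and> length xs = Suc n)"

definition graph_sphere :: "'a set \<Rightarrow> 'a set set \<Rightarrow> 'a \<Rightarrow> nat \<Rightarrow> 'a set" where
  "graph_sphere V E v r = {w \<in> V. graph_dist V E v w = r}"

definition incident_edges :: "'a set set \<Rightarrow> 'a \<Rightarrow> 'a set set" where
  "incident_edges E v = {e \<in> E. v \<in> e}"

text \<open>Finiteness is stated separately because the cardinality of an infinite set is 0.\<close>

definition semiregular_tree :: "'a set \<Rightarrow> 'a set \<Rightarrow> 'a set set \<Rightarrow> nat \<Rightarrow> nat \<Rightarrow> bool" where
  "semiregular_tree V0 V1 E d0 d1 \<longleftrightarrow>
     graph_tree (V0 \<union> V1) E \<and> V0 \<inter> V1 = {} \<and>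
     (\<forall>e\<in>E. \<exists>x\<in>V0. \<exists>y\<in>V1. e = {x, y}) \<and>
     (\<forall>x\<in>V0. finite (incident_edges E x) \<and> card (incident_edges E x) = d0) \<and>
     (\<forall>y\<in>V1. finite (incident_edges E y) \<and> card (incident_edges E y) = d1)"

section \<open>Ends\<close>

definition graph_ray :: "'a set \<Rightarrow> 'a set set \<Rightarrow> (nat \<Rightarrow> 'a) \<Rightarrow> bool" where
  "graph_ray V E r \<longleftrightarrow> range r \<subseteq> V \<and> inj r \<and> (\<forall>k. {r k, r (Suc k)} \<in> E)"

text \<open>Two rays of a tree define the same end iff they agree after deleting initial segments. The
  relation is only adequate for trees.\<close>

definition tail_equiv :: "'a set \<Rightarrow> 'a set set \<Rightarrow> ((nat \<Rightarrow> 'a) \<times> (nat \<Rightarrow> 'a)) set" where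
  "tail_equiv V E =
     {(r, s). graph_ray V E r \<and> graph_ray V E s \<and> (\<exists>m n. \<forall>k. r (m + k) = s (n + k))}"

definition tree_ends :: "'a set \<Rightarrow> 'a set set \<Rightarrow> (nat \<Rightarrow> 'a) set set" where
  "tree_ends V E = {r. graph_ray V E r} // tail_equiv V E"

definition end_action :: "('a \<Rightarrow> 'a) \<Rightarrow> (nat \<Rightarrow> 'a) set \<Rightarrow> (nat \<Rightarrow> 'a) set" where
  "end_action g \<epsilon> = (\<lambda>r. g \<circ> r) ` \<epsilon>"

section \<open>Permutation groups\<close>

text \<open>Permutation groups on \<open>X\<close> are subgroups of \<^term>\<open>BijGroup X\<close>; their elements are
  extensional on \<open>X\<close>. In particular \<open>Sym(d)\<close> is rendered as follows.\<close>

abbreviation Sym :: "nat \<Rightarrow> (nat \<Rightarrow> nat) monoid" where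
  "Sym d \<equiv> BijGroup {1..d}"

definition point_stabilizer :: "('a \<Rightarrow> 'a) set \<Rightarrow> 'a \<Rightarrow> ('a \<Rightarrow> 'a) set" where
  "point_stabilizer H x = {h \<in> H. h x = x}"

definition two_transitive_on :: "'g set \<Rightarrow> ('g \<Rightarrow> 'x \<Rightarrow> 'x) \<Rightarrow> 'x set \<Rightarrow> bool" where
  "two_transitive_on H act X \<longleftrightarrow>
     (\<forall>a\<in>X. \<forall>b\<in>X. \<forall>c\<in>X. \<forall>d\<in>X. a \<noteq> b \<longrightarrow> c \<noteq> d \<longrightarrow> (\<exists>h\<in>H. act h a = c \<and> act h b = d))"

text \<open>Permutation isomorphism: a bijection between the underlying sets that conjugates one group onto
  the other.\<close>

definition permutation_isomorphic ::
  "'x set \<Rightarrow> ('x \<Rightarrow> 'x) set \<Rightarrow> 'y set \<Rightarrow> ('y \<Rightarrow> 'y) set \<Rightarrow> bool" where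
  "permutation_isomorphic X P Y Q \<longleftrightarrow>
     (\<exists>\<phi>. bij_betw \<phi> X Y \<and> Q = (\<lambda>p. \<lambda>y\<in>Y. \<phi> (p (inv_into X \<phi> y))) ` P)"

section \<open>Automorphism groups of trees\<close>

definition tree_aut :: "'a set \<Rightarrow> 'a set set \<Rightarrow> ('a \<Rightarrow> 'a) set" where
  "tree_aut V E = {g \<in> Bij V. \<forall>x\<in>V. \<forall>y\<in>V. {g x, g y} \<in> E \<longleftrightarrow> {x, y} \<in> E}"

definition aut_group :: "'a set \<Rightarrow> 'a set set \<Rightarrow> ('a \<Rightarrow> 'a) monoid" where
  "aut_group V E = BijGroup V\<lparr>carrier := tree_aut V E\<rparr>"

definition aut_topology :: "'a set \<Rightarrow> 'a set set \<Rightarrow> ('a \<Rightarrow> 'a) topology" where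
  "aut_topology V E =
     subtopology (product_topology (\<lambda>_. discrete_topology V) V) (tree_aut V E)"

definition tree_aut_plus :: "'a set \<Rightarrow> 'a set \<Rightarrow> 'a set set \<Rightarrow> ('a \<Rightarrow> 'a) set" where
  "tree_aut_plus V0 V1 E = {g \<in> tree_aut (V0 \<union> V1) E. g ` V0 = V0 \<and> g ` V1 = V1}"

text \<open>The set \<open>\<H>\<^sub>T\<^sup>+\<close> of closed subgroups of the automorphism group that preserve types and are
  2-transitive on ends.\<close>

definition HT_plus :: "'a set \<Rightarrow> 'a set \<Rightarrow> 'a set set \<Rightarrow> ('a \<Rightarrow> 'a) set set" where
  "HT_plus V0 V1 E =
     {H. subgroup H (aut_group (V0 \<union> V1) E) \<and>
         closedin (aut_topology (V0 \<union> V1) E) H \<and>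
         H \<subseteq> tree_aut_plus V0 V1 E \<and>
         two_transitive_on H end_action (tree_ends (V0 \<union> V1) E)}"

text \<open>The permutation group on the edges at \<open>v\<close> induced by the stabilizer of \<open>v\<close> in \<open>H\<close>.\<close>

definition local_action :: "'a set set \<Rightarrow> ('a \<Rightarrow> 'a) set \<Rightarrow> 'a \<Rightarrow> ('a set \<Rightarrow> 'a set) set" where
  "local_action E H v = (\<lambda>g. \<lambda>e\<in>incident_edges E v. g ` e) ` point_stabilizer H v"

section \<open>Legal colorings\<close>

text \<open>The maps \<open>i\<^sub>0\<close> and \<open>i\<^sub>1\<close> are combined into one map; its values outside the vertex set are
  irrelevant. Vertices of type 0 are colored by \<open>{1..d1}\<close> and vertices of type 1 by \<open>{1..d0}\<close>.\<close>

definition legal_coloring ::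
  "'a set \<Rightarrow> 'a set \<Rightarrow> 'a set set \<Rightarrow> nat \<Rightarrow> nat \<Rightarrow> ('a \<Rightarrow> nat) \<Rightarrow> bool" where
  "legal_coloring V0 V1 E d0 d1 i \<longleftrightarrow>
     i \<in> V0 \<rightarrow> {1..d1} \<and> i \<in> V1 \<rightarrow> {1..d0} \<and>
     (\<forall>v\<in>V1. bij_betw i (graph_sphere (V0 \<union> V1) E v 1) {1..d1}) \<and>
     (\<forall>v\<in>V0. bij_betw i (graph_sphere (V0 \<union> V1) E v 1) {1..d0})"

text \<open>For a legal coloring and a vertex \<open>v\<close> of type \<open>t\<close> the domain \<open>i ` S(v,1)\<close> below is
  \<open>{1..d\<^sub>t}\<close>.\<close>

definition local_perm ::
  "'a set \<Rightarrow> 'a set set \<Rightarrow> ('a \<Rightarrow> nat) \<Rightarrow> ('a \<Rightarrow> 'a) \<Rightarrow> 'a \<Rightarrow> nat \<Rightarrow> nat" where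
  "local_perm V E i g v =
     (\<lambda>k \<in> i ` graph_sphere V E v 1. i (g (inv_into (graph_sphere V E v 1) i k)))"

definition U_plus ::
  "'a set \<Rightarrow> 'a set \<Rightarrow> 'a set set \<Rightarrow> ('a \<Rightarrow> nat) \<Rightarrow> (nat \<Rightarrow> nat) set \<Rightarrow> (nat \<Rightarrow> nat) set
     \<Rightarrow> ('a \<Rightarrow> 'a) set" where
  "U_plus V0 V1 E i F0 F1 =
     {g \<in> tree_aut_plus V0 V1 E.
        (\<forall>x\<in>V0. local_perm (V0 \<union> V1) E i g x \<in> F0) \<and>
        (\<forall>y\<in>V1. local_perm (V0 \<union> V1) E i g y \<in> F1)}"

section \<open>Basic facts\<close>

lemma subgroup_tree_aut: "subgroup (tree_aut V E) (BijGroup V)"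
proof -
  interpret group "BijGroup V" by (rule group_BijGroup)
  show ?thesis
  proof (rule subgroupI)
    show "tree_aut V E \<subseteq> carrier (BijGroup V)"
      by (auto simp: tree_aut_def BijGroup_def)
    have "(\<lambda>x\<in>V. x) \<in> tree_aut V E"
      by (auto simp: tree_aut_def id_Bij)
    then show "tree_aut V E \<noteq> {}" by blast
  next
    fix g assume g: "g \<in> tree_aut V E"
    then have B: "g \<in> Bij V" and img: "g ` V = V"
      by (auto simp: tree_aut_def Bij_def bij_betw_def)
    have iv: "inv_into V g x \<in> V \<and> g (inv_into V g x) = x" if "x \<in> V" for x
      using that img by (metis f_inv_into_f inv_into_into)
    have "inv\<^bsub>BijGroup V\<^esub> g = (\<lambda>x\<in>V. inv_into V g x)"
      using B by (rule inv_BijGroup)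
    moreover have "(\<lambda>x\<in>V. inv_into V g x) \<in> tree_aut V E"
    proof -
      have "{inv_into V g x, inv_into V g y} \<in> E \<longleftrightarrow> {x, y} \<in> E" if "x \<in> V" "y \<in> V" for x y
      proof -
        have "{g (inv_into V g x), g (inv_into V g y)} \<in> E \<longleftrightarrow>
              {inv_into V g x, inv_into V g y} \<in> E"
          using g iv[OF that(1)] iv[OF that(2)] unfolding tree_aut_def by blast
        then show ?thesis using iv[OF that(1)] iv[OF that(2)] by simp
      qed
      then show ?thesis
        using restrict_inv_into_Bij[OF B] unfolding tree_aut_def by simp
    qed
    ultimately show "inv\<^bsub>BijGroup V\<^esub> g \<in> tree_aut V E" by simp
  next
    fix g h assume gh: "g \<in> tree_aut V E" "h \<in> tree_aut V E"
    then have B: "g \<in> Bij V" "h \<in> Bij V" by (auto simp: tree_aut_def)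
    then have "g \<otimes>\<^bsub>BijGroup V\<^esub> h = compose V g h" by (simp add: BijGroup_def)
    moreover have "compose V g h \<in> tree_aut V E"
      using gh compose_Bij[OF B] Bij_imp_funcset[OF B(2)]
      by (auto simp: tree_aut_def compose_def Pi_iff)
    ultimately show "g \<otimes>\<^bsub>BijGroup V\<^esub> h \<in> tree_aut V E" by simp
  qed
qed

lemma group_aut_group: "group (aut_group V E)"
  unfolding aut_group_def
  using subgroup_tree_aut group_BijGroup by (rule subgroup.subgroup_is_group)

lemma topspace_aut_topology: "topspace (aut_topology V E) = tree_aut V E"
proof -
  have "tree_aut V E \<subseteq> (\<Pi>\<^sub>E x\<in>V. V)"
    by (auto simp: tree_aut_def PiE_def dest: Bij_imp_extensional Bij_imp_funcset)
  then show ?thesis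
    by (auto simp: aut_topology_def)
qed

lemma graph_dist_eq_0_iff:
  assumes "graph_connected V E" "v \<in> V" "w \<in> V"
  shows "graph_dist V E v w = 0 \<longleftrightarrow> v = w"
proof -
  let ?P = "\<lambda>n. \<exists>xs. graph_walk V E xs \<and> hd xs = v \<and> last xs = w \<and> length xs = Suc n"
  obtain xs where "graph_walk V E xs" "hd xs = v" "last xs = w"
    using assms unfolding graph_connected_def by blast
  then have "?P (length xs - 1)" by (auto simp: graph_walk_def)
  then have L: "?P (LEAST n. ?P n)" by (rule LeastI)
  show ?thesis
  proof
    assume "graph_dist V E v w = 0"
    with L show "v = w" by (auto simp: graph_dist_def length_Suc_conv)
  next
    assume "v = w"
    then have "?P 0" using assms by (intro exI[of _ "[v]"]) (auto simp: graph_walk_def)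
    then show "graph_dist V E v w = 0" unfolding graph_dist_def by (rule Least_eq_0)
  qed
qed

lemma graph_sphere_1:
  assumes "simple_graph V E" "graph_connected V E" "v \<in> V"
  shows "graph_sphere V E v 1 = {w. {v, w} \<in> E}"
proof (intro Set.set_eqI iffI)
  fix w assume w: "w \<in> graph_sphere V E v 1"
  then have W: "w \<in> V" "graph_dist V E v w = 1" by (auto simp: graph_sphere_def)
  let ?P = "\<lambda>n. \<exists>xs. graph_walk V E xs \<and> hd xs = v \<and> last xs = w \<and> length xs = Suc n"
  obtain xs where "graph_walk V E xs" "hd xs = v" "last xs = w"
    using assms W unfolding graph_connected_def by blast
  then have "?P (length xs - 1)" by (auto simp: graph_walk_def)
  then have "?P (LEAST n. ?P n)" by (rule LeastI)
  with W have "?P 1" by (simp add: graph_dist_def)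
  then show "w \<in> {w. {v, w} \<in> E}"
    by (auto simp: graph_walk_def length_Suc_conv)
next
  fix w assume "w \<in> {w. {v, w} \<in> E}"
  then have e: "{v, w} \<in> E" by simp
  then have W: "w \<in> V" "v \<noteq> w"
    using assms(1) unfolding simple_graph_def by (force simp: doubleton_eq_iff)+
  have "graph_dist V E v w \<le> 1"
    unfolding graph_dist_def using e W assms(3)
    by (intro Least_le exI[of _ "[v, w]"]) (auto simp: graph_walk_def)
  moreover have "graph_dist V E v w \<noteq> 0"
    using graph_dist_eq_0_iff[OF assms(2,3) W(1)] W by simp
  ultimately show "w \<in> graph_sphere V E v 1"
    using W by (simp add: graph_sphere_def)
qed

lemma equiv_tail_equiv: "equiv {r. graph_ray V E r} (tail_equiv V E)"
proof (rule equivI)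
  show "tail_equiv V E \<subseteq> {r. graph_ray V E r} \<times> {r. graph_ray V E r}"
    by (auto simp: tail_equiv_def)
  show "refl_on {r. graph_ray V E r} (tail_equiv V E)"
    by (auto simp: refl_on_def tail_equiv_def)
  show "sym (tail_equiv V E)"
  proof (rule symI)
    fix r s assume "(r, s) \<in> tail_equiv V E"
    then obtain m n where "graph_ray V E r" "graph_ray V E s" "\<And>k. r (m + k) = s (n + k)"
      unfolding tail_equiv_def by auto
    then have "graph_ray V E s \<and> graph_ray V E r \<and> (\<exists>m n. \<forall>k. s (m + k) = r (n + k))"
      by metis
    then show "(s, r) \<in> tail_equiv V E" unfolding tail_equiv_def by simp
  qed
  show "trans (tail_equiv V E)"
  proof (rule transI)
    fix r s t assume "(r, s) \<in> tail_equiv V E" "(s, t) \<in> tail_equiv V E"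
    then obtain m n p q where R: "graph_ray V E r" "graph_ray V E t"
      and "\<And>k. r (m + k) = s (n + k)" "\<And>k. s (p + k) = t (q + k)"
      unfolding tail_equiv_def by auto
    then have "r ((m + p) + k) = t ((q + n) + k)" for k
    proof -
      have "r ((m + p) + k) = s (n + (p + k))"
        using \<open>\<And>k. r (m + k) = s (n + k)\<close>[of "p + k"] by (simp add: add.assoc)
      also have "\<dots> = s (p + (n + k))" by (simp add: add.left_commute)
      also have "\<dots> = t ((q + n) + k)"
        using \<open>\<And>k. s (p + k) = t (q + k)\<close>[of "n + k"] by (simp add: add.assoc)
      finally show ?thesis .
    qed
    with R show "(r, t) \<in> tail_equiv V E" unfolding tail_equiv_def by blast
  qed
qed

end

theory Submission
  imports Defs
begin

text \<open>Boundary 2-transitivity makes every vertex stabiliser of \<open>H\<close> transitive on spheres, because an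
  element fixing an end can be corrected by a translation along its axis. Transporting charts of the
  local actions along \<open>H\<close>, and adjusting them outwards from a root by elements of the transitive groups
  \<open>F\<^sub>0\<close>, \<open>F\<^sub>1\<close>, gives a legal coloring with \<open>H\<close> contained in the universal group.

  For equality, \<open>H\<close> being closed, it suffices that the fixator of a ball acts on the next sphere as the
  full product of the groups \<open>F\<^sub>t(1)\<close>. As these are simple and non-abelian, the only obstruction is that
  the actions at two boundary vertices determine each other (Goursat). For balls of radius at least 1
  around a vertex or an edge this is excluded by induction: by transitivity on spheres the action at
  \<open>z\<close> would be determined by each of two siblings, whose actions are independent. For an edge it would
  make \<open>H\<close> discrete. For a star, the identification would be induced by an element centralizing
  the fixator of the star, which contradicts transitivity on paths of length 4.\<close>

section \<open>Non-backtracking walks and the tree metric\<close>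

text \<open>The point 1 in \<open>F\<^sub>t(1)\<close> stands for the neighbour of \<open>z\<close>
  nearer to the centre of the ball: the local actions are transitive, so any neighbour may receive
  colour 1. Degrees at least 3 come from the same hypothesis, since a point stabiliser on at most
  two points is trivial.

  Vertex balls and edge balls alternate in the induction because each type supplies, for the other,
  the independence of \<open>z\<close> from the boundary vertices in its own branch. For a boundary
  vertex \<open>w\<close> beyond the centre a sibling \<open>w'\<close> is used: the geodesics from
  \<open>z\<close> to both run through the centre, so an element fixing \<open>z\<close> and moving
  \<open>w\<close> to \<open>w'\<close> preserves the ball. In the ball of radius 1 around a vertex
  this breaks down: all boundary vertices are siblings of \<open>z\<close>, and the independence of
  siblings is the very claim. Hence the separate argument for the star.

  Only pairs of boundary vertices have to be examined: non-commutativity makes pairwise independence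
  imply joint independence.\<close>

fun nonbacktracking :: "'a list \<Rightarrow> bool" where
  "nonbacktracking (x # y # z # xs) \<longleftrightarrow> x \<noteq> z \<and> nonbacktracking (y # z # xs)"
| "nonbacktracking _ \<longleftrightarrow> True"

lemma nonbacktracking_ConsD: "nonbacktracking (x # xs) \<Longrightarrow> nonbacktracking xs"
  by (cases xs rule: nonbacktracking.cases) auto

lemma nonbacktracking_append:
  "nonbacktracking (xs @ x # ys) \<longleftrightarrow>
     nonbacktracking (xs @ [x]) \<and> nonbacktracking (x # ys) \<and> (xs \<noteq> [] \<longrightarrow> ys \<noteq> [] \<longrightarrow> last xs \<noteq> hd ys)"
proof (induction xs rule: nonbacktracking.induct)
  case ("2_2" v)
  then show ?case by (cases ys) auto
next
  case ("2_3" v w)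
  then show ?case by (cases ys) auto
qed auto

lemma nonbacktracking_rev: "nonbacktracking (rev xs) \<longleftrightarrow> nonbacktracking xs"
proof (induction xs rule: nonbacktracking.induct)
  case (1 x y z xs)
  have "nonbacktracking (rev (x # y # z # xs)) \<longleftrightarrow> nonbacktracking ((rev xs @ [z]) @ y # [x])"
    by simp
  also have "\<dots> \<longleftrightarrow> nonbacktracking (rev xs @ [z, y]) \<and> z \<noteq> x"
    using nonbacktracking_append[of "rev xs @ [z]" y "[x]"] by simp
  finally show ?case using 1 by auto
qed auto

text \<open>Interface for the metric arguments: the distances of adjacent vertices from a base point
  differ by one, and a vertex other than the base point has a single neighbour closer to it. Walks
  as lists stay behind this interface.\<close>

locale tree_metric =
  fixes V :: "'a set" and adj :: "'a \<Rightarrow> 'a \<Rightarrow> bool" and td :: "'a \<Rightarrow> 'a \<Rightarrow> nat"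
  assumes adj_V: "adj x y \<Longrightarrow> x \<in> V"
    and adj_sym: "adj x y \<Longrightarrow> adj y x"
    and td_sym: "x \<in> V \<Longrightarrow> y \<in> V \<Longrightarrow> td x y = td y x"
    and td_0: "x \<in> V \<Longrightarrow> y \<in> V \<Longrightarrow> td x y = 0 \<longleftrightarrow> x = y"
    and td_step: "x \<in> V \<Longrightarrow> adj y z \<Longrightarrow> td x z = Suc (td x y) \<or> td x y = Suc (td x z)"
    and parent_ex: "x \<in> V \<Longrightarrow> y \<in> V \<Longrightarrow> x \<noteq> y \<Longrightarrow> \<exists>p. adj p y \<and> td x y = Suc (td x p)"
    and parent_unique: "x \<in> V \<Longrightarrow> adj p y \<Longrightarrow> adj q y \<Longrightarrow> td x p < td x y \<Longrightarrow> td x q < td x y \<Longrightarrow> p = q"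

locale combinatorial_tree =
  fixes V :: "'a set" and E :: "'a set set"
  assumes graph_tree: "graph_tree V E"
begin

definition adj :: "'a \<Rightarrow> 'a \<Rightarrow> bool" where "adj x y \<longleftrightarrow> {x, y} \<in> E"

definition nb_walk :: "'a list \<Rightarrow> bool" where
  "nb_walk xs \<longleftrightarrow> xs \<noteq> [] \<and> set xs \<subseteq> V \<and> successively adj xs \<and> nonbacktracking xs"

definition geodesic :: "'a \<Rightarrow> 'a \<Rightarrow> 'a list" where
  "geodesic x y = (THE xs. nb_walk xs \<and> hd xs = x \<and> last xs = y)"

definition td :: "'a \<Rightarrow> 'a \<Rightarrow> nat" where "td x y = length (geodesic x y) - 1"

lemma walk_adj: "graph_walk V E xs \<longleftrightarrow> xs \<noteq> [] \<and> set xs \<subseteq> V \<and> successively adj xs"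
  unfolding graph_walk_def adj_def by simp

lemma adj_sym: "adj x y \<Longrightarrow> adj y x"
  unfolding adj_def by (simp add: insert_commute)

lemma adj_V: "adj x y \<Longrightarrow> x \<in> V" and adj_irrefl: "\<not> adj x x"
  using graph_tree unfolding adj_def graph_tree_def simple_graph_def
  by (auto simp: doubleton_eq_iff)

lemma nb_walk_ConsD: "nb_walk (x # xs) \<Longrightarrow> xs \<noteq> [] \<Longrightarrow> nb_walk xs"
  unfolding nb_walk_def by (auto dest: nonbacktracking_ConsD simp: successively_Cons)

text \<open>A first return to \<open>x\<close> closes a cycle \<open>x # as\<close>: irreflexivity
  rules out an empty \<open>as\<close> and the absence of backtracking a singleton, so the cycle has
  the length that \<open>graph_cycle\<close> demands.\<close>

lemma nb_walk_distinct: "nb_walk xs \<Longrightarrow> distinct xs"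
proof (induction xs)
  case (Cons x xs)
  show ?case
  proof (rule ccontr)
    assume nd: "\<not> distinct (x # xs)"
    then have ne: "xs \<noteq> []" by auto
    have dxs: "distinct xs" using Cons nb_walk_ConsD ne by blast
    with nd have "x \<in> set xs" by simp
    then obtain as bs where xs: "xs = as @ x # bs" and nas: "x \<notin> set as"
      using split_list_first by metis
    have S: "successively adj ((x # as) @ x # bs)" and nb: "nonbacktracking (x # as @ x # bs)"
      and sV: "set (x # as) \<subseteq> V"
      using Cons.prems xs unfolding nb_walk_def by auto
    have S': "successively adj (x # as)" "adj (last (x # as)) x"
      using S unfolding successively_append_iff by auto
    have "as \<noteq> []" using S'(2) adj_irrefl by auto
    moreover have "as \<noteq> [a]" for a using nb by auto
    ultimately have "length (x # as) \<ge> 3" by (cases as rule: nonbacktracking.cases) auto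
    moreover have "distinct (x # as)" using nas dxs xs by auto
    ultimately have "graph_cycle V E (x # as)"
      using S' sV unfolding graph_cycle_def walk_adj by (auto simp: adj_def insert_commute)
    then show False using graph_tree unfolding graph_tree_def by blast
  qed
qed simp

lemma nb_walk_rev: "nb_walk xs \<Longrightarrow> nb_walk (rev xs)"
  unfolding nb_walk_def by (auto simp: nonbacktracking_rev adj_sym
    elim: successively_mono)

lemma nb_walk_append:
  assumes "nb_walk (xs @ [x])" "nb_walk (x # ys)" "xs \<noteq> [] \<Longrightarrow> ys \<noteq> [] \<Longrightarrow> last xs \<noteq> hd ys"
  shows "nb_walk (xs @ x # ys)"
  using assms unfolding nb_walk_def nonbacktracking_append[of xs x ys]
  by (auto simp: successively_append_iff)

text \<open>If the walks part at their first step, the reversal of one continued by the other does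
  not backtrack at \<open>x\<close>. Its vertices are then distinct by
  \<open>nb_walk_distinct\<close>, which contradicts the common last vertex.\<close>

lemma nb_walk_unique:
  "nb_walk xs \<Longrightarrow> nb_walk ys \<Longrightarrow> hd xs = hd ys \<Longrightarrow> last xs = last ys \<Longrightarrow> xs = ys"
proof (induction xs arbitrary: ys)
  case (Cons x xs)
  obtain ys' where ys: "ys = x # ys'"
    using Cons.prems unfolding nb_walk_def by (cases ys) auto
  show ?case
  proof (cases "xs = [] \<or> ys' = []")
    case True
    then show ?thesis
      using nb_walk_distinct[OF Cons.prems(1)] nb_walk_distinct[OF Cons.prems(2)] Cons.prems(4) ys
      by (auto split: if_splits)
  next
    case False
    show ?thesis
    proof (cases "hd xs = hd ys'")
      case True
      then show ?thesis
        using Cons.IH[of ys'] nb_walk_ConsD Cons.prems False ys by auto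
    next
      case neq: False
      have "nb_walk (rev xs @ x # ys')"
      proof (rule nb_walk_append)
        show "nb_walk (rev xs @ [x])" using nb_walk_rev[OF Cons.prems(1)] by simp
        show "nb_walk (x # ys')" using Cons.prems(2) ys by simp
        show "last (rev xs) \<noteq> hd ys'" using neq False by (simp add: last_rev)
      qed
      then have "distinct (rev xs @ x # ys')" by (rule nb_walk_distinct)
      moreover have "last xs = last ys'" using Cons.prems(4) False ys by simp
      ultimately show ?thesis using False by (auto) (metis disjoint_iff last_in_set)
    qed
  qed
qed (simp add: nb_walk_def)

text \<open>Backtracking is cancelled while the walk is built up from its end: if \<open>x\<close>
  is also the second vertex of the reduced tail, the first vertex of that tail is dropped instead of
  \<open>x\<close> being prepended.\<close>

lemma walk_imp_nb_walk:
  "graph_walk V E xs \<Longrightarrow> \<exists>ys. nb_walk ys \<and> hd ys = hd xs \<and> last ys = last xs"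
proof (induction xs)
  case (Cons x xs)
  show ?case
  proof (cases xs)
    case Nil
    then show ?thesis using Cons.prems
      by (intro exI[of _ "[x]"]) (auto simp: nb_walk_def walk_adj)
  next
    case (Cons y zs)
    have w: "graph_walk V E xs" "adj x y" "x \<in> V"
      using Cons.prems Cons unfolding walk_adj by auto
    from Cons.IH[OF w(1)] obtain ys where ys: "nb_walk ys" "hd ys = y" "last ys = last xs"
      using Cons by auto
    show ?thesis
    proof (cases ys rule: nonbacktracking.cases)
      case (1 a b c us)
      show ?thesis
      proof (cases "b = x")
        case True
        then show ?thesis using ys 1 w Cons nb_walk_ConsD[of a "b # c # us"]
          by (intro exI[of _ "b # c # us"]) auto
      next
        case False
        then show ?thesis using ys 1 w Cons
          by (intro exI[of _ "x # ys"]) (auto simp: nb_walk_def)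
      qed
    next
      case "2_1"
      then show ?thesis using ys by (simp add: nb_walk_def)
    next
      case ("2_2" v)
      then show ?thesis using ys w Cons
          by (intro exI[of _ "x # ys"]) (auto simp: nb_walk_def)
    next
      case ("2_3" v b)
      show ?thesis
      proof (cases "b = x")
        case True
        then show ?thesis using ys "2_3" w Cons nb_walk_ConsD[of v "[b]"]
          by (intro exI[of _ "[b]"]) auto
      next
        case False
        then show ?thesis using ys "2_3" w Cons
          by (intro exI[of _ "x # ys"]) (auto simp: nb_walk_def)
      qed
    qed
  qed
qed (simp add: graph_walk_def)

lemma geodesic_eqI: "nb_walk xs \<Longrightarrow> hd xs = x \<Longrightarrow> last xs = y \<Longrightarrow> geodesic x y = xs"
  unfolding geodesic_def using nb_walk_unique by (intro the_equality) auto

lemma geodesic: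
  assumes "x \<in> V" "y \<in> V"
  shows "nb_walk (geodesic x y)" "hd (geodesic x y) = x" "last (geodesic x y) = y"
proof -
  obtain xs where "graph_walk V E xs" "hd xs = x" "last xs = y"
    using graph_tree assms unfolding graph_tree_def graph_connected_def by blast
  then obtain ys where "nb_walk ys \<and> hd ys = x \<and> last ys = y" using walk_imp_nb_walk by metis
  then show "nb_walk (geodesic x y)" "hd (geodesic x y) = x" "last (geodesic x y) = y"
    using geodesic_eqI by auto
qed

lemma geodesic_snoc:
  assumes "x \<in> V" "adj p y" "geodesic x p = xs @ [p]" "xs \<noteq> [] \<Longrightarrow> last xs \<noteq> y"
  shows "geodesic x y = xs @ [p, y]"
proof (rule geodesic_eqI)
  have pV: "p \<in> V" "y \<in> V" using assms(2) adj_V adj_sym by blast+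
  have "nb_walk [p, y]" using assms(2) pV by (auto simp: nb_walk_def)
  then show "nb_walk (xs @ [p, y])"
    using nb_walk_append[of xs p "[y]"] geodesic(1)[OF assms(1) pV(1)] assms(3,4) by auto
  show "hd (xs @ [p, y]) = x" using geodesic(2)[OF assms(1) pV(1)] assms(3) by (cases xs) auto
qed simp

lemma geodesic_parent:
  assumes "x \<in> V" "y \<in> V" "x \<noteq> y"
  obtains p where "adj p y" "geodesic x y = geodesic x p @ [y]"
    "\<And>q. adj q y \<Longrightarrow> q \<noteq> p \<Longrightarrow> geodesic x q = geodesic x y @ [q]"
proof -
  note g = geodesic[OF assms(1,2)]
  obtain ys where ys: "geodesic x y = ys @ [y]"
    using g(1,3) unfolding nb_walk_def by (metis append_butlast_last_id)
  have "ys \<noteq> []" using g(2) assms(3) ys by auto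
  then obtain xs p where xs: "ys = xs @ [p]" by (metis append_butlast_last_id)
  have nb: "nb_walk (xs @ [p, y])" using g(1) ys xs by simp
  then have a: "adj p y" unfolding nb_walk_def by (simp add: successively_append_iff)
  have "nb_walk (xs @ [p])"
    using nb nonbacktracking_append[of xs p "[y]"] unfolding nb_walk_def
    by (auto simp: successively_append_iff)
  then have gp: "geodesic x p = xs @ [p]"
    using g(2) ys xs by (intro geodesic_eqI) (auto simp: hd_append split: if_splits)
  show thesis
  proof (rule that[OF a])
    show "geodesic x y = geodesic x p @ [y]" using ys xs gp by simp
    fix q assume "adj q y" "q \<noteq> p"
    then show "geodesic x q = geodesic x y @ [q]"
      using geodesic_snoc[OF assms(1), of y q "xs @ [p]"] ys xs adj_sym by auto
  qed
qed

lemma length_geodesic: "x \<in> V \<Longrightarrow> y \<in> V \<Longrightarrow> length (geodesic x y) = Suc (td x y)"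
  using geodesic(1)[of x y] unfolding td_def nb_walk_def by (cases "geodesic x y") auto

lemma td_0: "x \<in> V \<Longrightarrow> y \<in> V \<Longrightarrow> td x y = 0 \<longleftrightarrow> x = y"
proof
  assume V: "x \<in> V" "y \<in> V" and "td x y = 0"
  then have "length (geodesic x y) = 1" using length_geodesic by simp
  then show "x = y" using geodesic(2,3)[OF V] by (auto simp: length_Suc_conv)
next
  assume V: "x \<in> V" "y \<in> V" and "x = y"
  then have "geodesic x y = [x]" by (intro geodesic_eqI) (auto simp: nb_walk_def)
  then show "td x y = 0" by (simp add: td_def)
qed

lemma td_parent:
  assumes "x \<in> V" "y \<in> V" "x \<noteq> y"
  obtains p where "adj p y" "td x y = Suc (td x p)"
    "\<And>q. adj q y \<Longrightarrow> q \<noteq> p \<Longrightarrow> td x q = Suc (td x y)"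
proof -
  obtain p where p: "adj p y" "geodesic x y = geodesic x p @ [y]"
    "\<And>q. adj q y \<Longrightarrow> q \<noteq> p \<Longrightarrow> geodesic x q = geodesic x y @ [q]"
    using geodesic_parent[OF assms] by blast
  have "td x y = Suc (td x p)"
    using length_geodesic[OF assms(1,2)] length_geodesic[OF assms(1) adj_V[OF p(1)]] p(2) by simp
  moreover have "td x q = Suc (td x y)" if "adj q y" "q \<noteq> p" for q
    using length_geodesic[OF assms(1,2)] length_geodesic[OF assms(1) adj_V[OF that(1)]] p(3)[OF that]
    by simp
  ultimately show thesis using that p(1) by blast
qed

lemma td_adj: "adj x y \<Longrightarrow> td x y = 1"
proof -
  assume a: "adj x y"
  then have "geodesic x y = [x, y]"
    using adj_V adj_sym by (intro geodesic_eqI) (auto simp: nb_walk_def)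
  then show ?thesis by (simp add: td_def)
qed

sublocale tree_metric V adj td
proof
  show "td x y = td y x" if "x \<in> V" "y \<in> V" for x y
  proof -
    have "geodesic y x = rev (geodesic x y)"
      using geodesic[OF that] nb_walk_rev
      by (intro geodesic_eqI) (auto simp: hd_rev last_rev nb_walk_def)
    then show ?thesis by (simp add: td_def)
  qed
  show "td x z = Suc (td x y) \<or> td x y = Suc (td x z)" if "x \<in> V" "adj y z" for x y z
  proof (cases "x = y")
    case True
    then show ?thesis using td_adj[OF that(2)] td_0 that adj_V by auto
  next
    case False
    then show ?thesis using td_parent[OF that(1) adj_V[OF that(2)]] that(2) adj_sym by metis
  qed
  show "\<exists>p. adj p y \<and> td x y = Suc (td x p)" if "x \<in> V" "y \<in> V" "x \<noteq> y" for x y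
    using td_parent[OF that] by metis
  show "p = q" if "x \<in> V" "adj p y" "adj q y" "td x p < td x y" "td x q < td x y" for x y p q
  proof (cases "x = y")
    case True
    then have "td x y = 0" using that(1) td_0 by simp
    then show ?thesis using that by simp
  next
    case False
    then show ?thesis
      using td_parent[OF that(1) adj_V[OF adj_sym[OF that(2)]]] that by (metis Suc_lessD not_less_eq)
  qed
qed (auto simp: adj_V adj_sym td_0)

end

section \<open>Transitivity on spheres\<close>

text \<open>\<open>HOL-Algebra\<close> reserves the notation \<open>inv\<close> for inverses in a group.\<close>

abbreviation finv :: "('a \<Rightarrow> 'b) \<Rightarrow> 'b \<Rightarrow> 'a" where "finv f \<equiv> inv_into UNIV f"

section \<open>Distances, rays and bi-infinite lines\<close>

context tree_metric
begin

lemma adj_V2: "adj x y \<Longrightarrow> y \<in> V"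
  using adj_V adj_sym by blast

lemma td_refl [simp]: "x \<in> V \<Longrightarrow> td x x = 0"
  by (simp add: td_0)

lemma td_adj: "adj x y \<Longrightarrow> td x y = 1"
  using td_step[of x x y] adj_V by auto

lemma td_1_adj:
  assumes "x \<in> V" "y \<in> V" "td x y = 1"
  shows "adj x y"
proof -
  have "x \<noteq> y" using assms by auto
  then obtain p where p: "adj p y" "td x y = Suc (td x p)" using parent_ex assms by blast
  then have "x = p" using assms td_0 adj_V[OF p(1)] by simp
  then show ?thesis using p by simp
qed

lemma td_step': "x \<in> V \<Longrightarrow> adj y z \<Longrightarrow> td y x = Suc (td z x) \<or> td z x = Suc (td y x)"
  using td_step[of x y z] td_sym[of x y] td_sym[of x z] adj_V[of y z] adj_V2[of y z] by auto

lemma td_triangle: "x \<in> V \<Longrightarrow> y \<in> V \<Longrightarrow> z \<in> V \<Longrightarrow> td x z \<le> td x y + td y z"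
proof (induction "td y z" arbitrary: z)
  case 0
  then show ?case using td_0 by auto
next
  case (Suc n)
  then have "y \<noteq> z" using td_0 by auto
  then obtain p where p: "adj p z" "td y z = Suc (td y p)" using parent_ex Suc.prems by blast
  then have "td x p \<le> td x y + td y p" using Suc adj_V by simp
  then show ?case using td_step[OF Suc.prems(1) p(1)] p by auto
qed

lemma td_child:
  assumes "x \<in> V" "adj p y" "td x y = Suc (td x p)" "adj y q" "q \<noteq> p"
  shows "td x q = Suc (td x y)"
proof (rule ccontr)
  assume "td x q \<noteq> Suc (td x y)"
  then have "td x q < td x y" using td_step[OF assms(1,4)] by auto
  then show False using parent_unique[OF assms(1,2), of q] assms adj_sym by auto
qed

text \<open>A step from \<open>b\<close> towards either candidate is also a step towards
  \<open>a\<close>. As the neighbour of \<open>b\<close> nearer to \<open>a\<close> is unique, both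
  candidates take the same step, and the induction continues from there.\<close>

lemma td_between_unique:
  assumes "a \<in> V" "b \<in> V" "u \<in> V" "u' \<in> V"
    "td a u + td u b = td a b" "td a u' + td u' b = td a b" "td a u = td a u'"
  shows "u = u'"
  using assms
proof (induction "td u b" arbitrary: b)
  case 0
  then show ?case using td_0 by auto
next
  case (Suc n)
  have eq: "td u b = td u' b" using Suc.prems by linarith
  have step: "\<exists>p. adj p b \<and> td v b = Suc (td v p) \<and> td a b = Suc (td a p)"
    if v: "v \<in> V" "td a v + td v b = td a b" "td v b = Suc n" for v
  proof -
    have "v \<noteq> b" using v td_0 by auto
    then obtain p where p: "adj p b" "td v b = Suc (td v p)"
      using parent_ex[of v b] Suc.prems(2) v(1) by blast
    then have "td a p \<le> td a v + td v p" using td_triangle Suc.prems(1) v adj_V by blast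
    then show ?thesis using td_step[OF Suc.prems(1) p(1)] p v by auto
  qed
  obtain p where p: "adj p b" "td u b = Suc (td u p)" "td a b = Suc (td a p)"
    using step[OF Suc.prems(3,5) Suc.hyps(2)[symmetric]] by blast
  obtain q where q: "adj q b" "td u' b = Suc (td u' q)" "td a b = Suc (td a q)"
    using step[OF Suc.prems(4,6)] Suc.hyps(2) eq by metis
  have "p = q" using parent_unique[OF Suc.prems(1) p(1) q(1)] p q by simp
  have "n = td u p" "td a u + td u p = td a p" "td a u' + td u' p = td a p"
    using p q(2)[folded \<open>p = q\<close>] eq Suc.hyps(2) Suc.prems(5,6) by linarith+
  then show ?case using Suc.hyps(1)[of p] Suc.prems adj_V[OF p(1)] by blast
qed

text \<open>Removing the edge leaves \<open>z\<close> on the side of \<open>y\<close> and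
  \<open>w\<close> on the side of \<open>x\<close>, so their geodesic crosses it. In the induction
  along the geodesic from \<open>x\<close> to \<open>w\<close>, the distance from \<open>z\<close>
  cannot drop: otherwise \<open>w\<close> would be the neighbour of \<open>w'\<close> nearer to
  \<open>z\<close>, but that neighbour is \<open>y\<close> if \<open>w' = x\<close> and the
  predecessor of \<open>w'\<close> otherwise.\<close>

lemma td_edge_separation:
  assumes "adj x y" "z \<in> V" "w \<in> V" "td x z = Suc (td y z)" "td y w = Suc (td x w)"
  shows "td z w = Suc (td z y + td x w)"
  using assms(3,5)
proof (induction "td x w" arbitrary: w)
  case 0
  have V: "x \<in> V" "y \<in> V" using assms(1) adj_V adj_V2 by blast+
  then have "w = x" using 0 td_0[OF V(1) \<open>w \<in> V\<close>] by simp
  then show ?case using assms(2,4) td_sym[OF V(1) assms(2)] td_sym[OF V(2) assms(2)] V(1) by simp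
next
  case (Suc n)
  have xV: "x \<in> V" and yV: "y \<in> V" using assms(1) adj_V adj_V2 by blast+
  have "x \<noteq> w" using Suc.hyps xV by auto
  then obtain w' where w': "adj w' w" "td x w = Suc (td x w')"
    using parent_ex xV Suc.prems by blast
  have w'V: "w' \<in> V" using w' adj_V by blast
  have y': "td y w' = Suc (td x w')"
    using td_step[OF yV w'(1)] td_step'[OF w'V assms(1)] w'(2) Suc.prems(2) by linarith
  then have IH: "td z w' = Suc (td z y + td x w')" using Suc.hyps w'(2) w'V by simp
  have "td z w' \<noteq> Suc (td z w)"
  proof
    assume "td z w' = Suc (td z w)"
    show False
    proof (cases "w' = x")
      case True
      have "td z x = Suc (td z y)"
        using assms(4) td_sym[OF xV assms(2)] td_sym[OF yV assms(2)] by simp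
      then have "y = w" using \<open>td z w' = Suc (td z w)\<close> True parent_unique[OF assms(2) adj_sym[OF assms(1)], of w]
          adj_sym[OF w'(1)] by auto
      then show False using Suc.prems yV by simp
    next
      case False
      then obtain w'' where w'': "adj w'' w'" "td x w' = Suc (td x w'')"
        using parent_ex xV w'V by metis
      have w''V: "w'' \<in> V" using w'' adj_V by blast
      have "td y w'' = Suc (td x w'')"
        using td_step[OF yV w''(1)] td_step'[OF w''V assms(1)] w''(2) y' by linarith
      moreover have "td z w'' \<le> td z y + td y w''"
        using td_triangle assms(2) yV w''V by blast
      ultimately have "td z w'' < td z w'" using IH w''(2) by linarith
      then have "w'' = w" using \<open>td z w' = Suc (td z w)\<close>
          parent_unique[OF assms(2) w''(1) adj_sym[OF w'(1)]] by auto
      then show False using w' w'' by auto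
    qed
  qed
  then show ?case using td_step[OF assms(2) w'(1)] IH w'(2) by linarith
qed

text \<open>Local conditions, as for \<open>is_line\<close>, are easily checked for spliced
  sequences; injectivity follows from them by \<open>ray_inj\<close> and
  \<open>line_inj\<close>.\<close>

definition is_ray :: "(nat \<Rightarrow> 'a) \<Rightarrow> bool" where
  "is_ray r \<longleftrightarrow> (\<forall>k. adj (r k) (r (Suc k)) \<and> r k \<noteq> r (Suc (Suc k)))"

definition is_line :: "(int \<Rightarrow> 'a) \<Rightarrow> bool" where
  "is_line l \<longleftrightarrow> (\<forall>k. adj (l k) (l (k + 1)) \<and> l k \<noteq> l (k + 2))"

lemma is_ray_V: "is_ray r \<Longrightarrow> r k \<in> V"
  unfolding is_ray_def using adj_V by blast

lemma is_line_V: "is_line l \<Longrightarrow> l k \<in> V"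
  unfolding is_line_def using adj_V by blast

lemma is_ray_shift: "is_ray r \<Longrightarrow> is_ray (\<lambda>k. r (k + n))"
  unfolding is_ray_def by simp

lemma td_ray0: "is_ray r \<Longrightarrow> td (r 0) (r k) = k"
proof (induction k rule: less_induct)
  case (less k)
  consider "k = 0" | "k = 1" | n where "k = Suc (Suc n)"
    by (metis One_nat_def not0_implies_Suc)
  then show ?case
  proof cases
    case 3
    have a: "adj (r n) (r (Suc n))" "adj (r (Suc n)) (r (Suc (Suc n)))" "r (Suc (Suc n)) \<noteq> r n"
      using less.prems unfolding is_ray_def by metis+
    show ?thesis using td_child[OF is_ray_V[OF less.prems, of 0] a(1) _ a(2,3)] less 3 by auto
  next
    case 1
    then show ?thesis using td_refl[OF is_ray_V[OF less.prems]] by simp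
  next
    case 2
    then show ?thesis using td_adj[of "r 0" "r 1"] less.prems by (simp add: is_ray_def)
  qed
qed

lemma td_ray: "is_ray r \<Longrightarrow> td (r i) (r (i + k)) = k"
  using td_ray0[OF is_ray_shift, of r i k] by (simp add: add.commute)

lemma td_line: "is_line l \<Longrightarrow> td (l i) (l (i + int k)) = k"
proof -
  assume l: "is_line l"
  have "is_ray (\<lambda>k. l (i + int k))"
    unfolding is_ray_def
  proof
    fix k
    show "adj (l (i + int k)) (l (i + int (Suc k))) \<and> l (i + int k) \<noteq> l (i + int (Suc (Suc k)))"
      using l[unfolded is_line_def, rule_format, of "i + int k"] by (simp add: algebra_simps)
  qed
  from td_ray0[OF this, of k] show ?thesis by simp
qed

lemma td_line_le: "is_line l \<Longrightarrow> i \<le> j \<Longrightarrow> int (td (l i) (l j)) = j - i"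
  using td_line[of l i "nat (j - i)"] by simp

lemma line_inj:
  assumes l: "is_line l" and eq: "l i = l j"
  shows "i = j"
proof -
  have "td (l i) (l j) = 0" "td (l j) (l i) = 0" using td_refl[OF is_line_V[OF l]] eq by simp_all
  then show ?thesis using td_line_le[OF l, of i j] td_line_le[OF l, of j i] by linarith
qed

lemma ray_inj: "is_ray r \<Longrightarrow> inj r"
proof (rule injI)
  fix i j assume r: "is_ray r" "r i = r j"
  have "td (r i) (r j) = 0" "td (r j) (r i) = 0" using td_refl[OF is_ray_V[OF r(1)]] r(2) by simp_all
  then show "i = j"
    using td_ray[OF r(1), of i "j - i"] td_ray[OF r(1), of j "i - j"]
    by (cases "i \<le> j") simp_all
qed

end

text \<open>Degree at least 3 in the form in which it is used: any two vertices can be avoided when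
  choosing a neighbour.\<close>

locale thick_tree = tree_metric V adj td
  for V :: "'a set" and adj :: "'a \<Rightarrow> 'a \<Rightarrow> bool" and td :: "'a \<Rightarrow> 'a \<Rightarrow> nat" +
  assumes thick: "x \<in> V \<Longrightarrow> \<exists>c. adj x c \<and> c \<noteq> a \<and> c \<noteq> b"
begin

lemma ray_extension:
  assumes "adj a b"
  obtains r where "is_ray r" "r 0 = a" "r 1 = b"
proof -
  have "\<exists>f::nat \<Rightarrow> 'a \<times> 'a. \<forall>n. (adj (fst (f n)) (snd (f n)) \<and> (n = 0 \<longrightarrow> f n = (a, b))) \<and>
          (fst (f (Suc n)) = snd (f n) \<and> snd (f (Suc n)) \<noteq> fst (f n))"
  proof (rule dependent_nat_choice)
    show "\<exists>x. adj (fst x) (snd x) \<and> ((0::nat) = 0 \<longrightarrow> x = (a, b))" using assms by auto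
    fix x :: "'a \<times> 'a" and n :: nat
    assume "adj (fst x) (snd x) \<and> (n = 0 \<longrightarrow> x = (a, b))"
    then obtain c where "adj (snd x) c" "c \<noteq> fst x" using thick adj_V2 by blast
    then show "\<exists>y. (adj (fst y) (snd y) \<and> (Suc n = 0 \<longrightarrow> y = (a, b))) \<and>
       (fst y = snd x \<and> snd y \<noteq> fst x)"
      by (intro exI[of _ "(snd x, c)"]) auto
  qed
  then obtain f :: "nat \<Rightarrow> 'a \<times> 'a" where
    f: "\<And>n. adj (fst (f n)) (snd (f n))" "f 0 = (a, b)" "\<And>n. fst (f (Suc n)) = snd (f n)"
       "\<And>n. snd (f (Suc n)) \<noteq> fst (f n)" by blast
  show thesis
  proof (rule that[of "fst \<circ> f"])
    show "is_ray (fst \<circ> f)" unfolding is_ray_def using f by (metis comp_apply)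
  qed (use f in auto)
qed

text \<open>The geodesic from \<open>x\<close> is attached one vertex at a time. There is no
  backtracking at the joint because \<open>s 1\<close> is farther from \<open>x\<close> than
  \<open>s 0\<close>.\<close>

lemma ray_prepend:
  assumes "x \<in> V" "is_ray s" "td x (s 0) = n" "td x (s 1) = Suc n"
  shows "\<exists>r. is_ray r \<and> r 0 = x \<and> (\<forall>k. r (n + k) = s k)"
  using assms(2-)
proof (induction n arbitrary: s)
  case 0
  then have "s 0 = x" using td_0[OF assms(1) is_ray_V[OF 0(1)]] by simp
  then show ?case using 0 by (intro exI[of _ s]) auto
next
  case (Suc n)
  have "x \<noteq> s 0" using Suc.prems(2) assms(1) by auto
  then obtain p where p: "adj p (s 0)" "td x (s 0) = Suc (td x p)"
    using parent_ex assms(1) is_ray_V[OF Suc.prems(1)] by blast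
  define s' where "s' = case_nat p s"
  have "p \<noteq> s 1" using p(2) Suc.prems(2,3) by auto
  then have "is_ray s'"
    using Suc.prems(1) p unfolding is_ray_def s'_def by (auto split: nat.split)
  then have "\<exists>r. is_ray r \<and> r 0 = x \<and> (\<forall>k. r (n + k) = s' k)"
    using Suc.prems p by (intro Suc.IH) (auto simp: s'_def)
  then obtain r where r: "is_ray r" "r 0 = x" "\<And>k. r (n + k) = s' k" by blast
  have "r (Suc n + k) = s k" for k using r(3)[of "Suc k"] by (simp add: s'_def)
  then show ?case using r by blast
qed

lemma ray_through:
  assumes "x \<in> V" "w \<in> V"
  obtains r where "is_ray r" "r 0 = x" "r (td x w) = w"
proof -
  have "\<exists>c. adj w c \<and> td x c = Suc (td x w)"
  proof (cases "x = w")
    case True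
    obtain c where c: "adj w c" using thick[OF assms(2)] by blast
    then show ?thesis using td_adj[OF c] True assms(2) by (intro exI[of _ c]) simp
  next
    case False
    then obtain p where p: "adj p w" "td x w = Suc (td x p)" using parent_ex assms by blast
    then show ?thesis using thick[OF assms(2), of p p] td_child[OF assms(1) p] by blast
  qed
  then obtain c where c: "adj w c" "td x c = Suc (td x w)" by blast
  obtain s where s: "is_ray s" "s 0 = w" "s 1 = c" using ray_extension[OF c(1)] .
  obtain r where r: "is_ray r" "r 0 = x" "\<And>k. r (td x w + k) = s k"
    using ray_prepend[OF assms(1) s(1)] s c by metis
  show thesis using that[OF r(1,2)] r(3)[of 0] s by simp
qed

end

text \<open>\<open>line_trans\<close> is 2-transitivity on ends: an ordered pair of distinct ends is
  a line up to a shift of its parameter, whence the unknown \<open>s\<close>. Elements of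
  \<open>G\<close> are bijections of the whole type, so that composition and inversion are the usual
  ones.\<close>

locale line_transitive_group = thick_tree V adj td
  for V :: "'a set" and adj :: "'a \<Rightarrow> 'a \<Rightarrow> bool" and td :: "'a \<Rightarrow> 'a \<Rightarrow> nat" +
  fixes G :: "('a \<Rightarrow> 'a) set"
  assumes G_bij: "g \<in> G \<Longrightarrow> bij g"
    and G_id: "id \<in> G"
    and G_comp: "g \<in> G \<Longrightarrow> h \<in> G \<Longrightarrow> g \<circ> h \<in> G"
    and G_inv: "g \<in> G \<Longrightarrow> finv g \<in> G"
    and G_adj: "g \<in> G \<Longrightarrow> adj (g x) (g y) \<longleftrightarrow> adj x y"
    and line_trans: "is_line l \<Longrightarrow> is_line l' \<Longrightarrow> \<exists>g\<in>G. \<exists>s. \<forall>k. g (l k) = l' (k + s)"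
begin

lemma G_inv_left [simp]: "g \<in> G \<Longrightarrow> finv g (g x) = x"
  and G_inv_right [simp]: "g \<in> G \<Longrightarrow> g (finv g x) = x"
  using G_bij by (simp_all add: bij_is_inj bij_is_surj surj_f_inv_f)

lemma G_eq_iff [simp]: "g \<in> G \<Longrightarrow> g x = g y \<longleftrightarrow> x = y"
  using G_inv_left by metis

lemma G_V: "g \<in> G \<Longrightarrow> x \<in> V \<Longrightarrow> g x \<in> V"
proof -
  assume g: "g \<in> G" "x \<in> V"
  obtain c where "adj x c" using thick[OF g(2)] by blast
  then have "adj (g x) (g c)" using G_adj[OF g(1)] by simp
  then show "g x \<in> V" by (rule adj_V)
qed

lemma G_V_iff [simp]: "g \<in> G \<Longrightarrow> g x \<in> V \<longleftrightarrow> x \<in> V"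
  using G_V[of g x] G_V[of "finv g" "g x"] G_inv[of g] G_inv_left[of g x] by metis

lemma G_td_le: "g \<in> G \<Longrightarrow> x \<in> V \<Longrightarrow> y \<in> V \<Longrightarrow> td (g x) (g y) \<le> td x y"
proof (induction "td x y" arbitrary: y)
  case 0
  then have "x = y" using td_0 by simp
  then show ?case using 0 by simp
next
  case (Suc n)
  then have "x \<noteq> y" by auto
  then obtain p where p: "adj p y" "td x y = Suc (td x p)" using parent_ex Suc.prems by blast
  then have "td (g x) (g p) \<le> td x p" using Suc adj_V by simp
  moreover have "adj (g p) (g y)" using G_adj Suc.prems p by simp
  ultimately show ?case using td_step[OF G_V[OF Suc.prems(1,2)], of "g p" "g y"] p by linarith
qed

lemma G_td:
  assumes "g \<in> G" "x \<in> V" "y \<in> V"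
  shows "td (g x) (g y) = td x y"
  using G_td_le[OF assms] G_td_le[OF G_inv[OF assms(1)], of "g x" "g y"] assms by simp

lemma is_line_image: "g \<in> G \<Longrightarrow> is_line l \<Longrightarrow> is_line (\<lambda>k. g (l k))"
  unfolding is_line_def using G_adj by simp

text \<open>The axis of the hyperbolic element \<open>h\<close>: pull the translated end back along powers of \<open>h\<close>.\<close>

lemma axis_of_translation:
  assumes h: "h \<in> G" and l: "is_line l" and hl: "\<And>k. k \<ge> k0 \<Longrightarrow> h (l k) = l (k + s)" and s: "s > 0"
  obtains L where "is_line L" "\<And>k. h (L k) = L (k + s)"
proof -
  \<comment> \<open>Beyond \<open>k0\<close> the element \<open>h\<close> shifts \<open>l\<close> by
    \<open>s\<close>, so \<open>f k q\<close> is independent of \<open>q\<close> as soon as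
    \<open>k + q s\<close> reaches \<open>k0\<close>. The bound \<open>N k\<close> ensures this
    because \<open>s\<close> is at least 1.\<close>
  define f where "f k q = (finv h ^^ q) (l (k + int q * s))" for k q
  have f_Suc: "f k (Suc q) = f k q" if "k + int q * s \<ge> k0" for k q
  proof -
    have "l (k + int (Suc q) * s) = h (l (k + int q * s))"
      using hl[OF that] by (simp add: algebra_simps)
    then show ?thesis unfolding f_def funpow_Suc_right comp_apply using h by simp
  qed
  have f_add: "f k (q + j) = f k q" if "k + int q * s \<ge> k0" for k q j
  proof (induction j)
    case (Suc j)
    have "int q * s \<le> int (q + j) * s" using s by (intro mult_right_mono) auto
    then show ?case using Suc f_Suc[of k "q + j"] that by simp
  qed simp
  define N where "N k = nat (\<bar>k\<bar> + \<bar>k0\<bar>)" for k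
  have N: "k + int q * s \<ge> k0" if "q \<ge> N k" for k q
  proof -
    have "int q * 1 \<le> int q * s" using s by (intro mult_left_mono) auto
    then show ?thesis using that unfolding N_def by linarith
  qed
  define L where "L k = f k (N k)" for k
  have L: "L k = f k q" if "q \<ge> N k" for k q
    using f_add[OF N[OF order_refl], of k "q - N k"] that by (simp add: L_def)
  have pow_G: "finv h ^^ q \<in> G" for q
  proof (induction q)
    case (Suc q)
    then show ?case using G_comp[OF G_inv[OF h]] unfolding funpow.simps by blast
  qed (simp add: G_id[unfolded id_def] id_def)
  show thesis
  proof (rule that[of L])
    show "is_line L"
      unfolding is_line_def
    proof
      fix k
      let ?q = "max (N k) (max (N (k + 1)) (N (k + 2)))"
      have "is_line (\<lambda>j. (finv h ^^ ?q) (l j))" using is_line_image[OF pow_G l] .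
      from this[unfolded is_line_def, rule_format, of "k + int ?q * s"]
      show "adj (L k) (L (k + 1)) \<and> L k \<noteq> L (k + 2)"
        using L[of k ?q] L[of "k + 1" ?q] L[of "k + 2" ?q] by (simp add: f_def algebra_simps)
    qed
    fix k
    let ?q = "max (N k) (N (k + s))"
    have "h (L k) = h (f k (Suc ?q))" using L[of k "Suc ?q"] by simp
    also have "\<dots> = f (k + s) ?q" by (simp add: f_def h algebra_simps)
    also have "\<dots> = L (k + s)" using L[of "k + s" ?q] by simp
    finally show "h (L k) = L (k + s)" .
  qed
qed

text \<open>The axis \<open>L\<close> of \<open>h\<close> need not be \<open>l\<close> itself, but
  an element of \<open>G\<close> carrying \<open>L\<close> to \<open>l\<close> conjugates
  \<open>h\<close> into a translation of \<open>l\<close> by the same amount. For negative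
  \<open>s\<close> this is done with the inverse of \<open>h\<close>.\<close>

lemma translation_along_line:
  assumes h: "h \<in> G" and l: "is_line l" and hl: "\<And>k. k \<ge> k0 \<Longrightarrow> h (l k) = l (k + s)"
  shows "\<exists>t\<in>G. \<forall>k. t (l k) = l (k + s)"
proof -
  have pos: "\<exists>t\<in>G. \<forall>k. t (l k) = l (k + s)"
    if h: "h \<in> G" and hl: "\<And>k. k \<ge> k0 \<Longrightarrow> h (l k) = l (k + s)" and s: "s > 0" for h k0 s
  proof -
    obtain L where L: "is_line L" "\<And>k. h (L k) = L (k + s)"
      using axis_of_translation[OF h l hl s] by blast
    obtain g p where g: "g \<in> G" "\<And>k. g (L k) = l (k + p)" using line_trans[OF L(1) l] by blast
    have "(g \<circ> h \<circ> finv g) (l k) = l (k + s)" for k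
    proof -
      have "finv g (l k) = L (k - p)" using g(2)[of "k - p"] G_inv_left[OF g(1), of "L (k - p)"] by simp
      then show ?thesis using L(2)[of "k - p"] g(2)[of "k - p + s"] by (simp add: algebra_simps)
    qed
    moreover have "g \<circ> h \<circ> finv g \<in> G" using g h G_comp G_inv by blast
    ultimately show ?thesis by blast
  qed
  consider "s = 0" | "s > 0" | "s < 0" by linarith
  then show ?thesis
  proof cases
    case 1
    then show ?thesis using G_id by (intro bexI[of _ id]) auto
  next
    case 2
    then show ?thesis using pos[OF h hl] by blast
  next
    case 3
    have "finv h (l k) = l (k + - s)" if "k \<ge> k0 + s" for k
    proof -
      have "h (l (k - s)) = l k" using hl[of "k - s"] that by simp
      then show ?thesis using G_inv_left[OF h, of "l (k - s)"] by simp
    qed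
    then obtain t where t: "t \<in> G" "\<And>k. t (l k) = l (k - s)"
      using pos[OF G_inv[OF h], of "k0 + s" "- s"] 3 by auto
    have "finv t (l k) = l (k + s)" for k
      using t(2)[of "k + s"] G_inv_left[OF t(1), of "l (k + s)"] by simp
    then show ?thesis using G_inv[OF t(1)] by blast
  qed
qed

text \<open>The element provided by \<open>line_trans\<close> matches the lines up to a shift. It
  therefore shifts their common half by \<open>s\<close>, so \<open>translation_along_line\<close>
  yields a translation of \<open>l\<close> that cancels the shift.\<close>

lemma line_map_fixing_end:
  assumes l: "is_line l" "is_line l'" and eq: "\<And>k. k \<ge> 0 \<Longrightarrow> l k = l' k"
  shows "\<exists>h\<in>G. \<forall>k. h (l k) = l' k"
proof -
  obtain g s where g: "g \<in> G" "\<And>k. g (l k) = l' (k + s)" using line_trans[OF l] by blast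
  have "g (l k) = l (k + s)" if "k \<ge> max 0 (- s)" for k
    using g(2)[of k] eq[of "k + s"] that by simp
  then obtain t where t: "t \<in> G" "\<And>k. t (l k) = l (k + s)"
    using translation_along_line[OF g(1) l(1)] by blast
  have "(g \<circ> finv t) (l k) = l' k" for k
  proof -
    have "finv t (l k) = l (k - s)" using t(2)[of "k - s"] G_inv_left[OF t(1), of "l (k - s)"] by simp
    then show ?thesis using g(2)[of "k - s"] by simp
  qed
  then show ?thesis using G_comp[OF g(1) G_inv[OF t(1)]] by blast
qed

lemma is_line_join:
  assumes r: "is_ray r" "is_ray s" and eq: "r 0 = s 0" "r 1 \<noteq> s 1"
  shows "is_line (\<lambda>k. if k \<ge> 0 then r (nat k) else s (nat (- k)))"
  unfolding is_line_def
proof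
  fix k :: int
  consider "k \<ge> 0" | "k = - 1" | "k \<le> - 2" by linarith
  then show "adj (if k \<ge> 0 then r (nat k) else s (nat (- k)))
      (if k + 1 \<ge> 0 then r (nat (k + 1)) else s (nat (- (k + 1)))) \<and>
    (if k \<ge> 0 then r (nat k) else s (nat (- k))) \<noteq>
      (if k + 2 \<ge> 0 then r (nat (k + 2)) else s (nat (- (k + 2))))"
  proof cases
    case 1
    then have "nat (k + 1) = Suc (nat k)" "nat (k + 2) = Suc (Suc (nat k))" by auto
    then show ?thesis using r(1) 1 unfolding is_ray_def by auto
  next
    case 2
    have "adj (s 0) (s 1)" using r(2) unfolding is_ray_def by auto
    then show ?thesis using 2 eq adj_sym by auto
  next
    case 3
    define n where "n = nat (- (k + 2))"
    have *: "nat (- (k + 2)) = n" "nat (- (k + 1)) = Suc n" "nat (- k) = Suc (Suc n)"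
      using 3 unfolding n_def by auto
    show ?thesis
    proof (cases "k = - 2")
      case True
      then have "n = 0" by (simp add: n_def)
      then show ?thesis using True r(2) eq adj_sym unfolding is_ray_def
        by (auto simp: numeral_2_eq_2) metis
    next
      case False
      have "adj (s n) (s (Suc n)) \<and> s n \<noteq> s (Suc (Suc n)) \<and> adj (s (Suc n)) (s (Suc (Suc n)))"
        using r(2) unfolding is_ray_def by blast
      then show ?thesis using 3 False adj_sym[of "s (Suc n)" "s (Suc (Suc n))"] unfolding * by auto
    qed
  qed
qed

text \<open>A third ray from the common origin, leaving through a neighbour different from both
  \<open>r 1\<close> and \<open>r' 1\<close>, completes the two rays to lines with a common half;
  \<open>line_map_fixing_end\<close> fixes that half pointwise and matches the rest.\<close>

lemma ray_transitive:
  assumes "is_ray r" "is_ray r'" "r 0 = r' 0"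
  shows "\<exists>h\<in>G. \<forall>k. h (r k) = r' k"
proof -
  obtain u where u: "adj (r 0) u" "u \<noteq> r 1" "u \<noteq> r' 1"
    using thick[OF is_ray_V[OF assms(1)]] by metis
  obtain s where s: "is_ray s" "s 0 = r 0" "s 1 = u" using ray_extension[OF u(1)] .
  let ?l = "\<lambda>r k. if k \<ge> 0 then s (nat k) else r (nat (- k))"
  have "is_line (?l r)" "is_line (?l r')"
    using is_line_join[OF s(1) assms(1)] is_line_join[OF s(1) assms(2)] s u assms(3) by auto
  then obtain h where h: "h \<in> G" "\<And>k. h (?l r k) = ?l r' k"
    using line_map_fixing_end[of "?l r" "?l r'"] by (force simp del: of_nat_0_le_iff)
  have "h (r k) = r' k" for k
    using h(2)[of "- int k"] s assms(3) by (cases "k = 0") auto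
  then show ?thesis using h by blast
qed

lemma sphere_transitive:
  assumes "z \<in> V" "w \<in> V" "w' \<in> V" "td z w = td z w'"
  obtains g where "g \<in> G" "g z = z" "g w = w'"
proof -
  obtain r where r: "is_ray r" "r 0 = z" "r (td z w) = w" using ray_through[OF assms(1,2)] .
  obtain r' where r': "is_ray r'" "r' 0 = z" "r' (td z w') = w'" using ray_through[OF assms(1,3)] .
  obtain h where h: "h \<in> G" "\<And>k. h (r k) = r' k"
    using ray_transitive[OF r(1) r'(1)] r r' by auto
  show thesis using that[OF h(1)] h(2)[of 0] h(2)[of "td z w"] r r' assms(4) by simp
qed

text \<open>Vertices two steps apart are exchanged by \<open>sphere_transitive\<close> around their
  midpoint.\<close>

lemma even_transitive:
  "x \<in> V \<Longrightarrow> y \<in> V \<Longrightarrow> even (td x y) \<Longrightarrow> \<exists>g\<in>G. g x = y"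
proof (induction "td x y" arbitrary: y rule: less_induct)
  case less
  show ?case
  proof (cases "x = y")
    case True
    then show ?thesis using G_id by (intro bexI[of _ id]) auto
  next
    case False
    then obtain p where p: "adj p y" "td x y = Suc (td x p)" using parent_ex less.prems by blast
    then have "x \<noteq> p" using less.prems(1,3) by auto
    then obtain q where q: "adj q p" "td x p = Suc (td x q)"
      using parent_ex less.prems adj_V p by metis
    have V: "p \<in> V" "q \<in> V" using p q adj_V by blast+
    have "even (td x q)" "td x q < td x y" using less.prems(3) p(2) q(2) by auto
    then obtain g where g: "g \<in> G" "g x = q" using less.hyps less.prems(1) V(2) by metis
    have "td p q = td p y" using td_adj[OF p(1)] td_adj[OF adj_sym[OF q(1)]] by simp
    then obtain h where "h \<in> G" "h q = y" using sphere_transitive[OF V less.prems(2)] by blast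
    then show ?thesis using g G_comp[of h g] by (intro bexI[of _ "h \<circ> g"]) auto
  qed
qed

end

section \<open>Local simplicity\<close>

context line_transitive_group
begin

definition fixator :: "'a set \<Rightarrow> ('a \<Rightarrow> 'a) set" where
  "fixator S = {g \<in> G. \<forall>v\<in>S. g v = v}"

text \<open>Closed under the group operations; no topological closedness is meant.\<close>

definition closed_subgroup :: "('a \<Rightarrow> 'a) set \<Rightarrow> bool" where
  "closed_subgroup K \<longleftrightarrow> K \<subseteq> G \<and> id \<in> K \<and> (\<forall>g\<in>K. \<forall>h\<in>K. g \<circ> h \<in> K) \<and> (\<forall>g\<in>K. finv g \<in> K)"

definition star :: "'a \<Rightarrow> 'a set" where "star x = {v. adj x v}"

text \<open>In a chart at \<open>z\<close> that gives \<open>p\<close> colour 1, the fixator of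
  \<open>p\<close> and \<open>z\<close> acts on \<open>star z\<close> as
  \<open>F\<^sub>t(1)\<close>; \<open>K\<close> is to induce every permutation of that
  group.\<close>

definition full_at :: "'a \<Rightarrow> 'a \<Rightarrow> ('a \<Rightarrow> 'a) set \<Rightarrow> bool" where
  "full_at p z K \<longleftrightarrow> (\<forall>g\<in>fixator {p, z}. \<exists>k\<in>K. \<forall>v\<in>star z. k v = g v)"

definition trivial_at :: "'a \<Rightarrow> ('a \<Rightarrow> 'a) set \<Rightarrow> bool" where
  "trivial_at z K \<longleftrightarrow> (\<forall>k\<in>K. \<forall>v\<in>star z. k v = v)"

lemma fixatorI: "g \<in> G \<Longrightarrow> (\<And>v. v \<in> S \<Longrightarrow> g v = v) \<Longrightarrow> g \<in> fixator S"
  by (simp add: fixator_def)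

lemma fixatorD: "g \<in> fixator S \<Longrightarrow> g \<in> G" "g \<in> fixator S \<Longrightarrow> v \<in> S \<Longrightarrow> g v = v"
  by (simp_all add: fixator_def)

lemma fixator_mono: "S \<subseteq> T \<Longrightarrow> fixator T \<subseteq> fixator S"
  by (auto simp: fixator_def)

lemma fixator_comp: "g \<in> fixator S \<Longrightarrow> h \<in> fixator S \<Longrightarrow> g \<circ> h \<in> fixator S"
  by (simp add: fixator_def G_comp)

lemma finv_fixed: "g \<in> G \<Longrightarrow> g v = v \<Longrightarrow> finv g v = v"
  using G_inv_left[of g v] by simp

lemma fixator_inv: "g \<in> fixator S \<Longrightarrow> finv g \<in> fixator S"
  by (simp add: fixator_def G_inv finv_fixed)

lemma closed_subgroup_fixator: "closed_subgroup (fixator S)"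
  unfolding closed_subgroup_def
  using fixator_comp fixator_inv by (auto simp: fixator_def G_id)

lemma conj_G: "g \<in> G \<Longrightarrow> k \<in> G \<Longrightarrow> g \<circ> k \<circ> finv g \<in> G"
  by (simp add: G_comp G_inv)

lemma conj_fixator:
  assumes "g \<in> G" "g ` S \<subseteq> T" "T \<subseteq> g ` S" "k \<in> fixator S"
  shows "g \<circ> k \<circ> finv g \<in> fixator T"
proof (rule fixatorI)
  show "g \<circ> k \<circ> finv g \<in> G" using assms conj_G fixatorD by blast
  fix v assume "v \<in> T"
  then obtain u where "u \<in> S" "v = g u" using assms by blast
  then show "(g \<circ> k \<circ> finv g) v = v" using assms fixatorD by simp
qed

lemma star_iff: "v \<in> star x \<longleftrightarrow> adj x v"
  by (simp add: star_def)

lemma G_star: "g \<in> G \<Longrightarrow> g v \<in> star (g x) \<longleftrightarrow> v \<in> star x"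
  by (simp add: star_def G_adj)

lemma G_star': "g \<in> G \<Longrightarrow> g x = x \<Longrightarrow> g v \<in> star x \<longleftrightarrow> v \<in> star x"
  using G_star[of g v x] by simp

lemma finv_star: "g \<in> G \<Longrightarrow> g x = x \<Longrightarrow> finv g v \<in> star x \<longleftrightarrow> v \<in> star x"
  using G_star'[OF G_inv, of g x v] finv_fixed[of g x] by simp

lemma image_star: "g \<in> G \<Longrightarrow> g ` star x = star (g x)"
proof
  assume g: "g \<in> G"
  show "g ` star x \<subseteq> star (g x)" using G_star[OF g] by blast
  show "star (g x) \<subseteq> g ` star x"
  proof
    fix v assume "v \<in> star (g x)"
    then have "finv g v \<in> star x" using G_star[OF g, of "finv g v"] g by simp
    then show "v \<in> g ` star x" using G_inv_right[OF g, of v] by (metis imageI)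
  qed
qed

lemma image_fixes: "g \<in> fixator S \<Longrightarrow> g ` S = S"
  by (auto simp: fixator_def image_iff)

lemma image_stars: "g \<in> fixator S \<Longrightarrow> W \<subseteq> S \<Longrightarrow> g ` (S \<union> \<Union>(star ` W)) = S \<union> \<Union>(star ` W)"
proof -
  assume g: "g \<in> fixator S" "W \<subseteq> S"
  have "g ` star w = star w" if "w \<in> W" for w
    using image_star[OF fixatorD(1)[OF g(1)], of w] fixatorD(2)[OF g(1), of w] g(2) that by auto
  then have "g ` \<Union>(star ` W) = \<Union>(star ` W)" by (simp add: image_Union image_image)
  then show ?thesis using image_fixes[OF g(1)] by (simp add: image_Un)
qed

lemma conj_fixator_stars:
  "g \<in> fixator S \<Longrightarrow> W \<subseteq> S \<Longrightarrow> k \<in> fixator (S \<union> \<Union>(star ` W)) \<Longrightarrow>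
    g \<circ> k \<circ> finv g \<in> fixator (S \<union> \<Union>(star ` W))"
  using conj_fixator[of g "S \<union> \<Union>(star ` W)" "S \<union> \<Union>(star ` W)" k] image_stars[of g S W] fixatorD(1)
  by simp

lemma full_at_mono: "K \<subseteq> K' \<Longrightarrow> full_at p z K \<Longrightarrow> full_at p z K'"
  unfolding full_at_def by blast

lemma full_at_fixator_mono: "full_at p z (fixator T) \<Longrightarrow> S \<subseteq> T \<Longrightarrow> full_at p z (fixator S)"
  using full_at_mono[OF fixator_mono] by blast

definition tball :: "'a \<Rightarrow> nat \<Rightarrow> 'a set" where "tball x n = {v \<in> V. td x v \<le> n}"

lemma tball_image:
  assumes "g \<in> G" "g x = x" "x \<in> V"
  shows "g ` tball x n = tball x n"
proof -
  have sub: "h ` tball x n \<subseteq> tball x n" if "h \<in> G" "h x = x" for h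
    using G_td[OF that(1) assms(3)] that by (auto simp: tball_def)
  have "v \<in> g ` tball x n" if "v \<in> tball x n" for v
    using sub[OF G_inv[OF assms(1)] finv_fixed[OF assms(1,2)]] that G_inv_right[OF assms(1), of v]
    by (metis imageI subsetD)
  then show ?thesis using sub[OF assms(1,2)] by blast
qed

text \<open>Both \<open>u\<close> and \<open>g u\<close> lie on the geodesic from \<open>a\<close>
  to \<open>g b\<close>, at the same distance from \<open>a\<close>. Used for points at which the
  geodesics to \<open>b\<close> and to its image have not yet parted.\<close>

lemma between_fixed:
  assumes "g \<in> G" "a \<in> V" "b \<in> V" "u \<in> V" "g a = a" "td a u + td u b = td a b"
    "td a u + td u (g b) = td a (g b)"
  shows "g u = u"
proof (rule td_between_unique[OF assms(2)])
  show "g b \<in> V" "g u \<in> V" using assms by simp_all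
  show "td a (g u) + td (g u) (g b) = td a (g b)" "td a (g u) = td a u"
    using G_td[OF assms(1), of a u] G_td[OF assms(1), of u b] G_td[OF assms(1), of a b] assms by simp_all
qed (use assms in auto)

end

text \<open>\<open>local_simple\<close> speaks of the permutation group induced on
  \<open>star z\<close> without forming it: normality is required only up to agreement on
  \<open>star z\<close>, and the conclusion is that the induced group is trivial or everything.
  \<open>local_nonabelian\<close> likewise asks for non-commuting actions on
  \<open>star z\<close>.\<close>

locale locally_simple_group = line_transitive_group V adj td G
  for V :: "'a set" and adj :: "'a \<Rightarrow> 'a \<Rightarrow> bool" and td :: "'a \<Rightarrow> 'a \<Rightarrow> nat" and G +
  assumes finite_star: "x \<in> V \<Longrightarrow> finite (star x)"
    and local_simple: "adj p z \<Longrightarrow> closed_subgroup N \<Longrightarrow> N \<subseteq> fixator {p, z} \<Longrightarrow>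
       (\<And>g n. g \<in> fixator {p, z} \<Longrightarrow> n \<in> N \<Longrightarrow> \<exists>m\<in>N. \<forall>v\<in>star z. m v = g (n (finv g v))) \<Longrightarrow>
       trivial_at z N \<or> full_at p z N"
    and local_nonabelian: "adj p z \<Longrightarrow>
       \<exists>g\<in>fixator {p, z}. \<exists>h\<in>fixator {p, z}. \<exists>v\<in>star z. g (h v) \<noteq> h (g v)"
begin

text \<open>As \<open>K\<close> induces the whole simple group on \<open>star z\<close>, a subgroup
  normalised by \<open>K\<close> induces a normal subgroup of it.\<close>

lemma trivial_or_full:
  assumes "adj p z" "closed_subgroup N" "N \<subseteq> fixator {p, z}" "K \<subseteq> fixator {p, z}"
    "full_at p z K" "\<And>k n. k \<in> K \<Longrightarrow> n \<in> N \<Longrightarrow> k \<circ> n \<circ> finv k \<in> N"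
  shows "trivial_at z N \<or> full_at p z N"
proof (rule local_simple[OF assms(1-3)])
  fix g n assume g: "g \<in> fixator {p, z}" and n: "n \<in> N"
  obtain k where k: "k \<in> K" "\<And>v. v \<in> star z \<Longrightarrow> k v = g v"
    using assms(5) g unfolding full_at_def by blast
  have G: "g \<in> G" "k \<in> G" "n \<in> G" and z: "g z = z" "k z = z" "n z = z"
    using g n k(1) assms(3,4) fixatorD by blast+
  have "(k \<circ> n \<circ> finv k) v = g (n (finv g v))" if v: "v \<in> star z" for v
  proof -
    have gv: "finv g v \<in> star z" using finv_star[OF G(1) z(1)] v by simp
    then have "k (finv g v) = v" using k(2) G by simp
    then have "finv k v = finv g v" using G_inv_left[OF G(2), of "finv g v"] by simp
    moreover have "n (finv g v) \<in> star z" using G_star'[OF G(3) z(3)] gv by simp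
    ultimately show ?thesis using k(2) by simp
  qed
  then show "\<exists>m\<in>N. \<forall>v\<in>star z. m v = g (n (finv g v))" using assms(6)[OF k(1) n] by blast
qed

lemma full_not_trivial:
  assumes "adj p z" "full_at p z K"
  shows "\<not> trivial_at z K"
proof
  assume t: "trivial_at z K"
  have fixes_star: "g v = v" if "g \<in> fixator {p, z}" "v \<in> star z" for g v
    using assms(2) t that unfolding full_at_def trivial_at_def by metis
  obtain g h v where "g \<in> fixator {p, z}" "h \<in> fixator {p, z}" "v \<in> star z" "g (h v) \<noteq> h (g v)"
    using local_nonabelian[OF assms(1)] by blast
  then show False using fixes_star by metis
qed

text \<open>The elements of \<open>N\<close> are those inducing a central permutation on
  \<open>star z\<close>. The centre is normal, and it is not everything because the induced group is
  non-abelian; by simplicity it is trivial.\<close>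

lemma local_centre_trivial:
  assumes "adj p z" "q \<in> fixator {p, z}"
    and comm: "\<And>g v. g \<in> fixator {p, z} \<Longrightarrow> v \<in> star z \<Longrightarrow> q (g v) = g (q v)"
    and v: "v \<in> star z"
  shows "q v = v"
proof -
  let ?F = "fixator {p, z}"
  define N where "N = {n \<in> ?F. \<forall>g\<in>?F. \<forall>v\<in>star z. n (g v) = g (n v)}"
  have st: "g v \<in> star z" if "g \<in> ?F" "v \<in> star z" for g v
    using G_star'[OF fixatorD(1)[OF that(1)], of z v] fixatorD(2)[OF that(1), of z] that(2) by simp
  have "closed_subgroup N"
    unfolding closed_subgroup_def
  proof (intro conjI ballI)
    show "N \<subseteq> G" unfolding N_def fixator_def by blast
    show "id \<in> N" unfolding N_def fixator_def by (simp add: G_id)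
    show "m \<circ> n \<in> N" if mn: "m \<in> N" "n \<in> N" for m n
    proof -
      have F: "m \<in> ?F" "n \<in> ?F" using mn unfolding N_def by blast+
      have "m (n (g v)) = g (m (n v))" if "g \<in> ?F" "v \<in> star z" for g v
      proof -
        have "m (g (n v)) = g (m (n v))" using mn(1) that(1) st[OF F(2) that(2)] unfolding N_def by blast
        moreover have "n (g v) = g (n v)" using mn(2) that unfolding N_def by blast
        ultimately show ?thesis by simp
      qed
      then show ?thesis using fixator_comp[OF F] unfolding N_def by simp
    qed
    show "finv n \<in> N" if n: "n \<in> N" for n
    proof -
      have nF: "n \<in> ?F" and nG: "n \<in> G" using n unfolding N_def fixator_def by auto
      have "finv n (g v) = g (finv n v)" if g: "g \<in> ?F" and v: "v \<in> star z" for g v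
      proof -
        have "n (g (finv n v)) = g (n (finv n v))"
          using n g st[OF fixator_inv[OF nF] v] unfolding N_def by blast
        then have "n (g (finv n v)) = g v" using nG by simp
        then show ?thesis using G_inv_left[OF nG, of "g (finv n v)"] by simp
      qed
      then show ?thesis using fixator_inv[OF nF] unfolding N_def by blast
    qed
  qed
  moreover have "\<exists>m\<in>N. \<forall>v\<in>star z. m v = g (n (finv g v))" if g: "g \<in> ?F" and n: "n \<in> N" for g n
  proof (intro bexI[OF _ n] ballI)
    fix v assume v: "v \<in> star z"
    have "n (g (finv g v)) = g (n (finv g v))"
      using n g st[OF fixator_inv[OF g] v] unfolding N_def by blast
    then show "n v = g (n (finv g v))" using fixatorD(1)[OF g] by simp
  qed
  ultimately have "trivial_at z N \<or> full_at p z N"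
    using local_simple[OF assms(1), of N] unfolding N_def by blast
  moreover have "\<not> full_at p z N"
  proof
    assume f: "full_at p z N"
    obtain g h v where gh: "g \<in> ?F" "h \<in> ?F" "v \<in> star z" "g (h v) \<noteq> h (g v)"
      using local_nonabelian[OF assms(1)] by blast
    obtain n where n: "n \<in> N" "\<And>v. v \<in> star z \<Longrightarrow> n v = g v"
      using f gh(1) unfolding full_at_def by blast
    have "n (h v) = h (n v)" using n(1) gh(2,3) unfolding N_def by blast
    then show False using n(2)[OF gh(3)] n(2)[OF st[OF gh(2,3)]] gh(4) by simp
  qed
  moreover have "q \<in> N" using assms(2) comm unfolding N_def by blast
  ultimately show ?thesis using v unfolding trivial_at_def by blast
qed

text \<open>The intersection contains all commutators, hence it is not trivial at \<open>z\<close>.\<close>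

lemma full_at_Int:
  assumes "adj p z" "closed_subgroup M" "closed_subgroup N"
    "M \<subseteq> fixator {p, z}" "N \<subseteq> fixator {p, z}"
    "full_at p z M" "full_at p z N"
    "\<And>m n. m \<in> M \<Longrightarrow> n \<in> N \<Longrightarrow> m \<circ> n \<circ> finv m \<in> N"
    "\<And>m n. m \<in> M \<Longrightarrow> n \<in> N \<Longrightarrow> n \<circ> m \<circ> finv n \<in> M"
  shows "full_at p z (M \<inter> N)"
proof -
  note M = assms(2)[unfolded closed_subgroup_def]
  note N = assms(3)[unfolded closed_subgroup_def]
  have sub: "closed_subgroup (M \<inter> N)" unfolding closed_subgroup_def using M N by blast
  have nrm: "m \<circ> n \<circ> finv m \<in> M \<inter> N" if "m \<in> M" "n \<in> M \<inter> N" for m n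
  proof -
    have "m \<circ> n \<in> M" "finv m \<in> M" using M that by blast+
    then have "m \<circ> n \<circ> finv m \<in> M" using M by blast
    then show ?thesis using assms(8) that by blast
  qed
  have "trivial_at z (M \<inter> N) \<or> full_at p z (M \<inter> N)"
    by (rule trivial_or_full[OF assms(1) sub _ assms(4,6)]) (use assms(4) nrm in auto)
  moreover have "\<not> trivial_at z (M \<inter> N)"
  proof
    assume t: "trivial_at z (M \<inter> N)"
    obtain g h v where gh: "g \<in> fixator {p, z}" "h \<in> fixator {p, z}" "v \<in> star z" "g (h v) \<noteq> h (g v)"
      using local_nonabelian[OF assms(1)] by blast
    obtain m where m: "m \<in> M" "\<And>v. v \<in> star z \<Longrightarrow> m v = g v"
      using assms(6) gh(1) unfolding full_at_def by blast
    obtain n where n: "n \<in> N" "\<And>v. v \<in> star z \<Longrightarrow> n v = h v"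
      using assms(7) gh(2) unfolding full_at_def by blast
    have G: "m \<in> G" "n \<in> G" "g \<in> G" "h \<in> G" using m n M N gh fixatorD by blast+
    have gv: "g v \<in> star z" "h v \<in> star z"
      using G_star'[of g z v] G_star'[of h z v] gh fixatorD G by simp_all
    let ?c = "m \<circ> n \<circ> finv m \<circ> finv n"
    have "m \<circ> n \<circ> finv m \<in> N" "finv n \<in> N" using assms(8) m n N by blast+
    then have cN: "?c \<in> N" using N by blast
    have "n \<circ> finv m \<circ> finv n \<in> M" using assms(9)[of "finv m" n] m n M by blast
    then have "m \<circ> (n \<circ> finv m \<circ> finv n) \<in> M" using m M by blast
    then have "?c \<in> M \<inter> N" using cN by (simp add: o_assoc)
    moreover have "h (g v) \<in> star z" using G_star'[of h z "g v"] gv gh fixatorD G by simp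
    ultimately have "?c (h (g v)) = h (g v)" using t unfolding trivial_at_def by blast
    moreover have "h (g v) = n (m v)" using m n gh gv by simp
    ultimately have "m (n v) = h (g v)" using G by simp
    then show False using m(2)[OF gv(2)] n(2)[OF gh(3)] gh by simp
  qed
  ultimately show ?thesis by blast
qed

text \<open>Passage from pairs to joint independence: fixing one more star intersects two subgroups
  normalised by \<open>fixator S\<close>, and \<open>full_at_Int\<close> preserves fullness.\<close>

lemma full_at_fixator_stars:
  assumes "adj p z" "p \<in> S" "z \<in> S" "finite W" "W \<subseteq> S" "full_at p z (fixator S)"
    "\<And>w. w \<in> W \<Longrightarrow> full_at p z (fixator (S \<union> star w))"
  shows "full_at p z (fixator (S \<union> \<Union>(star ` W)))"
  using assms(4,5,7)
proof (induction W rule: finite_induct)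
  case empty
  then show ?case using assms(6) by simp
next
  case (insert w W)
  let ?M = "fixator (S \<union> \<Union>(star ` W))" and ?N = "fixator (S \<union> \<Union>(star ` {w}))"
  have sub: "fixator (S \<union> T) \<subseteq> fixator {p, z}" "fixator (S \<union> T) \<subseteq> fixator S" for T
    using fixator_mono assms(2,3) by auto
  have W: "W \<subseteq> S" "{w} \<subseteq> S" using insert.prems(1) by auto
  have "full_at p z (?M \<inter> ?N)"
  proof (rule full_at_Int[OF assms(1) closed_subgroup_fixator closed_subgroup_fixator sub(1) sub(1)])
    show "full_at p z ?M" using insert.IH insert.prems by blast
    show "full_at p z ?N" using insert.prems(2) by simp
    show "m \<circ> n \<circ> finv m \<in> ?N" if "m \<in> ?M" "n \<in> ?N" for m n
      using conj_fixator_stars[OF _ W(2)] that sub(2) by blast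
    show "n \<circ> m \<circ> finv n \<in> ?M" if "m \<in> ?M" "n \<in> ?N" for m n
      using conj_fixator_stars[OF _ W(1)] that sub(2) by blast
  qed
  moreover have "?M \<inter> ?N = fixator (S \<union> \<Union>(star ` insert w W))"
    by (auto simp: fixator_def)
  ultimately show ?case by simp
qed

text \<open>Goursat's alternative for the pair \<open>w\<close>, \<open>z\<close>. Since
  \<open>w\<close> is in \<open>S\<close>, \<open>fixator S\<close> preserves \<open>star w\<close>
  as a set and so normalises the smaller fixator.\<close>

lemma star_trivial_or_full:
  assumes "adj p z" "p \<in> S" "z \<in> S" "w \<in> S" "full_at p z (fixator S)"
  shows "trivial_at z (fixator (S \<union> star w)) \<or> full_at p z (fixator (S \<union> star w))"
proof (rule trivial_or_full[OF assms(1) closed_subgroup_fixator _ _ assms(5)])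
  show "fixator (S \<union> star w) \<subseteq> fixator {p, z}" "fixator S \<subseteq> fixator {p, z}"
    using fixator_mono assms(2,3) by auto
  show "k \<circ> n \<circ> finv k \<in> fixator (S \<union> star w)" if "k \<in> fixator S" "n \<in> fixator (S \<union> star w)" for k n
    using conj_fixator_stars[of k S "{w}" n] that assms(4) by simp
qed

text \<open>If the action at \<open>w\<close> determined the action at \<open>z\<close>, then so would the action at \<open>w'\<close>; but the
  actions at \<open>w\<close> and \<open>w'\<close> are independent.\<close>

lemma full_at_of_independent_pair:
  assumes "adj p z" "p \<in> S" "z \<in> S" "w \<in> S" "full_at p z (fixator S)"
    and w': "w' \<in> S" "q \<in> S" "adj q w'" "full_at q w' (fixator (S \<union> star w))"
    and g: "g \<in> G" "g ` S = S" "g z = z" "g w = w'"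
  shows "full_at p z (fixator (S \<union> star w))"
proof (rule ccontr)
  assume "\<not> full_at p z (fixator (S \<union> star w))"
  then have t: "trivial_at z (fixator (S \<union> star w))" using star_trivial_or_full[OF assms(1-5)] by blast
  have im: "g ` (S \<union> star w) = S \<union> star w'" using image_star[OF g(1)] g by (simp add: image_Un)
  \<comment> \<open>Conjugation by \<open>g\<close> preserves \<open>S\<close> and \<open>z\<close>
    and carries \<open>w\<close> to \<open>w'\<close>.\<close>
  have t': "trivial_at z (fixator (S \<union> star w'))"
    unfolding trivial_at_def
  proof (intro ballI)
    fix k v assume k: "k \<in> fixator (S \<union> star w')" and v: "v \<in> star z"
    have gi: "finv g \<in> G" using g G_inv by simp
    have "finv g ` (S \<union> star w') = S \<union> star w"
      using im[symmetric] G_inv_left[OF g(1)] by (simp add: image_image)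
    then have "finv g \<circ> k \<circ> finv (finv g) \<in> fixator (S \<union> star w)"
      using conj_fixator[OF gi _ _ k] by simp
    moreover have "finv g v \<in> star z" using finv_star[OF g(1,3)] v by simp
    ultimately have "(finv g \<circ> k \<circ> finv (finv g)) (finv g v) = finv g v"
      using t unfolding trivial_at_def by blast
    then have "finv g (k v) = finv g v" using gi by simp
    then show "k v = v" using gi by simp
  qed
  \<comment> \<open>Some \<open>k\<close> fixing \<open>star w\<close> copies \<open>h\<close> on
    \<open>star w'\<close>. Then \<open>k\<close> is trivial at \<open>z\<close> by
    \<open>t\<close>, and \<open>h\<close> divided by \<open>k\<close> is trivial at
    \<open>z\<close> by \<open>t'\<close>.\<close>
  have "trivial_at z (fixator S)"
    unfolding trivial_at_def
  proof (intro ballI)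
    fix h v assume h: "h \<in> fixator S" and v: "v \<in> star z"
    have "h \<in> fixator {q, w'}" using h w' fixator_mono[of "{q, w'}" S] by blast
    then obtain k where k: "k \<in> fixator (S \<union> star w)" "\<And>v. v \<in> star w' \<Longrightarrow> k v = h v"
      using w'(4) unfolding full_at_def by blast
    have G: "k \<in> G" "h \<in> G" using k h fixatorD by blast+
    have "finv k \<circ> h \<in> fixator (S \<union> star w')"
    proof (rule fixatorI)
      show "finv k \<circ> h \<in> G" using G G_comp G_inv by blast
      fix v assume "v \<in> S \<union> star w'"
      then consider "v \<in> S" | "v \<in> star w'" by blast
      then show "(finv k \<circ> h) v = v"
      proof cases
        case 1
        then show ?thesis using h k finv_fixed[OF G(1)] by (simp add: fixator_def)
      next
        case 2
        then show ?thesis using k(2)[OF 2, symmetric] G by simp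
      qed
    qed
    then have "finv k (h v) = v" using t' v unfolding trivial_at_def by auto
    moreover have "k v = v" using t k v unfolding trivial_at_def by blast
    ultimately show "h v = v" using G_inv_right[OF G(1), of "h v"] by simp
  qed
  then show False using full_not_trivial[OF assms(1,5)] by blast
qed

end

section \<open>Independence at the boundary of balls\<close>

context tree_metric
begin

text \<open>On the \<open>y\<close> side of the edge, geodesics from \<open>x\<close> pass through
  \<open>y\<close>, so \<open>z\<close> has the same parent seen from either end.\<close>

lemma parent_towards:
  assumes "adj x y" "adj p z" "td y z = Suc m" "td x z = Suc (Suc m)" "td x p = Suc m"
  shows "td y p = m"
proof -
  have V: "x \<in> V" "y \<in> V" "p \<in> V" "z \<in> V" using assms(1,2) adj_V adj_V2 by blast+
  have "y \<noteq> z" using assms(3) V by auto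
  then obtain p' where p': "adj p' z" "td y z = Suc (td y p')" using parent_ex V by blast
  have "td x p' < td x z" using td_step'[OF adj_V[OF p'(1)] assms(1)] p'(2) assms(3,4) by linarith
  then have "p' = p" using parent_unique[OF V(1) p'(1) assms(2)] assms(4,5) by linarith
  then show ?thesis using p'(2) assms(3) by simp
qed

end

context locally_simple_group
begin

lemma finite_tball: "x \<in> V \<Longrightarrow> finite (tball x n)"
proof (induction n)
  case 0
  then have "tball x 0 \<subseteq> {x}" using td_0 by (auto simp: tball_def)
  then show ?case by (rule finite_subset) simp
next
  case (Suc n)
  have "tball x (Suc n) \<subseteq> tball x n \<union> \<Union>(star ` tball x n)"
  proof
    fix v assume v: "v \<in> tball x (Suc n)"
    show "v \<in> tball x n \<union> \<Union>(star ` tball x n)"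
    proof (cases "x = v")
      case True
      then show ?thesis using v by (auto simp: tball_def)
    next
      case False
      then obtain p where p: "adj p v" "td x v = Suc (td x p)"
        using parent_ex Suc.prems v unfolding tball_def by blast
      then have "p \<in> tball x n" using v adj_V[OF p(1)] by (simp add: tball_def)
      then show ?thesis using p(1) star_iff by blast
    qed
  qed
  moreover have "finite (star v)" if "v \<in> tball x n" for v
    using that finite_star by (simp add: tball_def)
  ultimately show ?case using Suc by (meson finite_UN_I finite_UnI finite_subset)
qed

text \<open>For \<open>z\<close> on the sphere of radius \<open>n\<close>, this is the ball of
  radius \<open>n + 1\<close> without the children of \<open>z\<close>. Its fixator is trivial at
  all other vertices of that sphere.\<close>

definition punctured_ball :: "'a \<Rightarrow> nat \<Rightarrow> 'a \<Rightarrow> 'a set" where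
  "punctured_ball x n z = {v \<in> V. td x v \<le> Suc n \<and> \<not> (adj z v \<and> td x v = Suc n)}"

text \<open>Used with \<open>z\<close> on the side of \<open>y\<close>, at distance \<open>n\<close>
  from \<open>y\<close>. Its children are then at distance \<open>n + 2\<close> from
  \<open>x\<close>, and they are what is removed from the union of the two balls.\<close>

definition punctured_edge_ball :: "'a \<Rightarrow> 'a \<Rightarrow> nat \<Rightarrow> 'a \<Rightarrow> 'a set" where
  "punctured_edge_ball x y n z =
     {v \<in> V. (td x v \<le> Suc n \<or> td y v \<le> Suc n) \<and> \<not> (adj z v \<and> td x v = Suc (Suc n))}"

definition ball_independence :: "nat \<Rightarrow> bool" where
  "ball_independence n \<longleftrightarrow> (\<forall>x\<in>V. \<forall>p z. adj p z \<longrightarrow> td x z = n \<longrightarrow> td x p < n \<longrightarrow>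
     full_at p z (fixator (punctured_ball x n z)))"

definition edge_ball_independence :: "nat \<Rightarrow> bool" where
  "edge_ball_independence n \<longleftrightarrow> (\<forall>x y p z. adj x y \<longrightarrow> adj p z \<longrightarrow> td y z = n \<longrightarrow>
     td x z = Suc n \<longrightarrow> td x p = n \<longrightarrow> full_at p z (fixator (punctured_edge_ball x y n z)))"

text \<open>For \<open>w\<close> on the side of \<open>y\<close>, \<open>star w\<close> lies in the
  punctured ball around \<open>y\<close>, whose fixator is full at \<open>z\<close> by hypothesis.
  For \<open>w\<close> on the side of \<open>x\<close>, the hypothesis around \<open>x\<close> makes
  \<open>w\<close> and a sibling \<open>w'\<close> independent, and
  \<open>full_at_of_independent_pair\<close> applies.\<close>

lemma edge_ball_step:
  assumes P: "ball_independence (Suc m)"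
  shows "edge_ball_independence (Suc m)"
  unfolding edge_ball_independence_def
proof (intro allI impI)
  fix x y p z
  let ?n = "Suc m"
  let ?S = "tball x ?n \<union> tball y ?n"
  assume xy: "adj x y" and pz: "adj p z" and z: "td y z = ?n" "td x z = Suc ?n" and p: "td x p = ?n"
  have V: "x \<in> V" "y \<in> V" "p \<in> V" "z \<in> V" using xy pz adj_V adj_V2 by blast+
  \<comment> \<open>General in all vertices, since it is applied again with the ends of the edge
    exchanged and the sibling \<open>w'\<close> in the role of \<open>z\<close>.\<close>
  have cont: "tball x ?n \<union> tball y ?n \<union> star w \<subseteq> punctured_ball y ?n z"
    if "adj x y" "adj p z" "td y z = ?n" "td x z = Suc ?n" "td x p = ?n"
      "td y w = ?n" "w \<noteq> z" "w \<in> V" for x y p z w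
  proof
    have V: "x \<in> V" "y \<in> V" "p \<in> V" "z \<in> V" using that(1,2) adj_V adj_V2 by blast+
    fix v assume v: "v \<in> tball x ?n \<union> tball y ?n \<union> star w"
    then consider "v \<in> tball x ?n \<union> tball y ?n" | "v \<in> star w" by blast
    then show "v \<in> punctured_ball y ?n z"
    proof cases
      case 1
      then have vV: "v \<in> V" and d: "td x v \<le> ?n \<or> td y v \<le> ?n" by (auto simp: tball_def)
      have "\<not> (adj z v \<and> td y v = Suc ?n)"
      proof
        assume a: "adj z v \<and> td y v = Suc ?n"
        then have "td x v < td x z" using d that(4) by linarith
        moreover have "adj v z" using a adj_sym by blast
        ultimately have "v = p" using parent_unique[OF V(1) _ that(2), of v] that(4,5) by simp
        then show False using parent_towards[OF that(1-5)] a by simp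
      qed
      then show ?thesis using td_step'[OF vV that(1)] d vV unfolding punctured_ball_def by auto
    next
      case 2
      then have wv: "adj w v" by (simp add: star_iff)
      have "\<not> (adj z v \<and> td y v = Suc ?n)"
        using parent_unique[OF V(2) wv, of z] that(3,6,7) by auto
      then show ?thesis using td_step[OF V(2) wv] that(6) adj_V2[OF wv] unfolding punctured_ball_def by auto
    qed
  qed
  define W where "W = {w \<in> V. w \<noteq> z \<and>
    (td y w = ?n \<and> td x w = Suc ?n \<or> td x w = ?n \<and> td y w = Suc ?n)}"
  have WS: "W \<subseteq> ?S" unfolding W_def tball_def by auto
  have finW: "finite W" using finite_subset[OF WS] finite_tball V by simp
  have py: "td y p = m" using parent_towards[OF xy pz z p] .
  have pS: "p \<in> ?S" "z \<in> ?S" using p z V by (auto simp: tball_def)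
  have full: "full_at p z (fixator (punctured_ball y ?n z))"
    using P[unfolded ball_independence_def] V(2) pz z(1) py by auto
  have fS: "full_at p z (fixator ?S)"
  proof (rule full_at_fixator_mono[OF full])
    show "?S \<subseteq> punctured_ball y ?n z"
    proof
      fix v assume v: "v \<in> ?S"
      have "\<not> (adj z v \<and> td y v = Suc ?n)"
      proof
        assume a: "adj z v \<and> td y v = Suc ?n"
        then have "td x v < td x z" using v z by (auto simp: tball_def)
        moreover have "adj v z" using a adj_sym by blast
        ultimately have "v = p" using parent_unique[OF V(1) _ pz, of v] z p by simp
        then show False using py a by simp
      qed
      then show "v \<in> punctured_ball y ?n z"
        using td_step'[OF _ xy, of v] v unfolding punctured_ball_def by (auto simp: tball_def)
    qed
  qed
  have fw: "full_at p z (fixator (?S \<union> star w))" if w: "w \<in> W" for w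
  proof -
    have wV: "w \<in> V" and wz: "w \<noteq> z" using w by (auto simp: W_def)
    consider "td y w = ?n" | "td x w = ?n" "td y w = Suc ?n" using w by (auto simp: W_def)
    then show ?thesis
    proof cases
      case 1
      show ?thesis by (rule full_at_fixator_mono[OF full cont[OF xy pz z p 1 wz wV]])
    next
      case 2
      have "x \<noteq> w" using 2(1) V by auto
      then obtain q where q: "adj q w" "td x w = Suc (td x q)" using parent_ex V wV by blast
      have qV: "q \<in> V" using q adj_V by blast
      \<comment> \<open>Measuring from \<open>y\<close> gives \<open>q\<close> a parent
        \<open>q0\<close> even when \<open>q\<close> is \<open>x\<close>, in which case
        \<open>q0\<close> is \<open>y\<close>.\<close>
      have tq: "td y q = ?n"
        using parent_towards[OF adj_sym[OF xy] q(1)] td_step[OF V(2) q(1)] td_step'[OF qV xy] 2 q(2) by linarith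
      then have "y \<noteq> q" using V by auto
      then obtain q0 where q0: "adj q0 q" "td y q = Suc (td y q0)" using parent_ex V qV by blast
      obtain w' where w': "adj q w'" "w' \<noteq> w" "w' \<noteq> q0" using thick[OF qV] by blast
      have w'V: "w' \<in> V" using w' adj_V2 by blast
      have w'y: "td y w' = Suc ?n" using td_child[OF V(2) q0 w'(1,3)] tq by simp
      have w'x: "td x w' = ?n"
        using td_step[OF V(1) w'(1)] td_step'[OF w'V xy] 2(1) q(2) w'y by linarith
      \<comment> \<open>The geodesics from \<open>z\<close> to \<open>w\<close> and to
        \<open>w'\<close> both cross the edge, so an element fixing \<open>z\<close> and moving
        \<open>w\<close> to \<open>w'\<close> fixes \<open>x\<close> and \<open>y\<close> and
        preserves \<open>?S\<close>.\<close>
      have dw: "td z w = Suc (td z y + td x w)" "td z w' = Suc (td z y + td x w')"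
        using td_edge_separation[OF xy V(4)] wV w'V 2 w'x w'y z by simp_all
      have ds: "td z y = ?n" "td z x = Suc ?n" using z td_sym V by simp_all
      obtain g where g: "g \<in> G" "g z = z" "g w = w'"
        using sphere_transitive[OF V(4) wV w'V] dw 2 w'x by metis
      have gy: "g y = y" using between_fixed[OF g(1) V(4) wV V(2) g(2)] dw ds 2 w'x w'y g(3) by simp
      have gx: "g x = x" using between_fixed[OF g(1) V(4) wV V(1) g(2)] dw ds 2 w'x w'y g(3) by simp
      have gS: "g ` ?S = ?S" using tball_image[OF g(1)] gx gy V by (simp add: image_Un)
      have tq': "td x q = m" using q(2) 2(1) by simp
      have f': "full_at q w' (fixator (?S \<union> star w))"
      proof (rule full_at_fixator_mono)
        show "full_at q w' (fixator (punctured_ball x ?n w'))"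
          using P[unfolded ball_independence_def] V(1) w'(1) w'x tq' by auto
        show "?S \<union> star w \<subseteq> punctured_ball x ?n w'"
          using cont[OF adj_sym[OF xy] w'(1) w'x w'y tq 2(1)] w'(2) wV by (simp add: Un_commute)
      qed
      have inS: "w \<in> ?S" "w' \<in> ?S" "q \<in> ?S" using 2 w'x tq wV w'V qV by (auto simp: tball_def)
      show ?thesis
        by (rule full_at_of_independent_pair[OF pz pS inS(1) fS inS(2,3) w'(1) f' g(1) gS g(2,3)])
    qed
  qed
  show "full_at p z (fixator (punctured_edge_ball x y ?n z))"
  proof (rule full_at_fixator_mono[OF full_at_fixator_stars[OF pz pS finW WS fS fw]])
    show "punctured_edge_ball x y ?n z \<subseteq> ?S \<union> \<Union>(star ` W)"
    proof
      fix v assume v: "v \<in> punctured_edge_ball x y ?n z"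
      then have vV: "v \<in> V" and d: "td x v \<le> Suc ?n \<or> td y v \<le> Suc ?n"
        and nz: "\<not> (adj z v \<and> td x v = Suc (Suc ?n))" by (auto simp: punctured_edge_ball_def)
      show "v \<in> ?S \<union> \<Union>(star ` W)"
      proof (rule ccontr)
        assume n: "v \<notin> ?S \<union> \<Union>(star ` W)"
        then have far: "td x v > ?n" "td y v > ?n" using vV by (auto simp: tball_def)
        have notW: "w \<notin> W" if "adj w v" for w using n that star_iff by blast
        have "x \<noteq> v" "y \<noteq> v" using far V by auto
        show False
        proof (cases "td x v = Suc ?n")
          case True
          obtain w where w: "adj w v" "td x v = Suc (td x w)" using parent_ex V vV \<open>x \<noteq> v\<close> by blast
          have wV: "w \<in> V" using w adj_V by blast
          have "td x w = ?n" using w True by simp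
          moreover have "td y w = Suc ?n"
            using td_step[OF V(2) w(1)] td_step'[OF wV xy] td_step'[OF vV xy] far w(2) True by linarith
          moreover have "w \<noteq> z" using \<open>td x w = ?n\<close> z by auto
          ultimately show False using notW[OF w(1)] wV unfolding W_def by blast
        next
          case False
          then have y: "td y v = Suc ?n" "td x v = Suc (Suc ?n)"
            using d far td_step'[OF vV xy] by linarith+
          obtain w where w: "adj w v" "td y v = Suc (td y w)" using parent_ex V vV \<open>y \<noteq> v\<close> by blast
          have wV: "w \<in> V" using w adj_V by blast
          have "td y w = ?n" using w y by simp
          moreover have "td x w = Suc ?n"
            using td_step[OF V(1) w(1)] td_step'[OF wV xy] y w(2) by linarith
          moreover have "w \<noteq> z" using nz w(1) y(2) by blast
          ultimately show False using notW[OF w(1)] wV unfolding W_def by blast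
        qed
      qed
    qed
  qed
qed

text \<open>The branches at \<open>c\<close> replace the two sides of an edge. A vertex
  \<open>w\<close> in the branch of \<open>z\<close> is handled by the edge from \<open>c\<close>
  towards \<open>z\<close>; for another branch, the edge from \<open>c\<close> towards
  \<open>w\<close> makes \<open>w\<close> and its sibling \<open>w'\<close> independent.\<close>

lemma ball_step:
  assumes Q: "edge_ball_independence (Suc m)"
  shows "ball_independence (Suc (Suc m))"
  unfolding ball_independence_def
proof (intro ballI allI impI)
  fix c p z
  let ?n = "Suc m"
  let ?S = "tball c (Suc ?n)"
  assume cV: "c \<in> V" and pz: "adj p z" and z: "td c z = Suc ?n" and plt: "td c p < Suc ?n"
  have V: "p \<in> V" "z \<in> V" using pz adj_V adj_V2 by blast+
  have p: "td c p = ?n" using td_step[OF cV pz] z plt by linarith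
  have cont: "?S \<union> star w \<subseteq> punctured_edge_ball c y ?n z"
    if "adj c y" "td y w = ?n" "td c w = Suc ?n" "td c z = Suc ?n" "w \<noteq> z" for y w z
  proof
    fix v assume v: "v \<in> ?S \<union> star w"
    then consider "v \<in> ?S" | "adj w v" by (auto simp: star_iff)
    then show "v \<in> punctured_edge_ball c y ?n z"
    proof cases
      case 1
      then show ?thesis by (auto simp: tball_def punctured_edge_ball_def)
    next
      case 2
      have yV: "y \<in> V" using that(1) adj_V2 by blast
      have "\<not> (adj z v \<and> td c v = Suc (Suc ?n))"
        using parent_unique[OF cV 2, of z] that(3-5) by auto
      then show ?thesis using td_step[OF yV 2] that(2) adj_V2[OF 2] unfolding punctured_edge_ball_def by auto
    qed
  qed
  have towards: "\<exists>y. adj c y \<and> td y w = ?n" if w: "w \<in> V" "td c w = Suc ?n" for w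
  proof -
    have "w \<noteq> c" using w cV by auto
    then obtain y where y: "adj y c" "td w c = Suc (td w y)" using parent_ex w cV by blast
    then have "td y w = ?n" using td_sym[OF cV w(1)] td_sym[OF adj_V[OF y(1)] w(1)] w(2) by simp
    then show ?thesis using adj_sym[OF y(1)] by blast
  qed
  obtain y where y: "adj c y" "td y z = ?n" using towards V z by blast
  have yV: "y \<in> V" using y adj_V2 by blast
  define W where "W = {w \<in> V. w \<noteq> z \<and> td c w = Suc ?n}"
  have WS: "W \<subseteq> ?S" unfolding W_def tball_def by auto
  have finW: "finite W" using finite_subset[OF WS] finite_tball cV by simp
  have pS: "p \<in> ?S" "z \<in> ?S" using p z V by (auto simp: tball_def)
  have full: "full_at p z (fixator (punctured_edge_ball c y ?n z))"
    using Q[unfolded edge_ball_independence_def] y pz z p by blast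
  have fS: "full_at p z (fixator ?S)"
    by (rule full_at_fixator_mono[OF full]) (auto simp: tball_def punctured_edge_ball_def)
  have fw: "full_at p z (fixator (?S \<union> star w))" if w: "w \<in> W" for w
  proof -
    have wV: "w \<in> V" and wz: "w \<noteq> z" and wc: "td c w = Suc ?n" using w by (auto simp: W_def)
    consider "td y w = ?n" | "td y w = Suc (Suc ?n)" using td_step'[OF wV y(1)] wc by linarith
    then show ?thesis
    proof cases
      case 1
      show ?thesis by (rule full_at_fixator_mono[OF full cont[OF y(1) 1 wc z wz]])
    next
      case 2
      obtain y' where y': "adj c y'" "td y' w = ?n" using towards wV wc by blast
      have y'V: "y' \<in> V" using y' adj_V2 by blast
      have yy': "y \<noteq> y'" using 2 y' by auto
      have "c \<noteq> w" using wc cV by auto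
      then obtain q where q: "adj q w" "td c w = Suc (td c q)" using parent_ex cV wV by blast
      have qV: "q \<in> V" using q adj_V by blast
      have tq: "td c q = ?n" using q wc by simp
      have tq': "td y' q = m" using parent_towards[OF y'(1) q(1) y'(2) wc tq] .
      \<comment> \<open>As \<open>?n\<close> is positive, \<open>q\<close> differs from
        \<open>c\<close>, so the sibling \<open>w'\<close> lies in the same branch as
        \<open>w\<close>.\<close>
      have "c \<noteq> q" using tq cV by auto
      then obtain q0 where q0: "adj q0 q" "td c q = Suc (td c q0)" using parent_ex cV qV by blast
      obtain w' where w': "adj q w'" "w' \<noteq> w" "w' \<noteq> q0" using thick[OF qV] by blast
      have w'V: "w' \<in> V" using w' adj_V2 by blast
      have w'c: "td c w' = Suc ?n" using td_child[OF cV q0 w'(1,3)] tq by simp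
      have w'y': "td y' w' = ?n"
        using td_step[OF y'V w'(1)] td_step'[OF w'V y'(1)] tq' w'c by linarith
      have w'y: "td y w' = Suc (Suc ?n)"
      proof (rule ccontr)
        assume "td y w' \<noteq> Suc (Suc ?n)"
        then have "td y w' < td c w'" using td_step'[OF w'V y(1)] w'c by linarith
        moreover have "td y' w' < td c w'" using w'y' w'c by simp
        ultimately have "y = y'"
          using parent_unique[OF w'V adj_sym[OF y(1)] adj_sym[OF y'(1)]]
            td_sym[OF w'V cV] td_sym[OF w'V yV] td_sym[OF w'V y'V] by simp
        then show False using yy' by simp
      qed
      have dw: "td z w = Suc (td z y + td c w)" "td z w' = Suc (td z y + td c w')"
        using td_edge_separation[OF y(1) V(2)] wV w'V wc 2 w'c w'y z y(2) by simp_all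
      have ds: "td z y = ?n" "td z c = Suc ?n" using y z td_sym V cV yV by simp_all
      obtain g where g: "g \<in> G" "g z = z" "g w = w'"
        using sphere_transitive[OF V(2) wV w'V] dw wc w'c by metis
      have gc: "g c = c" using between_fixed[OF g(1) V(2) wV cV g(2)] dw ds wc w'c g(3) by simp
      have gS: "g ` ?S = ?S" using tball_image[OF g(1) gc cV] .
      have f': "full_at q w' (fixator (?S \<union> star w))"
      proof (rule full_at_fixator_mono)
        show "full_at q w' (fixator (punctured_edge_ball c y' ?n w'))"
          using Q[unfolded edge_ball_independence_def] y'(1) w'(1) w'y' w'c tq by blast
        show "?S \<union> star w \<subseteq> punctured_edge_ball c y' ?n w'"
          using cont[OF y'(1) y'(2) wc w'c] w'(2) by simp
      qed
      have inS: "w \<in> ?S" "w' \<in> ?S" "q \<in> ?S" using wc w'c tq wV w'V qV by (auto simp: tball_def)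
      show ?thesis
        by (rule full_at_of_independent_pair[OF pz pS inS(1) fS inS(2,3) w'(1) f' g(1) gS g(2,3)])
    qed
  qed
  show "full_at p z (fixator (punctured_ball c (Suc ?n) z))"
  proof (rule full_at_fixator_mono[OF full_at_fixator_stars[OF pz pS finW WS fS fw]])
    show "punctured_ball c (Suc ?n) z \<subseteq> ?S \<union> \<Union>(star ` W)"
    proof
      fix v assume v: "v \<in> punctured_ball c (Suc ?n) z"
      then have vV: "v \<in> V" and d: "td c v \<le> Suc (Suc ?n)"
        and nz: "\<not> (adj z v \<and> td c v = Suc (Suc ?n))" by (auto simp: punctured_ball_def)
      show "v \<in> ?S \<union> \<Union>(star ` W)"
      proof (cases "td c v \<le> Suc ?n")
        case True
        then show ?thesis using vV by (simp add: tball_def)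
      next
        case False
        then have dv: "td c v = Suc (Suc ?n)" using d by linarith
        have "c \<noteq> v" using dv cV by auto
        then obtain w where w: "adj w v" "td c v = Suc (td c w)" using parent_ex cV vV by blast
        have "w \<in> W" using w dv nz adj_V[OF w(1)] unfolding W_def by auto
        then show ?thesis using w(1) star_iff by blast
      qed
    qed
  qed
qed

end

section \<open>Independence at a single star\<close>

context locally_simple_group
begin

abbreviation star_fixator :: "'a \<Rightarrow> ('a \<Rightarrow> 'a) set" where
  "star_fixator x \<equiv> fixator (insert x (star x))"

lemma conj_star_fixator:
  assumes "g \<in> G" "k \<in> star_fixator x"
  shows "g \<circ> k \<circ> finv g \<in> star_fixator (g x)"
  using conj_fixator[OF assms(1) _ _ assms(2), of "insert (g x) (star (g x))"] image_star[OF assms(1), of x]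
  by simp

lemma conj_star_fixator':
  assumes "g \<in> G" "g x = x" "k \<in> star_fixator x"
  shows "g \<circ> k \<circ> finv g \<in> star_fixator x"
  using conj_star_fixator[OF assms(1,3)] assms(2) by simp

lemma full_at_pair: "full_at p z (fixator {p, z})"
  unfolding full_at_def by blast

text \<open>Once \<open>w\<close> has been moved to \<open>w1\<close>, the stabiliser of
  \<open>w1\<close> is transitive on the sphere of radius 2 around it. Moving one neighbour of
  \<open>c\<close> to another, it fixes the midpoint \<open>c\<close>.\<close>

lemma star_two_transitive:
  assumes "adj c w" "adj c z" "w \<noteq> z" "adj c w1" "adj c w2" "w1 \<noteq> w2"
  obtains g where "g \<in> G" "g c = c" "g w = w1" "g z = w2"
proof -
  have V: "c \<in> V" "w \<in> V" "z \<in> V" "w1 \<in> V" "w2 \<in> V" using assms adj_V adj_V2 by blast+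
  obtain g where g: "g \<in> G" "g c = c" "g w = w1"
    using sphere_transitive[OF V(1,2,4)] td_adj[OF assms(1)] td_adj[OF assms(4)] by metis
  have gz: "adj c (g z)" using G_adj[OF g(1), of c z] g(2) assms(2) by simp
  have gzV: "g z \<in> V" using gz adj_V2 by blast
  have ne: "g z \<noteq> w1" using g assms(3) G_eq_iff[OF g(1), of z w] by auto
  have d1: "td w1 c = 1" using td_adj[OF adj_sym[OF assms(4)]] .
  have dist2: "td w1 u = 2" if "adj c u" "u \<noteq> w1" for u
    using td_child[OF V(4) adj_sym[OF assms(4)] _ that] d1 V(4) by simp
  obtain h where h: "h \<in> G" "h w1 = w1" "h (g z) = w2"
    using sphere_transitive[OF V(4) gzV V(5)] dist2[OF gz ne] dist2[OF assms(5)] assms(6) by metis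
  have "h c = c"
    using between_fixed[OF h(1) V(4) gzV V(1) h(2)] h(3) d1 td_adj[OF gz] td_adj[OF assms(5)]
      dist2[OF gz ne] dist2[OF assms(5)] assms(6) by simp
  then show thesis using that[of "h \<circ> g"] g h G_comp by simp
qed

text \<open>A vertex stabiliser is infinite, hence not determined by its action on finitely many vertices.\<close>

lemma star_not_determining:
  assumes x: "x \<in> V"
  shows "\<exists>k\<in>star_fixator x. \<exists>v\<in>V. k v \<noteq> v"
proof (rule ccontr)
  assume "\<not> (\<exists>k\<in>star_fixator x. \<exists>v\<in>V. k v \<noteq> v)"
  then have triv: "\<And>k v. k \<in> star_fixator x \<Longrightarrow> v \<in> V \<Longrightarrow> k v = v" by blast
  obtain y where "adj x y" using thick[OF x] by blast
  then obtain r where r: "is_ray r" "r 0 = x" using ray_extension by metis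
  have rV: "r k \<in> V" for k using is_ray_V[OF r(1)] .
  have dr: "td x (r k) = k" for k using td_ray0[OF r(1), of k] r(2) by simp
  have ex: "\<exists>g\<in>G. (\<forall>j\<le>k. g (r j) = r j) \<and> g (r (Suc k)) \<noteq> r (Suc k)" for k
  proof -
    have a: "adj (r k) (r (Suc k))" using r(1) unfolding is_ray_def by blast
    have "\<exists>w. adj (r k) w \<and> w \<noteq> r (Suc k) \<and> td x w = Suc k"
    proof (cases k)
      case 0
      obtain w where "adj (r k) w" "w \<noteq> r (Suc k)" using thick[OF rV] by metis
      then show ?thesis using td_adj[of x w] r(2) 0 by auto
    next
      case (Suc i)
      have b: "adj (r i) (r k)" using r(1) Suc unfolding is_ray_def by blast
      obtain w where w: "adj (r k) w" "w \<noteq> r (Suc k)" "w \<noteq> r i" using thick[OF rV] by metis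
      then show ?thesis using td_child[OF x b _ w(1,3)] dr[of k] dr[of i] Suc by auto
    qed
    then obtain w where w: "adj (r k) w" "w \<noteq> r (Suc k)" "td x w = Suc k" by blast
    have wV: "w \<in> V" using w adj_V2 by blast
    obtain g where g: "g \<in> G" "g x = x" "g (r (Suc k)) = w"
      using sphere_transitive[OF x rV wV] dr w(3) by metis
    have "g (r j) = r j" if "j \<le> k" for j
    proof (rule between_fixed[OF g(1) x rV[of "Suc k"] rV g(2)])
      have "td (r j) (r (Suc k)) = Suc k - j" using td_ray[OF r(1), of j "Suc k - j"] that by simp
      then show "td x (r j) + td (r j) (r (Suc k)) = td x (r (Suc k))" using that dr by simp
      have "td (r j) (r k) = k - j" using td_ray[OF r(1), of j "k - j"] that by simp
      then have "td (r j) w \<le> Suc k - j"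
        using td_triangle[OF rV rV wV, of j k] td_adj[OF w(1)] that by simp
      moreover have "td x w \<le> td x (r j) + td (r j) w" using td_triangle x rV wV by blast
      ultimately show "td x (r j) + td (r j) (g (r (Suc k))) = td x (g (r (Suc k)))"
        using g(3) w(3) dr that by simp
    qed
    then show ?thesis using g w(2) by auto
  qed
  obtain g where g: "\<And>k. g k \<in> G" "\<And>k j. j \<le> k \<Longrightarrow> g k (r j) = r j" "\<And>k. g k (r (Suc k)) \<noteq> r (Suc k)"
    using ex by metis
  have gx: "g k x = x" for k using g(2)[of 0 k] r(2) by simp
  \<comment> \<open>Finitely many actions on \<open>star x\<close> are possible, so
    \<open>g i\<close> and \<open>g j\<close> agree there for some \<open>i < j\<close>. Their
    quotient is then trivial on \<open>V\<close>, although \<open>g j\<close> fixes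
    \<open>r (Suc i)\<close> and \<open>g i\<close> moves it.\<close>
  let ?R = "\<lambda>k. restrict (g k) (star x)"
  have "?R ` UNIV \<subseteq> star x \<rightarrow>\<^sub>E star x"
    using G_star'[OF g(1) gx] by auto
  then have "finite (range ?R)"
    using finite_subset finite_PiE[OF finite_star[OF x]] finite_star[OF x] by metis
  then have "\<not> inj ?R" using finite_imageD infinite_UNIV_nat by blast
  then obtain i j where ij: "i < j" "?R i = ?R j"
    unfolding inj_def by (metis linorder_neqE_nat)
  have "finv (g i) \<circ> g j \<in> star_fixator x"
  proof (rule fixatorI)
    show "finv (g i) \<circ> g j \<in> G" using g(1) G_comp G_inv by blast
    fix v assume v: "v \<in> insert x (star x)"
    have "g i v = g j v"
    proof (cases "v = x")
      case False
      then have "v \<in> star x" using v by simp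
      then show ?thesis using fun_cong[OF ij(2), of v] by simp
    qed (simp add: gx)
    then show "(finv (g i) \<circ> g j) v = v" using G_inv_left[OF g(1), of i v] by simp
  qed
  then have "finv (g i) (g j (r (Suc i))) = r (Suc i)" using triv[OF _ rV] by fastforce
  then have "g i (r (Suc i)) = r (Suc i)"
    using g(2)[of "Suc i" j] ij(1) G_inv_right[OF g(1), of i "r (Suc i)"] by simp
  then show False using g(3) by blast
qed

text \<open>Failure means that fixing \<open>star x\<close> entails fixing \<open>star y\<close>,
  and the converse is shown to follow. Transitivity on edges then makes all star fixators equal, so
  fixing one star means fixing the whole tree, against \<open>star_not_determining\<close>.\<close>

lemma star_independence:
  assumes xy: "adj x y"
  shows "full_at x y (star_fixator x)"
proof (rule ccontr)
  assume nf: "\<not> full_at x y (star_fixator x)"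
  have dich: "trivial_at v (star_fixator u) \<or> full_at u v (star_fixator u)" if uv: "adj u v" for u v
  proof (rule trivial_or_full[OF uv closed_subgroup_fixator _ order_refl full_at_pair])
    show "star_fixator u \<subseteq> fixator {u, v}" using uv by (intro fixator_mono) (simp add: star_iff)
    show "k \<circ> n \<circ> finv k \<in> star_fixator u" if "k \<in> fixator {u, v}" "n \<in> star_fixator u" for k n
      using conj_star_fixator'[of k u n] that fixatorD by simp
  qed
  have sub: "star_fixator u \<subseteq> star_fixator v" if "trivial_at v (star_fixator u)" "adj u v" for u v
  proof
    fix k assume k: "k \<in> star_fixator u"
    show "k \<in> star_fixator v"
    proof (rule fixatorI)
      show "k \<in> G" using k fixatorD by blast
      fix s assume "s \<in> insert v (star v)"
      then consider "s = v" | "s \<in> star v" by blast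
      then show "k s = s"
      proof cases
        case 1
        then show ?thesis using fixatorD(2)[OF k, of v] that(2) star_iff by simp
      qed (use that(1) k in \<open>simp add: trivial_at_def\<close>)
    qed
  qed
  have tx: "trivial_at y (star_fixator x)" using dich[OF xy] nf by blast
  \<comment> \<open>Otherwise any \<open>h\<close> fixing \<open>x\<close> and \<open>y\<close> is
    copied on \<open>star x\<close> by some \<open>k\<close> fixing \<open>star y\<close>. The
    quotient fixes \<open>star x\<close>, hence \<open>star y\<close>, so \<open>h\<close> itself
    would be trivial at \<open>y\<close>.\<close>
  have "\<not> full_at y x (star_fixator y)"
  proof
    assume f: "full_at y x (star_fixator y)"
    have "trivial_at y (fixator {x, y})"
      unfolding trivial_at_def
    proof (intro ballI)
      fix h v assume h: "h \<in> fixator {x, y}" and v: "v \<in> star y"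
      obtain k where k: "k \<in> star_fixator y" "\<And>u. u \<in> star x \<Longrightarrow> k u = h u"
        using f h unfolding full_at_def by (metis insert_commute)
      have G: "k \<in> G" "h \<in> G" using k h fixatorD by blast+
      have kx: "k x = x" using fixatorD(2)[OF k(1), of x] adj_sym[OF xy] star_iff by simp
      have "finv k \<circ> h \<in> star_fixator x"
      proof (rule fixatorI)
        show "finv k \<circ> h \<in> G" using G G_comp G_inv by blast
        fix u assume u: "u \<in> insert x (star x)"
        have "k u = h u" using u k(2) kx h fixatorD(2)[OF h, of x] by auto
        then show "(finv k \<circ> h) u = u" using G_inv_left[OF G(1), of u] by simp
      qed
      then have "finv k (h v) = v" using tx v unfolding trivial_at_def by auto
      then have "h v = k v" using G_inv_right[OF G(1), of "h v"] by simp
      then show "h v = v" using fixatorD(2)[OF k(1), of v] v by simp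
    qed
    then show False using full_not_trivial[OF xy full_at_pair] by blast
  qed
  then have ty: "trivial_at x (star_fixator y)" using dich[OF adj_sym[OF xy]] by blast
  have eq: "star_fixator x = star_fixator y" using sub[OF tx xy] sub[OF ty adj_sym[OF xy]] by blast
  have image: "star_fixator (g x) = star_fixator (g y)" if g: "g \<in> G" for g
  proof -
    have "star_fixator (g u) \<subseteq> star_fixator (g v)" if "star_fixator u = star_fixator v" for u v
    proof
      fix k assume "k \<in> star_fixator (g u)"
      then have "finv g \<circ> k \<circ> finv (finv g) \<in> star_fixator v"
        using conj_star_fixator[OF G_inv[OF g], of k "g u"] that g by simp
      then have "g \<circ> (finv g \<circ> k \<circ> finv (finv g)) \<circ> finv g \<in> star_fixator (g v)"
        using conj_star_fixator[OF g] by blast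
      moreover have "g \<circ> (finv g \<circ> k \<circ> finv (finv g)) \<circ> finv g = k"
        using G_inv_left[OF G_inv[OF g]] G_inv_right[OF G_inv[OF g]] g
        by (auto simp: fun_eq_iff)
      ultimately show "k \<in> star_fixator (g v)" by simp
    qed
    then show ?thesis using eq by blast
  qed
  have V: "x \<in> V" "y \<in> V" using xy adj_V adj_V2 by blast+
  \<comment> \<open>\<open>even_transitive\<close> reaches the vertices at even distance from
    \<open>x\<close>; an edge whose first end is at odd distance is reversed.\<close>
  have all: "star_fixator u = star_fixator v" if uv: "adj u v" for u v
  proof -
    have edge: "star_fixator a = star_fixator b" if ab: "adj a b" and ev: "even (td x a)" for a b
    proof -
      have abV: "a \<in> V" "b \<in> V" using ab adj_V adj_V2 by blast+
      obtain g where g: "g \<in> G" "g x = a" using even_transitive[OF V(1) abV(1) ev] by blast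
      have gy: "adj a (g y)" using G_adj[OF g(1), of x y] g(2) xy by simp
      obtain h where h: "h \<in> G" "h a = a" "h (g y) = b"
        using sphere_transitive[OF abV(1) adj_V2[OF gy] abV(2)] td_adj[OF ab] td_adj[OF gy] by metis
      show ?thesis using image[OF G_comp[OF h(1) g(1)]] g h by simp
    qed
    show ?thesis
    proof (cases "even (td x u)")
      case False
      then have "even (td x v)" using td_step[OF V(1) uv] by auto
      then show ?thesis using edge[OF adj_sym[OF uv]] by simp
    qed (use edge[OF uv] in simp)
  qed
  have const: "star_fixator x = star_fixator v" if "v \<in> V" for v
    using that
  proof (induction "td x v" arbitrary: v)
    case 0
    then show ?case using td_0[OF V(1)] by simp
  next
    case (Suc n)
    then have "x \<noteq> v" using V by auto
    then obtain p where p: "adj p v" "td x v = Suc (td x p)" using parent_ex V(1) Suc.prems by blast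
    then show ?case using Suc.hyps(1)[of p] Suc.hyps(2) adj_V[OF p(1)] all[OF p(1)] by simp
  qed
  obtain k v where k: "k \<in> star_fixator x" "v \<in> V" "k v \<noteq> v" using star_not_determining[OF V(1)] by blast
  then show False using const[OF k(2)] fixatorD(2)[of k "insert v (star v)" v] by simp
qed

text \<open>By \<open>star_independence\<close> the fixator of \<open>star c\<close> induces the
  full local group at \<open>z\<close>, so commuting with it on \<open>star z\<close> means being
  central there.\<close>

lemma star_centralizer:
  assumes cz: "adj c z" and q: "q \<in> G" "q c = c" "q z = z"
    and comm: "\<And>k u. k \<in> star_fixator c \<Longrightarrow> u \<in> star z \<Longrightarrow> q (k (finv q u)) = k u"
    and u: "u \<in> star z"
  shows "q u = u"
proof (rule local_centre_trivial[OF cz _ _ u])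
  show "q \<in> fixator {c, z}" using q by (intro fixatorI) auto
  fix g v assume g: "g \<in> fixator {c, z}" and v: "v \<in> star z"
  obtain k where k: "k \<in> star_fixator c" "\<And>u. u \<in> star z \<Longrightarrow> k u = g u"
    using star_independence[OF cz] g unfolding full_at_def by blast
  have qv: "q v \<in> star z" using G_star'[OF q(1,3)] v by simp
  show "q (g v) = g (q v)" using comm[OF k(1) qv] k(2)[OF v] k(2)[OF qv] q(1) by simp
qed

text \<open>If the actions of \<open>K\<close> at the neighbours \<open>w\<close> and \<open>z\<close> of \<open>c\<close> determine each other, they are
  identified by an element \<open>f\<close> centralizing \<open>K\<close> modulo the kernel of these actions. An element fixing
  \<open>a \<in> star w\<close> then has to fix \<open>f a \<in> star z\<close>, contradicting transitivity on the sphere around \<open>a\<close>.\<close>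

lemma neighbour_independence:
  assumes cw: "adj c w" and cz: "adj c z" and wz: "w \<noteq> z"
  shows "full_at c z (fixator (insert c (star c) \<union> star w))"
proof (rule ccontr)
  let ?K = "star_fixator c"
  let ?N = "\<lambda>w. fixator (insert c (star c) \<union> star w)"
  have V: "c \<in> V" "w \<in> V" "z \<in> V" using cw cz adj_V adj_V2 by blast+
  assume "\<not> full_at c z (?N w)"
  then have t0: "trivial_at z (?N w)"
    using star_trivial_or_full[OF cz, of "insert c (star c)" w] cz cw star_independence[OF cz] star_iff by auto
  \<comment> \<open>Triviality for the one pair \<open>w\<close>, \<open>z\<close> passes to all
    pairs of neighbours of \<open>c\<close> by \<open>star_two_transitive\<close>.\<close>
  have t: "k u = u" if ww: "adj c w1" "adj c w2" "w1 \<noteq> w2" and k: "k \<in> ?N w1" and u: "u \<in> star w2"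
    for w1 w2 k u
  proof -
    obtain g where g: "g \<in> G" "g c = c" "g w1 = w" "g w2 = z"
      using star_two_transitive[OF ww cw cz wz] .
    have im: "g ` (insert c (star c) \<union> star w1) = insert c (star c) \<union> star w"
      using image_star[OF g(1)] g by (simp add: image_Un)
    have "g \<circ> k \<circ> finv g \<in> ?N w"
      using conj_fixator[OF g(1) equalityD1[OF im] equalityD2[OF im] k] .
    moreover have "g u \<in> star z" using G_star[OF g(1), of u w2] u g by simp
    ultimately have "(g \<circ> k \<circ> finv g) (g u) = g u" using t0 unfolding trivial_at_def by blast
    then show ?thesis using g(1) by simp
  qed
  have K_fixes: "k v = v" if "k \<in> ?K" "adj c v" for k v
    using fixatorD(2)[OF that(1), of v] that(2) star_iff by simp
  have K_c: "k c = c" if "k \<in> ?K" for k using fixatorD(2)[OF that, of c] by simp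
  \<comment> \<open>The commutator of \<open>q\<close> and \<open>k\<close> is trivial at
    \<open>v\<close> because \<open>q\<close> is. By \<open>t\<close> it is then trivial at
    \<open>v'\<close>, where \<open>q\<close> and \<open>k\<close> therefore commute.\<close>
  have centralize: "q (k (finv q u)) = k u"
    if q: "q \<in> G" "q c = c" and v: "adj c v" "\<And>u. u \<in> star v \<Longrightarrow> q u = u"
      and v': "adj c v'" "v' \<noteq> v" "q v'' = v'" and k: "k \<in> ?K" and u: "u \<in> star v'" for q v v' v'' k u
  proof -
    have kG: "k \<in> G" using k fixatorD by blast
    let ?m = "q \<circ> k \<circ> finv q \<circ> finv k"
    have "q \<circ> k \<circ> finv q \<in> ?K" using conj_star_fixator'[OF q k] .
    then have mK: "?m \<in> ?K" using fixator_comp[OF _ fixator_inv[OF k]] by blast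
    have "?m s = s" if s: "s \<in> star v" for s
    proof -
      have ks: "finv k s \<in> star v" using finv_star[OF kG K_fixes[OF k v(1)]] s by simp
      have "finv q (finv k s) = finv k s" using finv_fixed[OF q(1) v(2)[OF ks]] .
      then show ?thesis using v(2)[OF s] kG by simp
    qed
    then have "?m \<in> ?N v" using mK unfolding fixator_def by auto
    moreover have "k u \<in> star v'" using G_star'[OF kG K_fixes[OF k v'(1)]] u by simp
    ultimately have "?m (k u) = k u" using t[OF v(1) v'(1)] v'(2) by metis
    then show ?thesis using kG by simp
  qed
  \<comment> \<open>The third neighbour \<open>v\<close> is where \<open>f\<close> will be trivial,
    so that \<open>centralize\<close> applies to it, while \<open>f\<close> carries \<open>w\<close>
    to \<open>z\<close>.\<close>
  obtain v where v: "adj c v" "v \<noteq> w" "v \<noteq> z" using thick[OF V(1)] by blast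
  obtain h where h: "h \<in> G" "h c = c" "h v = v" "h w = z"
    using star_two_transitive[OF v(1) cw v(2) v(1) cz v(3)] .
  have "h \<in> fixator {c, v}" using h by (intro fixatorI) auto
  then obtain k0 where k0: "k0 \<in> ?K" "\<And>u. u \<in> star v \<Longrightarrow> k0 u = h u"
    using star_independence[OF v(1)] unfolding full_at_def by blast
  have k0G: "k0 \<in> G" using k0 fixatorD by blast
  define f where "f = finv k0 \<circ> h"
  have f: "f \<in> G" "f c = c" "f w = z" "\<And>u. u \<in> star v \<Longrightarrow> f u = u"
  proof -
    show "f \<in> G" unfolding f_def using G_comp G_inv k0G h(1) by blast
    show "f c = c" "f w = z"
      unfolding f_def using h finv_fixed[OF k0G K_c[OF k0(1)]] finv_fixed[OF k0G K_fixes[OF k0(1) cz]] by simp_all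
    show "f u = u" if "u \<in> star v" for u
      unfolding f_def using k0(2)[OF that, symmetric] k0G by simp
  qed
  obtain a where a: "adj w a" "a \<noteq> c" using thick[OF V(2)] by blast
  have fa: "adj z (f a)" "f a \<noteq> c"
    using G_adj[OF f(1), of w a] f(3) a G_eq_iff[OF f(1), of a c] f(2) by auto
  obtain b where b: "adj z b" "b \<noteq> c" "b \<noteq> f a" using thick[OF V(3)] by blast
  have V': "a \<in> V" "b \<in> V" "f a \<in> V" using a b fa adj_V2 by blast+
  have wc: "adj w c" and zc: "adj z c" and aw: "adj a w" using cw cz a adj_sym by blast+
  have ac: "td a w = 1" "td a c = 2"
    using td_adj[OF aw] td_child[OF V'(1) aw _ wc a(2)[symmetric]] V'(1) by simp_all
  have az: "td a z = 3" using td_child[OF V'(1) wc _ cz wz[symmetric]] ac by simp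
  have as4: "td a s = 4" if "adj z s" "s \<noteq> c" for s
    using td_child[OF V'(1) cz _ that] ac az by simp
  have wz2: "td w c = 1" "td w z = 2"
    using td_adj[OF wc] td_child[OF V(2) wc _ cz wz[symmetric]] V(2) by simp_all
  have ws3: "td w s = 3" if "adj z s" "s \<noteq> c" for s
    using td_child[OF V(2) cz _ that] wz2 by simp
  have cs2: "td c s = 2" if "adj z s" "s \<noteq> c" for s
    using td_child[OF V(1) cz _ that] td_adj[OF cz] V(1) by simp
  \<comment> \<open>The path \<open>a\<close>, \<open>w\<close>, \<open>c\<close>, \<open>z\<close>,
    \<open>f a\<close> has length 4, and so has the one ending in \<open>b\<close>; hence
    \<open>g\<close> fixes \<open>w\<close>, \<open>c\<close> and \<open>z\<close>.\<close>
  obtain g where g: "g \<in> G" "g a = a" "g (f a) = b"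
    using sphere_transitive[OF V'(1,3,2)] as4[OF fa] as4[OF b(1,2)] by metis
  have gw: "g w = w"
    using between_fixed[OF g(1) V'(1,3) V(2) g(2)] g(3) ac ws3[OF fa] ws3[OF b(1,2)] as4[OF fa] as4[OF b(1,2)]
    by simp
  have gc: "g c = c"
    using between_fixed[OF g(1) V'(1,3) V(1) g(2)] g(3) ac cs2[OF fa] cs2[OF b(1,2)] as4[OF fa] as4[OF b(1,2)]
    by simp
  have gz: "g z = z"
    using between_fixed[OF g(1) V'(1,3) V(3) g(2)] g(3) az td_adj[OF fa(1)] td_adj[OF b(1)] as4[OF fa] as4[OF b(1,2)]
    by simp
  have "g \<in> fixator {c, w}" using g gc gw by (intro fixatorI) auto
  then obtain k where k: "k \<in> ?K" "\<And>u. u \<in> star w \<Longrightarrow> k u = g u"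
    using star_independence[OF cw] unfolding full_at_def by blast
  have kG: "k \<in> G" using k fixatorD by blast
  \<comment> \<open>Dividing \<open>g\<close> by the element \<open>k\<close> of \<open>?K\<close>
    with the same action at \<open>w\<close> leaves an element trivial at \<open>w\<close>, to which
    \<open>centralize\<close> applies. At \<open>z\<close> it is central, so \<open>k\<close> moves
    \<open>f a\<close> exactly as \<open>g\<close> does.\<close>
  define q where "q = finv k \<circ> g"
  have q: "q \<in> G" "q c = c" "q z = z" "\<And>u. u \<in> star w \<Longrightarrow> q u = u"
  proof -
    show "q \<in> G" unfolding q_def using G_comp G_inv kG g(1) by blast
    show "q c = c" "q z = z"
      unfolding q_def using gc gz finv_fixed[OF kG K_c[OF k(1)]] finv_fixed[OF kG K_fixes[OF k(1) cz]] by simp_all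
    show "q u = u" if "u \<in> star w" for u
      unfolding q_def using k(2)[OF that, symmetric] kG by simp
  qed
  have "q (f a) = f a"
  proof (rule star_centralizer[OF cz q(1-3)])
    show "f a \<in> star z" using fa star_iff by simp
    show "q (k (finv q u)) = k u" if "k \<in> ?K" "u \<in> star z" for k u
      using centralize[OF q(1,2) cw q(4) cz wz[symmetric] q(3) that] .
  qed
  then have kfa: "k (f a) = b" unfolding q_def using g(3) G_inv_right[OF kG, of b] by auto
  \<comment> \<open>Since \<open>f\<close> and \<open>k\<close> commute at \<open>z\<close> and
    \<open>k\<close> fixes \<open>a\<close>, \<open>k\<close> must fix \<open>f a\<close>, whereas
    it was found to move it to \<open>b\<close>.\<close>
  have "f (k (finv f (f a))) = k (f a)"
    using centralize[OF f(1,2) v(1) f(4) cz v(3)[symmetric] f(3) k(1)] fa(1) star_iff by simp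
  moreover have "k a = a" using k(2) a(1) g(2) star_iff by simp
  ultimately show False using kfa b(3) f(1) by simp
qed

lemma ball_independence_1: "ball_independence (Suc 0)"
  unfolding ball_independence_def
proof (intro ballI allI impI)
  fix c p z
  let ?S = "insert c (star c)"
  assume cV: "c \<in> V" and pz: "adj p z" and z: "td c z = Suc 0" and "td c p < Suc 0"
  then have "p = c" using td_0[OF cV adj_V[OF pz]] by simp
  then have cz: "adj c z" using pz by simp
  let ?W = "star c - {z}"
  have "full_at c z (fixator (?S \<union> \<Union>(star ` ?W)))"
  proof (rule full_at_fixator_stars[OF cz])
    show "z \<in> ?S" using cz star_iff by simp
    show "finite ?W" using finite_star[OF cV] by simp
    show "full_at c z (fixator (?S \<union> star w))" if "w \<in> ?W" for w
      using neighbour_independence[OF _ cz] that star_iff by simp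
  qed (use star_independence[OF cz] in auto)
  moreover have "punctured_ball c (Suc 0) z \<subseteq> ?S \<union> \<Union>(star ` ?W)"
  proof
    fix v assume v: "v \<in> punctured_ball c (Suc 0) z"
    then have vV: "v \<in> V" and d: "td c v \<le> 2" and nz: "\<not> (adj z v \<and> td c v = 2)"
      unfolding punctured_ball_def by auto
    show "v \<in> ?S \<union> \<Union>(star ` ?W)"
    proof (cases "c = v")
      case False
      then obtain w where w: "adj w v" "td c v = Suc (td c w)" using parent_ex cV vV by blast
      have wV: "w \<in> V" using w adj_V by blast
      show ?thesis
      proof (cases "c = w")
        case True
        then show ?thesis using w(1) star_iff by simp
      next
        case False
        then have "td c w = 1" using td_0[OF cV wV] w(2) d by linarith
        then have "w \<in> ?W" using td_1_adj[OF cV wV] w nz star_iff by auto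
        then show ?thesis using w(1) star_iff by blast
      qed
    qed simp
  qed
  ultimately show "full_at p z (fixator (punctured_ball c (Suc 0) z))"
    using full_at_fixator_mono \<open>p = c\<close> by blast
qed

theorem ball_independence: "n > 0 \<Longrightarrow> ball_independence n"
proof (induction n)
  case (Suc n)
  then show ?case using ball_independence_1 ball_step[OF edge_ball_step] by (cases n) auto
qed simp

end

section \<open>Colorings\<close>

text \<open>Here \<open>par\<close> gives the parent, \<open>\<iota>\<close> the charts, and
  \<open>pick v w k\<close> a permutation in \<open>F v\<close> taking the chart colour of
  \<open>w\<close> at \<open>v\<close> to \<open>k\<close>. The recursion reaches back two levels
  because the chart at the parent of \<open>v\<close> has to be adjusted to the colour of the
  grandparent. The colour 1 of the root is an arbitrary choice.\<close>

fun tree_colour ::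
  "('a \<Rightarrow> 'a) \<Rightarrow> ('a \<Rightarrow> 'a \<Rightarrow> nat) \<Rightarrow> ('a \<Rightarrow> 'a \<Rightarrow> nat \<Rightarrow> nat \<Rightarrow> nat) \<Rightarrow> nat \<Rightarrow> 'a \<Rightarrow> nat" where
  "tree_colour par \<iota> pick 0 v = 1"
| "tree_colour par \<iota> pick (Suc 0) v = \<iota> (par v) v"
| "tree_colour par \<iota> pick (Suc (Suc n)) v =
     pick (par v) (par (par v)) (tree_colour par \<iota> pick n (par (par v))) (\<iota> (par v) v)"

context line_transitive_group
begin

text \<open>The chart \<open>\<psi>\<close> identifies the local action of \<open>G\<close> at \<open>v\<close> with the permutations in \<open>F\<close>,
  whose values outside \<open>{1..n}\<close> do not matter.\<close>

definition local_chart :: "'a \<Rightarrow> ('a \<Rightarrow> nat) \<Rightarrow> nat \<Rightarrow> (nat \<Rightarrow> nat) set \<Rightarrow> bool" where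
  "local_chart v \<psi> n F \<longleftrightarrow> bij_betw \<psi> (star v) {1..n} \<and>
     (\<forall>g\<in>fixator {v}. \<exists>f\<in>F. \<forall>u\<in>star v. \<psi> (g u) = f (\<psi> u)) \<and>
     (\<forall>f\<in>F. \<exists>g\<in>fixator {v}. \<forall>u\<in>star v. \<psi> (g u) = f (\<psi> u))"

lemma local_chartD:
  assumes "local_chart v \<psi> n F"
  shows "bij_betw \<psi> (star v) {1..n}"
    "g \<in> fixator {v} \<Longrightarrow> \<exists>f\<in>F. \<forall>u\<in>star v. \<psi> (g u) = f (\<psi> u)"
    "f \<in> F \<Longrightarrow> \<exists>g\<in>fixator {v}. \<forall>u\<in>star v. \<psi> (g u) = f (\<psi> u)"
  using assms unfolding local_chart_def by blast+

lemma local_chart_in: "local_chart v \<psi> n F \<Longrightarrow> u \<in> star v \<Longrightarrow> \<psi> u \<in> {1..n}"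
  using local_chartD(1) bij_betwE by blast

lemma fixator_star: "g \<in> fixator {v} \<Longrightarrow> g u \<in> star v \<longleftrightarrow> u \<in> star v"
  using G_star'[of g v u] fixatorD by simp

text \<open>In this context \<open>F\<close> is a bare set; its closure properties, on the colours
  that occur, are inherited from the local action of \<open>G\<close>.\<close>

lemma local_chart_inv:
  assumes c: "local_chart v \<psi> n F" and f: "f \<in> F"
  shows "\<exists>f'\<in>F. \<forall>u\<in>star v. f' (f (\<psi> u)) = \<psi> u"
proof -
  obtain g where g: "g \<in> fixator {v}" "\<And>u. u \<in> star v \<Longrightarrow> \<psi> (g u) = f (\<psi> u)"
    using local_chartD(3)[OF c f] by blast
  obtain f' where f': "f' \<in> F" "\<And>u. u \<in> star v \<Longrightarrow> \<psi> (finv g u) = f' (\<psi> u)"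
    using local_chartD(2)[OF c fixator_inv[OF g(1)]] by blast
  have "f' (f (\<psi> u)) = \<psi> u" if u: "u \<in> star v" for u
    using f'(2)[of "g u"] g(2)[OF u] fixator_star[OF g(1), of u] u fixatorD(1)[OF g(1)] by simp
  then show ?thesis using f'(1) by blast
qed

lemma local_chart_comp:
  assumes c: "local_chart v \<psi> n F" and f: "f \<in> F" "f' \<in> F"
  shows "\<exists>f''\<in>F. \<forall>u\<in>star v. f'' (\<psi> u) = f' (f (\<psi> u))"
proof -
  obtain g where g: "g \<in> fixator {v}" "\<And>u. u \<in> star v \<Longrightarrow> \<psi> (g u) = f (\<psi> u)"
    using local_chartD(3)[OF c f(1)] by blast
  obtain g' where g': "g' \<in> fixator {v}" "\<And>u. u \<in> star v \<Longrightarrow> \<psi> (g' u) = f' (\<psi> u)"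
    using local_chartD(3)[OF c f(2)] by blast
  obtain f'' where f'': "f'' \<in> F" "\<And>u. u \<in> star v \<Longrightarrow> \<psi> ((g' \<circ> g) u) = f'' (\<psi> u)"
    using local_chartD(2)[OF c fixator_comp[OF g'(1) g(1)]] by blast
  have "f'' (\<psi> u) = f' (f (\<psi> u))" if u: "u \<in> star v" for u
    using f''(2)[OF u] g'(2)[of "g u"] g(2)[OF u] fixator_star[OF g(1), of u] u by simp
  then show ?thesis using f''(1) by blast
qed

lemma local_chart_transitive:
  assumes c: "local_chart v \<psi> n F" and v: "v \<in> V" and w: "w \<in> star v" and k: "k \<in> {1..n}"
  shows "\<exists>f\<in>F. f (\<psi> w) = k"
proof -
  obtain u where u: "u \<in> star v" "\<psi> u = k"
    using local_chartD(1)[OF c] k unfolding bij_betw_def by (metis imageE)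
  have a: "adj v w" "adj v u" using w u star_iff by auto
  obtain g where g: "g \<in> G" "g v = v" "g w = u"
    using sphere_transitive[OF v adj_V2[OF a(1)] adj_V2[OF a(2)]] td_adj[OF a(1)] td_adj[OF a(2)] by metis
  have "g \<in> fixator {v}" using g by (intro fixatorI) auto
  then obtain f where "f \<in> F" "\<psi> (g w) = f (\<psi> w)" using local_chartD(2)[OF c] w by blast
  then show ?thesis using g(3) u(2) by auto
qed

text \<open>Relabelling by \<open>f\<close> amounts to precomposing the chart with an element
  \<open>g0\<close> of the stabiliser of \<open>v\<close>, so the induced group is merely conjugated
  by one of its own elements.\<close>

lemma local_chart_change:
  assumes c: "local_chart v \<psi> n F" and f: "f \<in> F" and eq: "\<And>u. u \<in> star v \<Longrightarrow> \<psi>' u = f (\<psi> u)"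
  shows "local_chart v \<psi>' n F"
proof -
  obtain g0 where g0: "g0 \<in> fixator {v}" "\<And>u. u \<in> star v \<Longrightarrow> \<psi> (g0 u) = f (\<psi> u)"
    using local_chartD(3)[OF c f] by blast
  have g0G: "g0 \<in> G" "g0 v = v" using g0(1) fixatorD by blast+
  have \<psi>': "\<psi>' u = \<psi> (g0 u)" if "u \<in> star v" for u using eq g0(2) that by simp
  have "bij_betw g0 (star v) (star v)"
    using image_star[OF g0G(1), of v] g0G G_eq_iff[OF g0G(1)] unfolding bij_betw_def inj_on_def by simp
  then have "bij_betw (\<psi> \<circ> g0) (star v) {1..n}" using local_chartD(1)[OF c] by (rule bij_betw_trans)
  then have "bij_betw \<psi>' (star v) {1..n}" using bij_betw_cong[of "star v" \<psi>' "\<psi> \<circ> g0"] \<psi>' by simp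
  moreover have "\<exists>f\<in>F. \<forall>u\<in>star v. \<psi>' (g u) = f (\<psi>' u)" if g: "g \<in> fixator {v}" for g
  proof -
    have "g0 \<circ> g \<circ> finv g0 \<in> fixator {v}" using g g0(1) fixator_comp fixator_inv by blast
    then obtain f1 where f1: "f1 \<in> F" "\<And>u. u \<in> star v \<Longrightarrow> \<psi> ((g0 \<circ> g \<circ> finv g0) u) = f1 (\<psi> u)"
      using local_chartD(2)[OF c] by blast
    have "\<psi>' (g u) = f1 (\<psi>' u)" if u: "u \<in> star v" for u
      using f1(2)[of "g0 u"] fixator_star[OF g0(1), of u] fixator_star[OF g, of u] u \<psi>' g0G by simp
    then show ?thesis using f1(1) by blast
  qed
  moreover have "\<exists>g\<in>fixator {v}. \<forall>u\<in>star v. \<psi>' (g u) = f1 (\<psi>' u)" if f1: "f1 \<in> F" for f1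
  proof -
    obtain g where g: "g \<in> fixator {v}" "\<And>u. u \<in> star v \<Longrightarrow> \<psi> (g u) = f1 (\<psi> u)"
      using local_chartD(3)[OF c f1] by blast
    have m: "finv g0 \<circ> g \<circ> g0 \<in> fixator {v}" using g(1) g0(1) fixator_comp fixator_inv by blast
    have "\<psi>' ((finv g0 \<circ> g \<circ> g0) u) = f1 (\<psi>' u)" if u: "u \<in> star v" for u
    proof -
      have "\<psi>' ((finv g0 \<circ> g \<circ> g0) u) = \<psi> (g0 ((finv g0 \<circ> g \<circ> g0) u))"
        using \<psi>' fixator_star[OF m, of u] u by blast
      also have "\<dots> = \<psi> (g (g0 u))" using g0G by simp
      also have "\<dots> = f1 (\<psi>' u)" using g(2)[of "g0 u"] fixator_star[OF g0(1), of u] u \<psi>' by simp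
      finally show ?thesis .
    qed
    then show ?thesis using m by blast
  qed
  ultimately show ?thesis unfolding local_chart_def by blast
qed

lemma local_chart_transport:
  assumes c: "local_chart v \<psi> n F" and h: "h \<in> G"
  shows "local_chart (h v) (\<psi> \<circ> finv h) n F"
proof -
  have st: "finv h u \<in> star v \<longleftrightarrow> u \<in> star (h v)" for u
    using G_star[OF h, of "finv h u" v] h by simp
  have im: "finv h ` star (h v) = star v"
    using image_star[OF h, of v] G_inv_left[OF h] by (simp add: image_image flip: image_star[OF h])
  have "inj_on (finv h) (star (h v))" using G_eq_iff[OF G_inv[OF h]] unfolding inj_on_def by simp
  then have "bij_betw (finv h) (star (h v)) (star v)" using im unfolding bij_betw_def by simp
  then have "bij_betw (\<psi> \<circ> finv h) (star (h v)) {1..n}"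
    using local_chartD(1)[OF c] by (rule bij_betw_trans)
  moreover have "\<exists>f\<in>F. \<forall>u\<in>star (h v). (\<psi> \<circ> finv h) (g u) = f ((\<psi> \<circ> finv h) u)"
    if g: "g \<in> fixator {h v}" for g
  proof -
    have "finv h \<circ> g \<circ> h \<in> fixator {v}"
      using g h fixatorD[OF g] by (intro fixatorI) (auto simp: G_comp G_inv)
    then obtain f where f: "f \<in> F" "\<And>u. u \<in> star v \<Longrightarrow> \<psi> ((finv h \<circ> g \<circ> h) u) = f (\<psi> u)"
      using local_chartD(2)[OF c] by blast
    have "(\<psi> \<circ> finv h) (g u) = f ((\<psi> \<circ> finv h) u)" if "u \<in> star (h v)" for u
      using f(2)[of "finv h u"] st[of u] that h by simp
    then show ?thesis using f(1) by blast
  qed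
  moreover have "\<exists>g\<in>fixator {h v}. \<forall>u\<in>star (h v). (\<psi> \<circ> finv h) (g u) = f ((\<psi> \<circ> finv h) u)"
    if f: "f \<in> F" for f
  proof -
    obtain g where g: "g \<in> fixator {v}" "\<And>u. u \<in> star v \<Longrightarrow> \<psi> (g u) = f (\<psi> u)"
      using local_chartD(3)[OF c f] by blast
    have "h \<circ> g \<circ> finv h \<in> fixator {h v}"
      using g h fixatorD[OF g(1)] by (intro fixatorI) (auto simp: G_comp G_inv)
    moreover have "(\<psi> \<circ> finv h) ((h \<circ> g \<circ> finv h) u) = f ((\<psi> \<circ> finv h) u)" if "u \<in> star (h v)" for u
      using g(2)[of "finv h u"] st[of u] that h by simp
    ultimately show ?thesis by blast
  qed
  ultimately show ?thesis unfolding local_chart_def by blast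
qed

text \<open>Transporting a chart from a representative of each orbit makes the charts compatible with \<open>G\<close>.\<close>

lemma equivariant_charts:
  fixes D :: "'a \<Rightarrow> nat" and F :: "'a \<Rightarrow> (nat \<Rightarrow> nat) set"
  assumes chart: "\<And>v. v \<in> V \<Longrightarrow> \<exists>\<psi>. local_chart v \<psi> (D v) (F v)"
    and inv: "\<And>g v. g \<in> G \<Longrightarrow> v \<in> V \<Longrightarrow> D (g v) = D v" "\<And>g v. g \<in> G \<Longrightarrow> v \<in> V \<Longrightarrow> F (g v) = F v"
  obtains \<iota> where "\<And>v. v \<in> V \<Longrightarrow> local_chart v (\<iota> v) (D v) (F v)"
    "\<And>g v. g \<in> G \<Longrightarrow> v \<in> V \<Longrightarrow> \<exists>f\<in>F v. \<forall>u\<in>star v. \<iota> (g v) (g u) = f (\<iota> v u)"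
proof -
  define rep where "rep v = (SOME u. \<exists>g\<in>G. g u = v)" for v
  have rep_ex: "\<exists>g\<in>G. g (rep v) = v" for v
    unfolding rep_def by (rule someI[of _ v]) (use G_id in \<open>auto intro!: bexI[of _ id]\<close>)
  have rep_eq: "rep (g v) = rep v" if g: "g \<in> G" for g v
  proof -
    have "(\<exists>h\<in>G. h u = g v) \<longleftrightarrow> (\<exists>h\<in>G. h u = v)" for u
    proof
      assume "\<exists>h\<in>G. h u = g v"
      then obtain h where "h \<in> G" "h u = g v" by blast
      then show "\<exists>h\<in>G. h u = v" using G_comp[OF G_inv[OF g]] g by (intro bexI[of _ "finv g \<circ> h"]) auto
    next
      assume "\<exists>h\<in>G. h u = v"
      then obtain h where "h \<in> G" "h u = v" by blast
      then show "\<exists>h\<in>G. h u = g v" using G_comp[OF g] by (intro bexI[of _ "g \<circ> h"]) auto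
    qed
    then show ?thesis unfolding rep_def by simp
  qed
  obtain h where h: "\<And>v. h v \<in> G" "\<And>v. h v (rep v) = v" using rep_ex by metis
  have repV: "rep v \<in> V \<longleftrightarrow> v \<in> V" for v using G_V_iff[OF h(1), of v "rep v"] h(2) by simp
  obtain \<psi> where \<psi>: "\<And>v. v \<in> V \<Longrightarrow> local_chart v (\<psi> v) (D v) (F v)" using chart by metis
  have DF: "D (rep v) = D v" "F (rep v) = F v" if "v \<in> V" for v
    using inv[OF h(1), of "rep v" v] h(2)[of v] repV that by simp_all
  define \<iota> where "\<iota> v = \<psi> (rep v) \<circ> finv (h v)" for v
  show thesis
  proof (rule that[of \<iota>])
    fix v assume v: "v \<in> V"
    have "local_chart (rep v) (\<psi> (rep v)) (D v) (F v)" using \<psi>[of "rep v"] repV v DF by simp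
    from local_chart_transport[OF this h(1)[of v]] show "local_chart v (\<iota> v) (D v) (F v)"
      using h(2) by (simp add: \<iota>_def)
  next
    fix g v assume g: "g \<in> G" and v: "v \<in> V"
    \<comment> \<open>The vertices \<open>v\<close> and \<open>g v\<close> have the same
      representative, so \<open>?m\<close> fixes it and acts there by an element of
      \<open>F v\<close>.\<close>
    let ?m = "finv (h (g v)) \<circ> g \<circ> h v"
    have "?m \<in> fixator {rep v}"
    proof (rule fixatorI)
      show "?m \<in> G" using G_comp G_inv h(1) g by blast
      show "?m u = u" if "u \<in> {rep v}" for u
        using that h(2)[of v] G_inv_left[OF h(1), of "g v" "rep (g v)"] h(2)[of "g v"] rep_eq[OF g, of v] by simp
    qed
    then obtain f where f: "f \<in> F v" "\<And>u. u \<in> star (rep v) \<Longrightarrow> \<psi> (rep v) (?m u) = f (\<psi> (rep v) u)"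
      using local_chartD(2)[OF \<psi>[of "rep v"]] repV v DF by metis
    have "\<iota> (g v) (g u) = f (\<iota> v u)" if u: "u \<in> star v" for u
    proof -
      have "finv (h v) u \<in> star (rep v)"
        using G_star[OF h(1), of v "finv (h v) u" "rep v"] h u by simp
      from f(2)[OF this] show ?thesis using h(1) rep_eq[OF g, of v] by (simp add: \<iota>_def)
    qed
    then show "\<exists>f\<in>F v. \<forall>u\<in>star v. \<iota> (g v) (g u) = f (\<iota> v u)" using f(1) by blast
  qed
qed

text \<open>The colours of the children of \<open>v\<close> are read off a chart at \<open>v\<close>, adjusted by an element of the
  transitive group \<open>F v\<close> so that the parent of \<open>v\<close> keeps its colour.\<close>

lemma colouring_exists:
  fixes D :: "'a \<Rightarrow> nat" and F :: "'a \<Rightarrow> (nat \<Rightarrow> nat) set"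
  assumes chart: "\<And>v. v \<in> V \<Longrightarrow> \<exists>\<psi>. local_chart v \<psi> (D v) (F v)"
    and inv: "\<And>g v. g \<in> G \<Longrightarrow> v \<in> V \<Longrightarrow> D (g v) = D v" "\<And>g v. g \<in> G \<Longrightarrow> v \<in> V \<Longrightarrow> F (g v) = F v"
    and "V \<noteq> {}"
  obtains i where "\<And>v. v \<in> V \<Longrightarrow> local_chart v i (D v) (F v)"
    "\<And>g v. g \<in> G \<Longrightarrow> v \<in> V \<Longrightarrow> \<exists>f\<in>F v. \<forall>u\<in>star v. i (g u) = f (i u)"
proof -
  obtain \<iota> where \<iota>: "\<And>v. v \<in> V \<Longrightarrow> local_chart v (\<iota> v) (D v) (F v)"
    "\<And>g v. g \<in> G \<Longrightarrow> v \<in> V \<Longrightarrow> \<exists>f\<in>F v. \<forall>u\<in>star v. \<iota> (g v) (g u) = f (\<iota> v u)"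
    by (rule equivariant_charts[of D F]) (rule chart inv; assumption | blast)+
  obtain \<rho> where \<rho>: "\<rho> \<in> V" using assms(4) by blast
  define par where "par v = (SOME p. adj p v \<and> td \<rho> v = Suc (td \<rho> p))" for v
  have par: "adj (par v) v" "td \<rho> v = Suc (td \<rho> (par v))" if "v \<in> V" "v \<noteq> \<rho>" for v
    using someI_ex[OF parent_ex[OF \<rho> that(1)]] that(2) unfolding par_def by metis+
  have par_eq: "par v = p" if "adj p v" "td \<rho> v = Suc (td \<rho> p)" for v p
  proof -
    have v: "v \<in> V" "v \<noteq> \<rho>" using that adj_V2 \<rho> by (blast, auto)
    show ?thesis using parent_unique[OF \<rho> par(1)[OF v] that(1)] par(2)[OF v] that(2) by simp
  qed
  define pick where "pick v w k = (SOME f. f \<in> F v \<and> f (\<iota> v w) = k)" for v w k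
  have pick: "pick v w k \<in> F v" "pick v w k (\<iota> v w) = k" if "v \<in> V" "w \<in> star v" "k \<in> {1..D v}" for v w k
    using someI_ex[of "\<lambda>f. f \<in> F v \<and> f (\<iota> v w) = k"]
      local_chart_transitive[OF \<iota>(1)[OF that(1)] that] unfolding pick_def by blast+
  define i where "i v = tree_colour par \<iota> pick (td \<rho> v) v" for v
  have D_eq: "D u = D u'" if wu: "adj w u" "adj w u'" for w u u'
  proof -
    have V: "w \<in> V" "u \<in> V" "u' \<in> V" using wu adj_V adj_V2 by blast+
    obtain g where "g \<in> G" "g u = u'"
      using sphere_transitive[OF V] td_adj[OF wu(1)] td_adj[OF wu(2)] by metis
    then show ?thesis using inv(1)[of g u] V by simp
  qed
  \<comment> \<open>The range of the children's colours belongs to the induction: adjusting the next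
    chart requires the prescribed colour of the parent to be attainable.\<close>
  have step: "(\<exists>f\<in>F v. \<forall>u\<in>star v. i u = f (\<iota> v u)) \<and> (\<forall>u\<in>star v. td \<rho> u = Suc n \<longrightarrow> i u \<in> {1..D v})"
    if v: "v \<in> V" "td \<rho> v = n" for n v
    using v
  proof (induction n arbitrary: v rule: less_induct)
    case (less n)
    note v = less.prems
    note c = \<iota>(1)[OF v(1)]
    have "\<exists>f\<in>F v. \<forall>u\<in>star v. i u = f (\<iota> v u)"
    proof (cases n)
      case 0
      then have v\<rho>: "v = \<rho>" using v td_0[OF \<rho>] by simp
      have "id \<in> fixator {v}" by (simp add: fixator_def G_id)
      then obtain f where f: "f \<in> F v" "\<And>u. u \<in> star v \<Longrightarrow> \<iota> v (id u) = f (\<iota> v u)"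
        using local_chartD(2)[OF c] by blast
      have "i u = f (\<iota> v u)" if u: "u \<in> star v" for u
      proof -
        have a: "adj \<rho> u" using u v\<rho> star_iff by simp
        have d: "td \<rho> u = Suc 0" using td_adj[OF a] by simp
        have "par u = \<rho>" using par_eq[OF a] d \<rho> by simp
        then have "i u = \<iota> v u" using d v\<rho> by (simp add: i_def)
        then show ?thesis using f(2)[OF u] by simp
      qed
      then show ?thesis using f(1) by blast
    next
      case (Suc m)
      have ne: "v \<noteq> \<rho>" using v(2) Suc \<rho> by auto
      let ?w = "par v"
      have w: "adj ?w v" "td \<rho> ?w = m" using par[OF v(1) ne] v(2) Suc by simp_all
      have wV: "?w \<in> V" using w adj_V by blast
      have ws: "?w \<in> star v" using adj_sym[OF w(1)] star_iff by simp
      \<comment> \<open>The root has colour 1, an element of the nonempty range. Any other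
        \<open>?w\<close> was coloured by the chart at its own parent, which is a neighbour of
        \<open>?w\<close> like \<open>v\<close> and so has the same degree.\<close>
      have wc: "i ?w \<in> {1..D v}"
      proof (cases m)
        case 0
        have "\<iota> v ?w \<in> {1..D v}" using local_chart_in[OF c ws] .
        then show ?thesis using w(2) 0 by (simp add: i_def)
      next
        case (Suc l)
        have "?w \<noteq> \<rho>" using w(2) Suc \<rho> by auto
        then have p: "adj (par ?w) ?w" "td \<rho> (par ?w) = l" using par[OF wV] w(2) Suc by simp_all
        have "i ?w \<in> {1..D (par ?w)}"
          using less.IH[of l "par ?w"] p adj_V[OF p(1)] star_iff Suc \<open>n = Suc m\<close> w(2) by simp
        then show ?thesis using D_eq[OF adj_sym[OF p(1)] w(1)] by simp
      qed
      let ?f = "pick v ?w (i ?w)"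
      note pk = pick[OF v(1) ws wc]
      have "i u = ?f (\<iota> v u)" if u: "u \<in> star v" for u
      proof (cases "u = ?w")
        case False
        have a: "adj v u" using u star_iff by simp
        have d: "td \<rho> u = Suc (Suc m)"
          using td_child[OF \<rho> w(1) _ a False] w(2) v(2) Suc by simp
        have "par u = v" using par_eq[OF a] d v(2) Suc by simp
        then show ?thesis using d w(2) by (simp add: i_def)
      qed (simp add: pk(2))
      then show ?thesis using pk(1) by blast
    qed
    moreover from this obtain f where f: "f \<in> F v" "\<And>u. u \<in> star v \<Longrightarrow> i u = f (\<iota> v u)" by blast
    ultimately show ?case using local_chart_in[OF local_chart_change[OF c f]] by blast
  qed
  have f: "\<exists>f\<in>F v. \<forall>u\<in>star v. i u = f (\<iota> v u)" if "v \<in> V" for v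
    using step[OF that refl] by blast
  show thesis
  proof (rule that[of i])
    fix v assume v: "v \<in> V"
    obtain f where f: "f \<in> F v" "\<And>u. u \<in> star v \<Longrightarrow> i u = f (\<iota> v u)" using f[OF v] by blast
    show "local_chart v i (D v) (F v)" using local_chart_change[OF \<iota>(1)[OF v] f] .
  next
    fix g v assume g: "g \<in> G" and v: "v \<in> V"
    note c = \<iota>(1)[OF v]
    obtain f0 where f0: "f0 \<in> F v" "\<And>u. u \<in> star v \<Longrightarrow> i u = f0 (\<iota> v u)" using f[OF v] by blast
    obtain f1 where f1: "f1 \<in> F v" "\<And>u. u \<in> star (g v) \<Longrightarrow> i u = f1 (\<iota> (g v) u)"
      using f[of "g v"] inv(2)[OF g v] g v by auto
    obtain f2 where f2: "f2 \<in> F v" "\<And>u. u \<in> star v \<Longrightarrow> \<iota> (g v) (g u) = f2 (\<iota> v u)"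
      using \<iota>(2)[OF g v] by blast
    \<comment> \<open>Relative to \<open>\<iota>\<close> the coloring is \<open>f0\<close> at
      \<open>v\<close> and \<open>f1\<close> at \<open>g v\<close>, so the local permutation sought
      is \<open>f1\<close> after \<open>f2\<close> after the inverse of \<open>f0\<close>.\<close>
    obtain f3 where f3: "f3 \<in> F v" "\<And>u. u \<in> star v \<Longrightarrow> f3 (f0 (\<iota> v u)) = \<iota> v u"
      using local_chart_inv[OF c f0(1)] by blast
    note c' = local_chart_change[OF c f0]
    obtain f4 where f4: "f4 \<in> F v" "\<And>u. u \<in> star v \<Longrightarrow> f4 (\<iota> v u) = f1 (f2 (\<iota> v u))"
      using local_chart_comp[OF c f2(1) f1(1)] by blast
    obtain f5 where f5: "f5 \<in> F v" "\<And>u. u \<in> star v \<Longrightarrow> f5 (i u) = f4 (f3 (i u))"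
      using local_chart_comp[OF c' f3(1) f4(1)] by blast
    have "i (g u) = f5 (i u)" if u: "u \<in> star v" for u
    proof -
      have gu: "g u \<in> star (g v)" using G_star[OF g] u by simp
      have "i (g u) = f1 (f2 (\<iota> v u))" using f1(2)[OF gu] f2(2)[OF u] by simp
      also have "\<dots> = f4 (f3 (f0 (\<iota> v u)))" using f3(2)[OF u] f4(2)[OF u] by simp
      finally show ?thesis using f5(2)[OF u] f0(2)[OF u] by simp
    qed
    then show "\<exists>f\<in>F v. \<forall>u\<in>star v. i (g u) = f (i u)" using f5(1) by blast
  qed
qed

end

section \<open>Approximation of locally admissible maps on balls\<close>

context locally_simple_group
begin

text \<open>At a vertex \<open>z\<close> of the sphere, \<open>w\<close> acts on
  \<open>star z\<close> like some element fixing \<open>z\<close> and its parent. Ball independence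
  replaces that element by one trivial at the other vertices of the sphere, and the product of these
  agrees with \<open>w\<close>. For \<open>n = 0\<close> there is no parent, and the chart at the
  centre suffices.\<close>

lemma agree_on_ball_Suc:
  assumes chart: "\<And>v. v \<in> V \<Longrightarrow> local_chart v i (D v) (F v)"
    and \<rho>: "\<rho> \<in> V"
    and w_star: "\<And>v s. adj v s \<Longrightarrow> adj (w v) (w s)"
    and w_local: "\<And>v. v \<in> V \<Longrightarrow> \<exists>f\<in>F v. \<forall>s\<in>star v. i (w s) = f (i s)"
    and w_fix: "\<And>v. v \<in> tball \<rho> n \<Longrightarrow> w v = v"
  shows "\<exists>k\<in>G. \<forall>v\<in>tball \<rho> (Suc n). k v = w v"
proof -
  have realise: "\<exists>g\<in>fixator {z}. \<forall>s\<in>star z. g s = w s" if z: "z \<in> V" "w z = z" for z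
  proof -
    obtain f where f: "f \<in> F z" "\<And>s. s \<in> star z \<Longrightarrow> i (w s) = f (i s)" using w_local[OF z(1)] by blast
    obtain g where g: "g \<in> fixator {z}" "\<And>s. s \<in> star z \<Longrightarrow> i (g s) = f (i s)"
      using local_chartD(3)[OF chart[OF z(1)] f(1)] by blast
    have "g s = w s" if s: "s \<in> star z" for s
    proof -
      have "w s \<in> star z" using w_star[of z s] z(2) s by (simp add: star_iff)
      moreover have "g s \<in> star z" using fixator_star[OF g(1)] s by simp
      moreover have "i (g s) = i (w s)" using g(2) f(2) s by simp
      ultimately show ?thesis
        using local_chartD(1)[OF chart[OF z(1)]] unfolding bij_betw_def inj_on_def by blast
    qed
    then show ?thesis using g(1) by blast
  qed
  define sphere where "sphere = {z \<in> V. td \<rho> z = n}"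
  have sph: "sphere \<subseteq> tball \<rho> n" by (auto simp: sphere_def tball_def)
  have fin: "finite sphere" using finite_subset[OF sph finite_tball[OF \<rho>]] .
  have wz: "w z = z" if "z \<in> sphere" for z using w_fix sph that by blast
  have cover: "v \<in> tball \<rho> n \<or> (\<exists>z\<in>sphere. v \<in> star z)" if v: "v \<in> tball \<rho> (Suc n)" for v
  proof (cases "td \<rho> v \<le> n")
    case True
    then show ?thesis using v by (simp add: tball_def)
  next
    case False
    then have d: "td \<rho> v = Suc n" "v \<in> V" using v by (auto simp: tball_def)
    then have "\<rho> \<noteq> v" using \<rho> by auto
    then obtain p where p: "adj p v" "td \<rho> v = Suc (td \<rho> p)" using parent_ex \<rho> d(2) by blast
    then have "p \<in> sphere" using d(1) adj_V[OF p(1)] by (simp add: sphere_def)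
    then show ?thesis using p(1) star_iff by blast
  qed
  have "\<exists>k\<in>G. (\<forall>v\<in>tball \<rho> n. k v = v) \<and> (\<forall>z\<in>sphere. \<forall>s\<in>star z. k s = w s)"
  proof (cases "n = 0")
    case True
    then have sp: "sphere = {\<rho>}" "tball \<rho> n = {\<rho>}"
      using td_0[OF \<rho>] \<rho> unfolding sphere_def tball_def by auto
    obtain g where g: "g \<in> fixator {\<rho>}" "\<forall>s\<in>star \<rho>. g s = w s" using realise[OF \<rho>] wz sp by auto
    then show ?thesis using sp fixatorD[OF g(1)] by auto
  next
    case False
    have one: "\<exists>k\<in>G. (\<forall>v\<in>tball \<rho> n. k v = v) \<and> (\<forall>s\<in>star z. k s = w s) \<and>
        (\<forall>z'\<in>sphere - {z}. \<forall>s\<in>star z'. k s = s)" if z: "z \<in> sphere" for z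
    proof -
      have zV: "z \<in> V" and dz: "td \<rho> z = n" using z by (auto simp: sphere_def)
      have "\<rho> \<noteq> z" using dz False \<rho> by auto
      then obtain p where p: "adj p z" "td \<rho> z = Suc (td \<rho> p)" using parent_ex \<rho> zV by blast
      obtain g where g: "g \<in> fixator {z}" "\<And>s. s \<in> star z \<Longrightarrow> g s = w s" using realise[OF zV wz[OF z]] by blast
      have "w p = p" using w_fix[of p] p dz adj_V[OF p(1)] by (simp add: tball_def)
      then have "g p = p" using g(2)[of p] adj_sym[OF p(1)] star_iff by simp
      then have "g \<in> fixator {p, z}" using g(1) by (simp add: fixator_def)
      moreover have "full_at p z (fixator (punctured_ball \<rho> n z))"
        using ball_independence[of n] False \<rho> p dz unfolding ball_independence_def by auto
      ultimately obtain k where k: "k \<in> fixator (punctured_ball \<rho> n z)" "\<And>s. s \<in> star z \<Longrightarrow> k s = g s"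
        unfolding full_at_def by blast
      have "k v = v" if "v \<in> tball \<rho> n" for v
        using fixatorD(2)[OF k(1), of v] that by (simp add: tball_def punctured_ball_def)
      moreover have "k s = s" if z': "z' \<in> sphere - {z}" and s: "s \<in> star z'" for z' s
      proof -
        have a: "adj z' s" and dz': "td \<rho> z' = n" using s z' by (auto simp: sphere_def star_iff)
        have "\<not> (adj z s \<and> td \<rho> s = Suc n)"
          using parent_unique[OF \<rho> a, of z] dz dz' z' by auto
        then have "s \<in> punctured_ball \<rho> n z"
          using td_step[OF \<rho> a] dz' adj_V2[OF a] unfolding punctured_ball_def by auto
        then show ?thesis using fixatorD(2)[OF k(1)] by blast
      qed
      ultimately show ?thesis using k(2) g(2) by (intro bexI[OF _ fixatorD(1)[OF k(1)]]) simp
    qed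
    have "\<exists>k\<in>G. (\<forall>v\<in>tball \<rho> n. k v = v) \<and> (\<forall>z\<in>Z. \<forall>s\<in>star z. k s = w s) \<and>
        (\<forall>z\<in>sphere - Z. \<forall>s\<in>star z. k s = s)" if "finite Z" "Z \<subseteq> sphere" for Z
      using that
    proof (induction Z rule: finite_induct)
      case empty
      then show ?case using G_id by (intro bexI[of _ id]) auto
    next
      case (insert z Z)
      then obtain k where k: "k \<in> G" "\<And>v. v \<in> tball \<rho> n \<Longrightarrow> k v = v"
        "\<And>z s. z \<in> Z \<Longrightarrow> s \<in> star z \<Longrightarrow> k s = w s"
        "\<And>z s. z \<in> sphere - Z \<Longrightarrow> s \<in> star z \<Longrightarrow> k s = s" by auto
      have zs: "z \<in> sphere" using insert.prems by simp
      obtain k1 where k1: "k1 \<in> G" "\<And>v. v \<in> tball \<rho> n \<Longrightarrow> k1 v = v" "\<And>s. s \<in> star z \<Longrightarrow> k1 s = w s"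
        "\<And>z' s. z' \<in> sphere - {z} \<Longrightarrow> s \<in> star z' \<Longrightarrow> k1 s = s" using one[OF zs] by blast
      have a: "(k1 \<circ> k) v = v" if "v \<in> tball \<rho> n" for v using that k(2) k1(2) by simp
      have b: "(k1 \<circ> k) s = w s" if z': "z' \<in> insert z Z" and s: "s \<in> star z'" for z' s
      proof (cases "z' = z")
        case True
        then have "k s = s" using k(4)[of z s] zs insert.hyps(2) s by simp
        then show ?thesis using k1(3) s True by simp
      next
        case False
        then have zZ: "z' \<in> Z" using z' by simp
        then have z's: "z' \<in> sphere - {z}" using insert.prems False by auto
        \<comment> \<open>The new factor \<open>k1\<close> fixes \<open>star z'\<close>, which
          contains \<open>w s\<close>, so the agreement already achieved at \<open>z'\<close>
          survives.\<close>
        have "w s \<in> star z'" using w_star[of z' s] wz[of z'] z's s by (simp add: star_iff)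
        then show ?thesis using k(3)[OF zZ s] k1(4)[OF z's] by simp
      qed
      have c: "(k1 \<circ> k) s = s" if z': "z' \<in> sphere - insert z Z" and s: "s \<in> star z'" for z' s
        using k(4)[of z' s] k1(4)[of z' s] z' s by simp
      show ?case using G_comp[OF k1(1) k(1)] a b c by blast
    qed
    from this[OF fin order_refl] show ?thesis by blast
  qed
  then obtain k where k: "k \<in> G" "\<And>v. v \<in> tball \<rho> n \<Longrightarrow> k v = v" "\<And>z s. z \<in> sphere \<Longrightarrow> s \<in> star z \<Longrightarrow> k s = w s"
    by blast
  have "k v = w v" if "v \<in> tball \<rho> (Suc n)" for v
    using cover[OF that] k(2,3) w_fix by metis
  then show ?thesis using k(1) by blast
qed

text \<open>Dividing \<open>w\<close> by the element found for radius \<open>n\<close> leaves a map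
  fixing that ball, still with local permutations in \<open>F\<close> because \<open>G\<close> has
  them too. Parity places \<open>w \<rho>\<close> in the orbit of \<open>\<rho>\<close> at the
  start.\<close>

lemma agree_on_ball:
  assumes chart: "\<And>v. v \<in> V \<Longrightarrow> local_chart v i (D v) (F v)"
    and G_local: "\<And>g v. g \<in> G \<Longrightarrow> v \<in> V \<Longrightarrow> \<exists>f\<in>F v. \<forall>u\<in>star v. i (g u) = f (i u)"
    and \<rho>: "\<rho> \<in> V"
    and w_V: "\<And>v. v \<in> V \<Longrightarrow> w v \<in> V"
    and w_star: "\<And>v s. adj v s \<Longrightarrow> adj (w v) (w s)"
    and w_F: "\<And>v. v \<in> V \<Longrightarrow> F (w v) = F v"
    and w_local: "\<And>v. v \<in> V \<Longrightarrow> \<exists>f\<in>F v. \<forall>s\<in>star v. i (w s) = f (i s)"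
    and w_even: "even (td \<rho> (w \<rho>))"
  shows "\<exists>k\<in>G. \<forall>v\<in>tball \<rho> n. k v = w v"
proof (induction n)
  case 0
  have "tball \<rho> 0 = {\<rho>}" using td_0[OF \<rho>] \<rho> unfolding tball_def by auto
  then show ?case using even_transitive[OF \<rho> w_V[OF \<rho>] w_even] by auto
next
  case (Suc n)
  then obtain h where h: "h \<in> G" "\<And>v. v \<in> tball \<rho> n \<Longrightarrow> h v = w v" by blast
  have "\<exists>k\<in>G. \<forall>v\<in>tball \<rho> (Suc n). k v = (finv h \<circ> w) v"
  proof (rule agree_on_ball_Suc[OF chart \<rho>])
    show "adj ((finv h \<circ> w) v) ((finv h \<circ> w) s)" if "adj v s" for v s
      using w_star[OF that] G_adj[OF G_inv[OF h(1)]] by simp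
    show "(finv h \<circ> w) v = v" if "v \<in> tball \<rho> n" for v
      using h(2)[OF that, symmetric] h(1) by simp
    fix v assume v: "v \<in> V"
    obtain f where f: "f \<in> F v" "\<And>s. s \<in> star v \<Longrightarrow> i (w s) = f (i s)" using w_local[OF v] by blast
    obtain f' where f': "f' \<in> F v" "\<And>s. s \<in> star (w v) \<Longrightarrow> i (finv h s) = f' (i s)"
      using G_local[OF G_inv[OF h(1)] w_V[OF v]] w_F[OF v] by auto
    obtain f'' where f'': "f'' \<in> F v" "\<And>s. s \<in> star v \<Longrightarrow> f'' (i s) = f' (f (i s))"
      using local_chart_comp[OF chart[OF v] f(1) f'(1)] by blast
    have "i ((finv h \<circ> w) s) = f'' (i s)" if s: "s \<in> star v" for s
    proof -
      have "w s \<in> star (w v)" using w_star s star_iff by simp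
      then show ?thesis using f'(2) f(2)[OF s] f''(2)[OF s] by simp
    qed
    then show "\<exists>f\<in>F v. \<forall>s\<in>star v. i ((finv h \<circ> w) s) = f (i s)" using f''(1) by blast
  qed
  then obtain k where k: "k \<in> G" "\<And>v. v \<in> tball \<rho> (Suc n) \<Longrightarrow> k v = finv h (w v)" by auto
  have "(h \<circ> k) v = w v" if "v \<in> tball \<rho> (Suc n)" for v using k(2)[OF that] h(1) by simp
  then show ?case using G_comp[OF h(1) k(1)] by blast
qed

end

section \<open>Local actions, topology and ends\<close>

context line_transitive_group
begin

section \<open>The stabiliser of colour 1 as a local action\<close>

context
  fixes p z :: 'a and \<psi> :: "'a \<Rightarrow> nat" and n :: nat and F :: "(nat \<Rightarrow> nat) set"
  assumes pz: "adj p z" and chart: "local_chart z \<psi> n F" and F: "F \<subseteq> Bij {1..n}"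
    and \<psi>p: "\<psi> p = 1"
begin

definition chart_perm :: "('a \<Rightarrow> 'a) \<Rightarrow> nat \<Rightarrow> nat" where
  "chart_perm g = (\<lambda>k\<in>{1..n}. \<psi> (g (inv_into (star z) \<psi> k)))"

lemma chart_inv_into: "k \<in> {1..n} \<Longrightarrow> inv_into (star z) \<psi> k \<in> star z \<and> \<psi> (inv_into (star z) \<psi> k) = k"
  using local_chartD(1)[OF chart] unfolding bij_betw_def by (metis f_inv_into_f inv_into_into)

lemma chart_perm_apply: "u \<in> star z \<Longrightarrow> chart_perm g (\<psi> u) = \<psi> (g u)"
  using local_chart_in[OF chart, of u] local_chartD(1)[OF chart]
  unfolding chart_perm_def bij_betw_def by (simp add: inv_into_f_f)

lemma chart_perm_eqI:
  assumes "f \<in> F" "\<And>u. u \<in> star z \<Longrightarrow> \<psi> (g u) = f (\<psi> u)"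
  shows "chart_perm g = f"
proof (rule extensionalityI[of _ "{1..n}"])
  show "chart_perm g \<in> extensional {1..n}" by (simp add: chart_perm_def)
  show "f \<in> extensional {1..n}" using assms(1) F Bij_imp_extensional by blast
  show "chart_perm g k = f k" if "k \<in> {1..n}" for k
    using chart_inv_into[OF that] assms(2) that by (simp add: chart_perm_def)
qed

lemma chart_perm_eq_iff:
  assumes "g \<in> G" "h \<in> G" "g z = z" "h z = z"
  shows "chart_perm g = chart_perm h \<longleftrightarrow> (\<forall>u\<in>star z. g u = h u)"
proof
  assume eq: "chart_perm g = chart_perm h"
  show "\<forall>u\<in>star z. g u = h u"
  proof
    fix u assume u: "u \<in> star z"
    have "\<psi> (g u) = \<psi> (h u)" using chart_perm_apply[OF u, of g] chart_perm_apply[OF u, of h] eq by simp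
    moreover have "g u \<in> star z" "h u \<in> star z" using G_star' assms u by simp_all
    ultimately show "g u = h u"
      using local_chartD(1)[OF chart] unfolding bij_betw_def inj_on_def by blast
  qed
next
  assume "\<forall>u\<in>star z. g u = h u"
  then show "chart_perm g = chart_perm h"
    using chart_inv_into unfolding chart_perm_def by (intro restrict_ext) simp
qed

abbreviation stabilizer_group :: "(nat \<Rightarrow> nat) monoid" where
  "stabilizer_group \<equiv> (Sym n)\<lparr>carrier := point_stabilizer F 1\<rparr>"

lemma chart_perm_stabilizer:
  assumes g: "g \<in> fixator {p, z}"
  shows "chart_perm g \<in> point_stabilizer F 1"
proof -
  have "g \<in> fixator {z}" using g fixator_mono[of "{z}" "{p, z}"] by blast
  then obtain f where f: "f \<in> F" "\<And>u. u \<in> star z \<Longrightarrow> \<psi> (g u) = f (\<psi> u)"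
    using local_chartD(2)[OF chart] by blast
  have "p \<in> star z" using adj_sym[OF pz] star_iff by simp
  then have "f 1 = 1" using f(2)[of p] \<psi>p fixatorD(2)[OF g, of p] by simp
  then show ?thesis using chart_perm_eqI[of f g] f unfolding point_stabilizer_def by simp
qed

lemma chart_perm_surj:
  assumes f: "f \<in> point_stabilizer F 1"
  shows "\<exists>g\<in>fixator {p, z}. chart_perm g = f"
proof -
  have fF: "f \<in> F" "f 1 = 1" using f unfolding point_stabilizer_def by auto
  obtain g where g: "g \<in> fixator {z}" "\<And>u. u \<in> star z \<Longrightarrow> \<psi> (g u) = f (\<psi> u)"
    using local_chartD(3)[OF chart fF(1)] by blast
  have ps: "p \<in> star z" using adj_sym[OF pz] star_iff by simp
  then have "\<psi> (g p) = \<psi> p" using g(2)[of p] \<psi>p fF(2) by simp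
  moreover have "g p \<in> star z" using fixator_star[OF g(1)] ps by simp
  ultimately have "g p = p"
    using local_chartD(1)[OF chart] ps unfolding bij_betw_def inj_on_def by blast
  then have "g \<in> fixator {p, z}" using g(1) by (simp add: fixator_def)
  then show ?thesis using chart_perm_eqI[OF fF(1) g(2)] by blast
qed

lemma chart_perm_comp:
  assumes g: "g \<in> fixator {p, z}" and h: "h \<in> fixator {p, z}"
  shows "chart_perm (g \<circ> h) = chart_perm g \<otimes>\<^bsub>stabilizer_group\<^esub> chart_perm h"
proof -
  have B: "chart_perm g \<in> Bij {1..n}" "chart_perm h \<in> Bij {1..n}"
    using chart_perm_stabilizer[OF g] chart_perm_stabilizer[OF h] F unfolding point_stabilizer_def by auto
  have "chart_perm (g \<circ> h) = compose {1..n} (chart_perm g) (chart_perm h)"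
  proof (rule extensionalityI[of _ "{1..n}"])
    show "chart_perm (g \<circ> h) \<in> extensional {1..n}" by (simp add: chart_perm_def)
    fix k assume k: "k \<in> {1..n}"
    let ?u = "inv_into (star z) \<psi> k"
    have u: "?u \<in> star z" "\<psi> ?u = k" using chart_inv_into[OF k] by auto
    have "h ?u \<in> star z" using G_star'[of h z ?u] fixatorD[OF h] u(1) by simp
    then have "chart_perm g (chart_perm h (\<psi> ?u)) = \<psi> (g (h ?u))"
      using chart_perm_apply u(1) by simp
    moreover have "chart_perm (g \<circ> h) (\<psi> ?u) = \<psi> (g (h ?u))" using chart_perm_apply[OF u(1)] by simp
    ultimately show "chart_perm (g \<circ> h) k = compose {1..n} (chart_perm g) (chart_perm h) k"
      using u(2) k by (simp add: compose_def)
  qed simp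
  then show ?thesis using B by (simp add: BijGroup_def)
qed

lemma chart_perm_id: "chart_perm id = \<one>\<^bsub>stabilizer_group\<^esub>"
proof -
  have "chart_perm id = (\<lambda>k\<in>{1..n}. k)"
    using chart_inv_into unfolding chart_perm_def by (intro restrict_ext) simp
  then show ?thesis by (simp add: BijGroup_def)
qed

text \<open>The permutations induced by \<open>N\<close> form a normal subgroup of the stabiliser of
  1. Agreement on \<open>star z\<close> in \<open>nrm\<close> is enough, since
  \<open>chart_perm\<close> depends on the action there only.\<close>

lemma trivial_or_full_of_simple:
  assumes simple: "simple_group stabilizer_group"
    and N: "closed_subgroup N" "N \<subseteq> fixator {p, z}"
    and nrm: "\<And>g m. g \<in> fixator {p, z} \<Longrightarrow> m \<in> N \<Longrightarrow> \<exists>m'\<in>N. \<forall>v\<in>star z. m' v = g (m (finv g v))"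
  shows "trivial_at z N \<or> full_at p z N"
proof -
  interpret S: simple_group stabilizer_group by (rule simple)
  note Ns = N(1)[unfolded closed_subgroup_def]
  have inv: "inv\<^bsub>stabilizer_group\<^esub> (chart_perm g) = chart_perm (finv g)" if g: "g \<in> fixator {p, z}" for g
  proof (rule S.inv_equality)
    have "finv g \<circ> g = id" using fixatorD(1)[OF g] by (simp add: fun_eq_iff)
    then show "chart_perm (finv g) \<otimes>\<^bsub>stabilizer_group\<^esub> chart_perm g = \<one>\<^bsub>stabilizer_group\<^esub>"
      using chart_perm_comp[OF fixator_inv[OF g] g] chart_perm_id by simp
  qed (use chart_perm_stabilizer g fixator_inv in auto)
  have "subgroup (chart_perm ` N) stabilizer_group"
  proof (rule S.subgroupI)
    show "chart_perm ` N \<subseteq> carrier stabilizer_group" using chart_perm_stabilizer N(2) by auto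
    show "chart_perm ` N \<noteq> {}" using Ns by blast
    fix a assume "a \<in> chart_perm ` N"
    then obtain m where m: "m \<in> N" "a = chart_perm m" by blast
    have "finv m \<in> N" using m(1) Ns by blast
    then show "inv\<^bsub>stabilizer_group\<^esub> a \<in> chart_perm ` N" using inv[of m] m N(2) by auto
    fix b assume "b \<in> chart_perm ` N"
    then obtain m' where m': "m' \<in> N" "b = chart_perm m'" by blast
    have "m \<circ> m' \<in> N" using m(1) m'(1) Ns by blast
    moreover have "a \<otimes>\<^bsub>stabilizer_group\<^esub> b = chart_perm (m \<circ> m')"
      using chart_perm_comp[OF subsetD[OF N(2) m(1)] subsetD[OF N(2) m'(1)]] m(2) m'(2) by metis
    ultimately show "a \<otimes>\<^bsub>stabilizer_group\<^esub> b \<in> chart_perm ` N" by blast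
  qed
  moreover have "x \<otimes>\<^bsub>stabilizer_group\<^esub> a \<otimes>\<^bsub>stabilizer_group\<^esub> inv\<^bsub>stabilizer_group\<^esub> x \<in> chart_perm ` N"
    if x: "x \<in> carrier stabilizer_group" and a: "a \<in> chart_perm ` N" for x a
  proof -
    have "x \<in> point_stabilizer F 1" using x by simp
    then obtain g where g: "g \<in> fixator {p, z}" "x = chart_perm g" using chart_perm_surj by metis
    obtain m where m: "m \<in> N" "a = chart_perm m" using a by blast
    have mf: "m \<in> fixator {p, z}" using m N(2) by blast
    have gm: "g \<circ> m \<in> fixator {p, z}" using fixator_comp[OF g(1) mf] .
    have gmg: "g \<circ> m \<circ> finv g \<in> fixator {p, z}" using fixator_comp[OF gm fixator_inv[OF g(1)]] .
    have "x \<otimes>\<^bsub>stabilizer_group\<^esub> a \<otimes>\<^bsub>stabilizer_group\<^esub> inv\<^bsub>stabilizer_group\<^esub> x = chart_perm (g \<circ> m \<circ> finv g)"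
      using chart_perm_comp[OF g(1) mf] chart_perm_comp[OF gm fixator_inv[OF g(1)]] inv[OF g(1)] g(2) m(2)
      by simp
    moreover obtain m' where m': "m' \<in> N" "\<And>v. v \<in> star z \<Longrightarrow> m' v = g (m (finv g v))"
      using nrm[OF g(1) m(1)] by blast
    have "chart_perm (g \<circ> m \<circ> finv g) = chart_perm m'"
    proof (subst chart_perm_eq_iff)
      show "g \<circ> m \<circ> finv g \<in> G" "(g \<circ> m \<circ> finv g) z = z" using fixatorD[OF gmg] by simp_all
      show "m' \<in> G" "m' z = z" using m'(1) N(2) fixatorD[of m' "{p, z}"] by auto
    qed (use m'(2) in auto)
    ultimately show ?thesis using m'(1) by simp
  qed
  ultimately have "chart_perm ` N \<lhd> stabilizer_group" using S.normal_inv_iff by blast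
  then consider "chart_perm ` N = carrier stabilizer_group" | "chart_perm ` N = {\<one>\<^bsub>stabilizer_group\<^esub>}"
    using S.no_real_normal_subgroup by blast
  then show ?thesis
  proof cases
    case 1
    have "full_at p z N"
      unfolding full_at_def
    proof
      fix g assume g: "g \<in> fixator {p, z}"
      have "chart_perm g \<in> chart_perm ` N" using 1 chart_perm_stabilizer[OF g] by simp
      then obtain m where m: "m \<in> N" "chart_perm m = chart_perm g" by (metis imageE)
      have mf: "m \<in> fixator {p, z}" using m N(2) by blast
      have "\<forall>u\<in>star z. m u = g u"
        using chart_perm_eq_iff[of m g] m(2) fixatorD[OF mf] fixatorD[OF g] by simp
      then show "\<exists>k\<in>N. \<forall>v\<in>star z. k v = g v" using m(1) by blast
    qed
    then show ?thesis by blast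
  next
    case 2
    have "trivial_at z N"
      unfolding trivial_at_def
    proof
      fix m assume m: "m \<in> N"
      have mf: "m \<in> fixator {p, z}" using m N(2) by blast
      have "chart_perm m = chart_perm id" using 2 m chart_perm_id by auto
      then show "\<forall>v\<in>star z. m v = v"
        using chart_perm_eq_iff[of m id] fixatorD[OF mf] G_id by simp
    qed
    then show ?thesis by blast
  qed
qed

lemma noncommuting_of_nonabelian:
  assumes simple: "simple_group stabilizer_group" and nonab: "\<not> comm_group stabilizer_group"
  shows "\<exists>g\<in>fixator {p, z}. \<exists>h\<in>fixator {p, z}. \<exists>v\<in>star z. g (h v) \<noteq> h (g v)"
proof (rule ccontr)
  assume c: "\<not> ?thesis"
  interpret S: simple_group stabilizer_group by (rule simple)
  have "comm_group stabilizer_group"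
  proof (rule S.group_comm_groupI)
    fix x y assume xy: "x \<in> carrier stabilizer_group" "y \<in> carrier stabilizer_group"
    have "x \<in> point_stabilizer F 1" "y \<in> point_stabilizer F 1" using xy by simp_all
    then obtain g h where gh: "g \<in> fixator {p, z}" "x = chart_perm g" "h \<in> fixator {p, z}" "y = chart_perm h"
      using chart_perm_surj by metis
    have "chart_perm (g \<circ> h) = chart_perm (h \<circ> g)"
    proof (subst chart_perm_eq_iff)
      show "g \<circ> h \<in> G" "h \<circ> g \<in> G" using gh fixatorD(1) G_comp by blast+
      show "(g \<circ> h) z = z" "(h \<circ> g) z = z" using fixatorD(2)[OF gh(1)] fixatorD(2)[OF gh(3)] by simp_all
      show "\<forall>u\<in>star z. (g \<circ> h) u = (h \<circ> g) u" using c gh by auto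
    qed
    then show "x \<otimes>\<^bsub>stabilizer_group\<^esub> y = y \<otimes>\<^bsub>stabilizer_group\<^esub> x"
      using chart_perm_comp gh by simp
  qed
  then show False using nonab by blast
qed

end

end

text \<open>A permutation of at most two points that fixes 1 is the identity, so the stabiliser
  would be abelian. The bound yields the axiom of \<open>thick_tree\<close>.\<close>

lemma nonabelian_stabilizer_degree:
  assumes simple: "simple_group ((Sym n)\<lparr>carrier := point_stabilizer F 1\<rparr>)"
    and nonab: "\<not> comm_group ((Sym n)\<lparr>carrier := point_stabilizer F 1\<rparr>)"
    and F: "F \<subseteq> Bij {1..n}"
  shows "n \<ge> 3"
proof (rule ccontr)
  assume "\<not> n \<ge> 3"
  then have n: "{1..n} \<subseteq> {1, 2}" by auto
  interpret S: simple_group "(Sym n)\<lparr>carrier := point_stabilizer F 1\<rparr>" by (rule simple)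
  have id: "f = (\<lambda>k\<in>{1..n}. k)" if f: "f \<in> point_stabilizer F 1" for f
  proof (rule extensionalityI[of _ "{1..n}"])
    have fB: "f \<in> Bij {1..n}" "f 1 = 1" using f F unfolding point_stabilizer_def by auto
    show "f \<in> extensional {1..n}" using fB(1) Bij_imp_extensional by blast
    have bij: "bij_betw f {1..n} {1..n}" using fB(1) by (simp add: Bij_def)
    fix k assume k: "k \<in> {1..n}"
    have "1 \<in> {1..n}" using k by auto
    then have "f k = f 1 \<longleftrightarrow> k = 1" using bij k unfolding bij_betw_def inj_on_def by blast
    moreover have "f k \<in> {1, 2}" "k \<in> {1, 2}" using bij k n bij_betwE by blast+
    ultimately show "f k = restrict (\<lambda>k. k) {1..n} k" using fB(2) k by auto
  qed simp
  have "comm_group ((Sym n)\<lparr>carrier := point_stabilizer F 1\<rparr>)"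
  proof (rule S.group_comm_groupI)
    fix x y
    assume "x \<in> carrier ((Sym n)\<lparr>carrier := point_stabilizer F 1\<rparr>)"
      "y \<in> carrier ((Sym n)\<lparr>carrier := point_stabilizer F 1\<rparr>)"
    then have "x = y" using id[of x] id[of y] by simp
    then show "x \<otimes>\<^bsub>(Sym n)\<lparr>carrier := point_stabilizer F 1\<rparr>\<^esub> y =
      y \<otimes>\<^bsub>(Sym n)\<lparr>carrier := point_stabilizer F 1\<rparr>\<^esub> x" by simp
  qed
  then show False using nonab by blast
qed

text \<open>Were \<open>u\<close> outside \<open>H\<close>, a basic open set around it would miss
  \<open>H\<close>. Such a set constrains finitely many vertices, and \<open>H\<close> contains an
  element agreeing with \<open>u\<close> on these.\<close>

lemma closedin_aut_topologyD:
  assumes cl: "closedin (aut_topology V E) H" and u: "u \<in> tree_aut V E"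
    and approx: "\<And>A. finite A \<Longrightarrow> A \<subseteq> V \<Longrightarrow> \<exists>h\<in>H. \<forall>v\<in>A. h v = u v"
  shows "u \<in> H"
proof (rule ccontr)
  assume nu: "u \<notin> H"
  let ?X = "product_topology (\<lambda>_. discrete_topology V) V"
  have HV: "H \<subseteq> tree_aut V E" using closedin_subset[OF cl] topspace_aut_topology by blast
  have "openin (aut_topology V E) (tree_aut V E - H)"
    using cl topspace_aut_topology unfolding closedin_def by metis
  then obtain T where T: "openin ?X T" "tree_aut V E - H = T \<inter> tree_aut V E"
    unfolding aut_topology_def openin_subtopology by blast
  have "u \<in> T" using T(2) u nu by blast
  then obtain U where U: "finite {i \<in> V. U i \<noteq> topspace (discrete_topology V)}"
      "u \<in> Pi\<^sub>E V U" "Pi\<^sub>E V U \<subseteq> T"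
    using T(1) unfolding openin_product_topology_alt by blast
  let ?A = "{i \<in> V. U i \<noteq> topspace (discrete_topology V)}"
  obtain h where h: "h \<in> H" "\<And>v. v \<in> ?A \<Longrightarrow> h v = u v" using approx[OF U(1)] by blast
  have hB: "h \<in> Bij V" using h(1) HV unfolding tree_aut_def by blast
  have "h \<in> Pi\<^sub>E V U"
  proof (rule PiE_I)
    fix v assume v: "v \<in> V"
    show "h v \<in> U v"
    proof (cases "v \<in> ?A")
      case True
      then show ?thesis using h(2) U(2) v by (auto dest: PiE_mem)
    next
      case False
      then have "U v = V" using v by simp
      then show ?thesis using Bij_imp_funcset[OF hB] v by auto
    qed
  next
    fix v assume "v \<notin> V"
    then show "h v = undefined" using Bij_imp_extensional[OF hB] by (simp add: extensional_def)
  qed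
  then have "h \<in> tree_aut V E - H" using T(2) U(3) h(1) HV by blast
  then show False using h(1) by blast
qed

context tree_metric
begin

text \<open>The stretch between the tails has the same length on both lines, so the shifts at the
  two ends agree and serve as \<open>s\<close>. In between, \<open>L j\<close> and
  \<open>L' (j + s)\<close> lie at equal distance along the geodesic between the same two
  vertices.\<close>

lemma lines_coincide:
  assumes L: "is_line L" "is_line L'"
    and pos: "\<And>k. L' (int m + int k) = L (int n + int k)"
    and neg: "\<And>k. L' (- int m' - int k) = L (- int n' - int k)"
  shows "\<exists>s. \<forall>k. L k = L' (k + s)"
proof -
  have "td (L (- int n')) (L (int n)) = n' + n"
    using td_line[OF L(1), of "- int n'" "n' + n"] by simp
  moreover have "td (L' (- int m')) (L' (int m)) = m' + m"
    using td_line[OF L(2), of "- int m'" "m' + m"] by simp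
  ultimately have eq: "m' + m = n' + n" using pos[of 0] neg[of 0] by simp
  define s where "s = int m - int n"
  have "L j = L' (j + s)" for j
  proof -
    consider "j \<ge> int n" | "j \<le> - int n'" | "- int n' \<le> j" "j \<le> int n" by linarith
    then show ?thesis
    proof cases
      case 1
      then have "L' (int m + (j - int n)) = L (int n + (j - int n))" using pos[of "nat (j - int n)"] by simp
      then show ?thesis by (simp add: s_def algebra_simps)
    next
      case 2
      have s': "s = int n' - int m'" using eq by (simp add: s_def)
      have "L' (- int m' - (- j - int n')) = L (- int n' - (- j - int n'))"
        using neg[of "nat (- j - int n')"] 2 by simp
      then show ?thesis by (simp add: s' algebra_simps)
    next
      case 3
      let ?a = "L (- int n')" and ?b = "L (int n)"
      have s': "s = int n' - int m'" using eq by (simp add: s_def)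
      have ab: "?a = L' (- int n' + s)" "?b = L' (int n + s)"
      proof -
        have "- int n' + s = - int m'" "int n + s = int m" using s' by (simp_all add: s_def)
        then show "?a = L' (- int n' + s)" "?b = L' (int n + s)" using pos[of 0] neg[of 0] by simp_all
      qed
      have D: "int (td ?a (L j)) = j + int n'" "int (td (L j) ?b) = int n - j"
        "int (td ?a ?b) = int n + int n'"
        using td_line_le[OF L(1)] 3 by simp_all
      have D': "int (td ?a (L' (j + s))) = j + int n'" "int (td (L' (j + s)) ?b) = int n - j"
        unfolding ab using td_line_le[OF L(2)] 3 by simp_all
      show ?thesis
        by (rule td_between_unique[of ?a ?b]) (use is_line_V[OF L(1)] is_line_V[OF L(2)] D D' in linarith | use is_line_V[OF L(1)] is_line_V[OF L(2)] in blast)+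
    qed
  qed
  then show ?thesis by blast
qed

end

section \<open>Ends of the tree and bi-infinite lines\<close>

context combinatorial_tree
begin

lemma graph_ray_iff: "graph_ray V E r \<longleftrightarrow> is_ray r"
proof
  assume r: "graph_ray V E r"
  then have "r k \<noteq> r (Suc (Suc k))" for k
    unfolding graph_ray_def inj_def by (metis n_not_Suc_n Suc_n_not_n lessI less_SucI less_irrefl_nat)
  then show "is_ray r" using r unfolding graph_ray_def is_ray_def adj_def by blast
next
  assume r: "is_ray r"
  have "range r \<subseteq> V" using is_ray_V[OF r] by blast
  then show "graph_ray V E r"
    using r ray_inj[OF r] unfolding graph_ray_def is_ray_def adj_def by blast
qed

lemma half_lines:
  assumes l: "is_line l"
  shows "is_ray (\<lambda>k. l (int k))" "is_ray (\<lambda>k. l (- int k))"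
proof -
  have A: "adj (l j) (l (j + 1))" "l j \<noteq> l (j + 2)" for j using l unfolding is_line_def by blast+
  show "is_ray (\<lambda>k. l (int k))"
    unfolding is_ray_def
  proof
    fix k show "adj (l (int k)) (l (int (Suc k))) \<and> l (int k) \<noteq> l (int (Suc (Suc k)))"
      using A[of "int k"] by (simp add: algebra_simps)
  qed
  show "is_ray (\<lambda>k. l (- int k))"
    unfolding is_ray_def
  proof
    fix k
    have "- int (Suc k) + 1 = - int k" "- int (Suc (Suc k)) + 2 = - int k" by auto
    then show "adj (l (- int k)) (l (- int (Suc k))) \<and> l (- int k) \<noteq> l (- int (Suc (Suc k)))"
      using adj_sym[OF A(1)[of "- int (Suc k)"]] A(2)[of "- int (Suc (Suc k))"] by metis
  qed
qed

lemma tail_equivD: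
  "(r, s) \<in> tail_equiv V E \<Longrightarrow> \<exists>m n. \<forall>k. r (m + k) = s (n + k)"
  unfolding tail_equiv_def by simp

lemma end_of_ray:
  assumes "is_ray r"
  shows "tail_equiv V E `` {r} \<in> tree_ends V E" "r \<in> tail_equiv V E `` {r}"
proof -
  have r: "r \<in> {r. graph_ray V E r}" using assms graph_ray_iff by simp
  show "tail_equiv V E `` {r} \<in> tree_ends V E" unfolding tree_ends_def using r by (rule quotientI)
  show "r \<in> tail_equiv V E `` {r}" using equiv_class_self[OF equiv_tail_equiv r] .
qed

lemma ends_of_line_distinct:
  assumes l: "is_line l"
  shows "tail_equiv V E `` {\<lambda>k. l (int k)} \<noteq> tail_equiv V E `` {\<lambda>k. l (- int k)}"
proof
  assume "tail_equiv V E `` {\<lambda>k. l (int k)} = tail_equiv V E `` {\<lambda>k. l (- int k)}"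
  then have "(\<lambda>k. l (- int k)) \<in> tail_equiv V E `` {\<lambda>k. l (int k)}"
    using end_of_ray(2)[OF half_lines(2)[OF l]] by simp
  then obtain m n where mn: "\<And>k. l (int (m + k)) = l (- int (n + k))"
    using tail_equivD by blast
  \<comment> \<open>Comparing at \<open>k = 1\<close> also covers \<open>m = n = 0\<close>, where
    the half-lines share their origin.\<close>
  have "int (m + 1) = - int (n + 1)" using line_inj[OF l mn] .
  then show False by simp
qed

text \<open>An element matching the two ends of \<open>l\<close> with those of \<open>l'\<close>
  makes the image line share a tail with \<open>l'\<close> in both directions;
  \<open>lines_coincide\<close> then matches the lines up to a shift.\<close>

lemma line_transitive_of_ends:
  assumes tt: "two_transitive_on H end_action (tree_ends V E)"
    and H: "\<And>h x y. h \<in> H \<Longrightarrow> x \<in> V \<Longrightarrow> y \<in> V \<Longrightarrow> adj (h x) (h y) \<longleftrightarrow> adj x y"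
      "\<And>h x y. h \<in> H \<Longrightarrow> x \<in> V \<Longrightarrow> y \<in> V \<Longrightarrow> h x = h y \<Longrightarrow> x = y"
    and l: "is_line l" "is_line l'"
  shows "\<exists>h\<in>H. \<exists>s. \<forall>k. h (l k) = l' (k + s)"
proof -
  let ?e = "\<lambda>r. tail_equiv V E `` {r}"
  let ?p = "\<lambda>l k. l (int k)" and ?n = "\<lambda>l k. l (- int k)"
  note hl = half_lines[OF l(1)] and hl' = half_lines[OF l(2)]
  have "\<exists>h\<in>H. end_action h (?e (?p l)) = ?e (?p l') \<and> end_action h (?e (?n l)) = ?e (?n l')"
    using tt[unfolded two_transitive_on_def, rule_format, OF end_of_ray(1)[OF hl(1)]
      end_of_ray(1)[OF hl(2)] end_of_ray(1)[OF hl'(1)] end_of_ray(1)[OF hl'(2)]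
      ends_of_line_distinct[OF l(1)] ends_of_line_distinct[OF l(2)]] .
  then obtain h where h: "h \<in> H" "end_action h (?e (?p l)) = ?e (?p l')"
    "end_action h (?e (?n l)) = ?e (?n l')" by blast
  have "h \<circ> ?p l \<in> ?e (?p l')"
    unfolding h(2)[symmetric] end_action_def using end_of_ray(2)[OF hl(1)] by (rule imageI)
  then have "(?p l', h \<circ> ?p l) \<in> tail_equiv V E" by simp
  then obtain m n where a: "\<And>k. l' (int (m + k)) = (h \<circ> ?p l) (n + k)"
    using tail_equivD by meson
  have "h \<circ> ?n l \<in> ?e (?n l')"
    unfolding h(3)[symmetric] end_action_def using end_of_ray(2)[OF hl(2)] by (rule imageI)
  then have "(?n l', h \<circ> ?n l) \<in> tail_equiv V E" by simp
  then obtain m' n' where a': "\<And>k. l' (- int (m' + k)) = (h \<circ> ?n l) (n' + k)"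
    using tail_equivD by meson
  have "is_line (\<lambda>k. h (l k))"
    unfolding is_line_def
  proof
    fix k
    have "adj (l k) (l (k + 1))" "l k \<noteq> l (k + 2)" using l(1) unfolding is_line_def by blast+
    then show "adj (h (l k)) (h (l (k + 1))) \<and> h (l k) \<noteq> h (l (k + 2))"
      using H(1)[OF h(1) is_line_V[OF l(1)] is_line_V[OF l(1)]]
        H(2)[OF h(1) is_line_V[OF l(1)] is_line_V[OF l(1)]] by blast
  qed
  moreover have "l' (int m + int k) = h (l (int n + int k))" for k using a[of k] by simp
  moreover have "l' (- int m' - int k) = h (l (- int n' - int k))" for k
    proof -
    have "- int (j + k) = - int j - int k" for j by simp
    then show ?thesis using a'[of k] unfolding comp_def by metis
  qed
  ultimately show ?thesis using lines_coincide[of "\<lambda>k. h (l k)" l' m n m' n'] l(2) h(1) by blast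
qed

end

section \<open>The universal group\<close>

locale boundary_two_transitive_group =
  fixes V0 V1 :: "'a set" and E :: "'a set set" and d0 d1 :: nat
    and F0 F1 :: "(nat \<Rightarrow> nat) set" and H :: "('a \<Rightarrow> 'a) set"
  assumes tree: "semiregular_tree V0 V1 E d0 d1"
    and F0: "subgroup F0 (Sym d0)"
    and F1: "subgroup F1 (Sym d1)"
    and H: "H \<in> HT_plus V0 V1 E"
    and perm0: "\<And>x. x \<in> V0 \<Longrightarrow>
           permutation_isomorphic (incident_edges E x) (local_action E H x) {1..d0} F0"
    and perm1: "\<And>y. y \<in> V1 \<Longrightarrow>
           permutation_isomorphic (incident_edges E y) (local_action E H y) {1..d1} F1"
    and simple0: "simple_group ((Sym d0)\<lparr>carrier := point_stabilizer F0 1\<rparr>)"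
    and nonab0: "\<not> comm_group ((Sym d0)\<lparr>carrier := point_stabilizer F0 1\<rparr>)"
    and simple1: "simple_group ((Sym d1)\<lparr>carrier := point_stabilizer F1 1\<rparr>)"
    and nonab1: "\<not> comm_group ((Sym d1)\<lparr>carrier := point_stabilizer F1 1\<rparr>)"
begin

abbreviation V :: "'a set" where "V \<equiv> V0 \<union> V1"

sublocale combinatorial_tree "V0 \<union> V1" E
  using tree unfolding semiregular_tree_def by unfold_locales blast

definition D :: "'a \<Rightarrow> nat" where "D v = (if v \<in> V0 then d0 else d1)"

definition F :: "'a \<Rightarrow> (nat \<Rightarrow> nat) set" where "F v = (if v \<in> V0 then F0 else F1)"

text \<open>The elements of \<open>H\<close> are extensional; extending them by the identity turns composition in
  \<open>aut_group\<close> into composition of functions.\<close>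

definition totalise :: "('a \<Rightarrow> 'a) \<Rightarrow> 'a \<Rightarrow> 'a" where
  "totalise h x = (if x \<in> V then h x else x)"

abbreviation G :: "('a \<Rightarrow> 'a) set" where "G \<equiv> totalise ` H"

lemma disjoint_types: "V0 \<inter> V1 = {}"
  using tree unfolding semiregular_tree_def by blast

lemma edge_types: "adj x y \<Longrightarrow> x \<in> V0 \<longleftrightarrow> y \<notin> V0"
proof -
  assume "adj x y"
  then obtain a b where "a \<in> V0" "b \<in> V1" "{x, y} = {a, b}"
    using tree unfolding semiregular_tree_def adj_def by metis
  then show ?thesis using disjoint_types by (auto simp: doubleton_eq_iff)
qed

lemma incident_edges_eq: "incident_edges E x = (\<lambda>u. {x, u}) ` {u. adj x u}"
proof
  show "incident_edges E x \<subseteq> (\<lambda>u. {x, u}) ` {u. adj x u}"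
  proof
    fix e assume e: "e \<in> incident_edges E x"
    then obtain a b where "e = {a, b}"
      using tree unfolding semiregular_tree_def incident_edges_def by blast
    then have "e = {x, a} \<or> e = {x, b}" using e unfolding incident_edges_def by auto
    then show "e \<in> (\<lambda>u. {x, u}) ` {u. adj x u}" using e unfolding incident_edges_def adj_def by blast
  qed
qed (auto simp: incident_edges_def adj_def)

lemma edge_inj: "inj_on (\<lambda>u. {x, u}) A"
  by (auto simp: inj_on_def doubleton_eq_iff)

lemma F_Bij: "F v \<subseteq> Bij {1..D v}"
  using subgroup.subset[OF F0] subgroup.subset[OF F1] by (auto simp: F_def D_def BijGroup_def)

lemma simple_F: "simple_group ((Sym (D v))\<lparr>carrier := point_stabilizer (F v) 1\<rparr>)"
  and nonab_F: "\<not> comm_group ((Sym (D v))\<lparr>carrier := point_stabilizer (F v) 1\<rparr>)"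
  using simple0 simple1 nonab0 nonab1 by (simp_all add: D_def F_def)

lemma D_ge_3: "D v \<ge> 3"
  using nonabelian_stabilizer_degree[OF simple_F nonab_F F_Bij] .

lemma degree:
  assumes "x \<in> V"
  shows "finite {u. adj x u}" "card {u. adj x u} = D x"
proof -
  have "finite (incident_edges E x)" "card (incident_edges E x) = D x"
    using tree assms disjoint_types unfolding semiregular_tree_def D_def by auto
  then show "finite {u. adj x u}" "card {u. adj x u} = D x"
    unfolding incident_edges_eq by (simp_all add: finite_image_iff[OF edge_inj] card_image[OF edge_inj])
qed

sublocale thick_tree "V0 \<union> V1" adj td
proof
  fix x a b assume x: "x \<in> V"
  show "\<exists>c. adj x c \<and> c \<noteq> a \<and> c \<noteq> b"
  proof (rule ccontr)
    assume "\<not> ?thesis"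
    then have "{u. adj x u} \<subseteq> {a, b}" by blast
    then have "card {u. adj x u} \<le> card {a, b}" by (intro card_mono) auto
    moreover have "card {a, b} \<le> 2" by (cases "a = b") auto
    ultimately show False using degree(2)[OF x] D_ge_3[of x] by simp
  qed
qed

lemma H_subgroup: "subgroup H (aut_group V E)"
  and H_closed: "closedin (aut_topology V E) H"
  and H_plus: "H \<subseteq> tree_aut_plus V0 V1 E"
  and H_ends: "two_transitive_on H end_action (tree_ends V E)"
  using H unfolding HT_plus_def by blast+

lemma H_aut:
  assumes "h \<in> H"
  shows "h \<in> tree_aut V E" "h \<in> Bij V" "h ` V0 = V0" "bij_betw h V V"
    "\<And>x. x \<in> V \<Longrightarrow> h x \<in> V" "\<And>x y. x \<in> V \<Longrightarrow> y \<in> V \<Longrightarrow> adj (h x) (h y) \<longleftrightarrow> adj x y"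
    "\<And>x y. x \<in> V \<Longrightarrow> y \<in> V \<Longrightarrow> h x = h y \<Longrightarrow> x = y"
proof -
  show t: "h \<in> tree_aut V E" and "h ` V0 = V0" using assms H_plus unfolding tree_aut_plus_def by blast+
  then show B: "h \<in> Bij V" unfolding tree_aut_def by blast
  then show b: "bij_betw h V V" unfolding Bij_def by blast
  show "\<And>x. x \<in> V \<Longrightarrow> h x \<in> V" using b bij_betwE by blast
  show "\<And>x y. x \<in> V \<Longrightarrow> y \<in> V \<Longrightarrow> adj (h x) (h y) \<longleftrightarrow> adj x y" using t unfolding tree_aut_def adj_def by blast
  show "\<And>x y. x \<in> V \<Longrightarrow> y \<in> V \<Longrightarrow> h x = h y \<Longrightarrow> x = y" using b unfolding bij_betw_def inj_on_def by blast
qed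

lemma aut_group_mult: "g \<in> H \<Longrightarrow> h \<in> H \<Longrightarrow> g \<otimes>\<^bsub>aut_group V E\<^esub> h = compose V g h"
  using H_aut(2) unfolding aut_group_def by (simp add: BijGroup_def)

lemma aut_group_one: "\<one>\<^bsub>aut_group V E\<^esub> = (\<lambda>x\<in>V. x)"
  unfolding aut_group_def by (simp add: BijGroup_def)

lemma totalise_compose: "h \<in> H \<Longrightarrow> totalise (compose V g h) = totalise g \<circ> totalise h"
  using H_aut(5) by (auto simp: totalise_def compose_def fun_eq_iff)

lemma bij_totalise: "h \<in> H \<Longrightarrow> bij (totalise h)"
proof -
  assume h: "h \<in> H"
  have "bij_betw (totalise h) V V"
    using H_aut(4)[OF h] bij_betw_cong[of V "totalise h" h] by (simp add: totalise_def)
  moreover have "bij_betw (totalise h) (- V) (- V)"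
    using bij_betw_cong[of "- V" "totalise h" id] by (simp add: totalise_def)
  ultimately have "bij_betw (totalise h) (V \<union> - V) (V \<union> - V)" by (rule bij_betw_combine) blast
  then show "bij (totalise h)" unfolding Compl_partition .
qed

sublocale line_transitive_group "V0 \<union> V1" adj td "totalise ` H"
proof
  interpret A: group "aut_group V E" by (rule group_aut_group)
  show "bij g" if "g \<in> G" for g using that bij_totalise by blast
  have "totalise (\<lambda>x\<in>V. x) = id" by (auto simp: totalise_def)
  then show "id \<in> G" using subgroup.one_closed[OF H_subgroup] aut_group_one by (metis imageI)
  show comp: "g \<circ> h \<in> G" if gh: "g \<in> G" "h \<in> G" for g h
  proof -
    obtain g' h' where g': "g' \<in> H" "g = totalise g'" and h': "h' \<in> H" "h = totalise h'" using gh by blast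
    have "compose V g' h' \<in> H"
      using subgroup.m_closed[OF H_subgroup g'(1) h'(1)] aut_group_mult[OF g'(1) h'(1)] by simp
    then show ?thesis using totalise_compose[OF h'(1), of g'] g' h' by (metis imageI)
  qed
  show "finv g \<in> G" if g: "g \<in> G" for g
  proof -
    obtain h where h: "h \<in> H" "g = totalise h" using g by blast
    let ?k = "inv\<^bsub>aut_group V E\<^esub> h"
    have k: "?k \<in> H" using subgroup.m_inv_closed[OF H_subgroup h(1)] .
    have "h \<in> carrier (aut_group V E)" using subgroup.subset[OF H_subgroup] h(1) by blast
    then have "compose V ?k h = (\<lambda>x\<in>V. x)"
      using A.l_inv aut_group_mult[OF k h(1)] aut_group_one by simp
    then have "totalise ?k \<circ> g = id"
      using totalise_compose[OF h(1), of ?k] h(2) \<open>totalise (\<lambda>x\<in>V. x) = id\<close> by simp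
    then have "finv g = totalise ?k"
      using bij_totalise[OF h(1)] h(2) by (metis bij_is_surj comp_apply fun_eq_iff id_apply surj_f_inv_f)
    then show ?thesis using k by blast
  qed
  show "adj (g x) (g y) \<longleftrightarrow> adj x y" if g: "g \<in> G" for g x y
  proof -
    obtain h where h: "h \<in> H" "g = totalise h" using g by blast
    show ?thesis
    proof (cases "x \<in> V \<and> y \<in> V")
      case True
      then show ?thesis using H_aut(6)[OF h(1)] h(2) by (simp add: totalise_def)
    next
      case False
      \<comment> \<open>Outside \<open>V\<close> there are no edges, and \<open>g\<close> preserves
        \<open>V\<close> and its complement.\<close>
      have m: "g u \<in> V \<longleftrightarrow> u \<in> V" for u using H_aut(5)[OF h(1)] h(2) unfolding totalise_def by metis
      have "\<not> adj a b" if "a \<notin> V \<or> b \<notin> V" for a b using that adj_V adj_V2 by blast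
      then show ?thesis using False m by metis
    qed
  qed
  show "\<exists>g\<in>G. \<exists>s. \<forall>k. g (l k) = l' (k + s)" if l: "is_line l" "is_line l'" for l l'
  proof -
    have "\<exists>h\<in>H. \<exists>s. \<forall>k. h (l k) = l' (k + s)"
      by (rule line_transitive_of_ends[OF H_ends _ _ l]) (rule H_aut(6,7); assumption)+
    then obtain h s where h: "h \<in> H" "\<And>k. h (l k) = l' (k + s)" by blast
    have "totalise h (l k) = l' (k + s)" for k using h(2) is_line_V[OF l(1)] by (simp add: totalise_def)
    then show ?thesis using h(1) by blast
  qed
qed

lemma G_types: "g \<in> G \<Longrightarrow> v \<in> V \<Longrightarrow> g v \<in> V0 \<longleftrightarrow> v \<in> V0"
proof -
  assume g: "g \<in> G" and v: "v \<in> V"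
  obtain h where h: "h \<in> H" "g = totalise h" using g by blast
  have gv: "g v = h v" using h v by (simp add: totalise_def)
  show "g v \<in> V0 \<longleftrightarrow> v \<in> V0"
  proof
    assume "g v \<in> V0"
    then obtain u where u: "u \<in> V0" "h u = h v" using H_aut(3)[OF h(1)] gv by (metis imageE)
    then show "v \<in> V0" using H_aut(7)[OF h(1), of u v] v by simp
  qed (use H_aut(3)[OF h(1)] gv in blast)
qed

lemma D_inv: "g \<in> G \<Longrightarrow> v \<in> V \<Longrightarrow> D (g v) = D v"
  and F_inv: "g \<in> G \<Longrightarrow> v \<in> V \<Longrightarrow> F (g v) = F v"
  using G_types by (simp_all add: D_def F_def)

text \<open>Neighbours \<open>u\<close> of \<open>v\<close> correspond to edges
  \<open>{v, u}\<close>, which turns the permutation isomorphism on edges into a chart on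
  vertices.\<close>

lemma charts_exist:
  assumes v: "v \<in> V"
  shows "\<exists>\<psi>. local_chart v \<psi> (D v) (F v)"
proof -
  have "permutation_isomorphic (incident_edges E v) (local_action E H v) {1..D v} (F v)"
    using perm0 perm1 v by (auto simp: D_def F_def)
  then obtain \<phi> where \<phi>: "bij_betw \<phi> (incident_edges E v) {1..D v}"
      "F v = (\<lambda>p. \<lambda>k\<in>{1..D v}. \<phi> (p (inv_into (incident_edges E v) \<phi> k))) ` local_action E H v"
    unfolding permutation_isomorphic_def by blast
  define \<psi> where "\<psi> u = \<phi> {v, u}" for u
  have inc: "incident_edges E v = (\<lambda>u. {v, u}) ` star v"
    using incident_edges_eq[of v] by (simp add: star_def)
  have "bij_betw (\<lambda>u. {v, u}) (star v) (incident_edges E v)"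
    unfolding inc using edge_inj by (rule inj_on_imp_bij_betw)
  then have "bij_betw (\<phi> \<circ> (\<lambda>u. {v, u})) (star v) {1..D v}" using \<phi>(1) by (rule bij_betw_trans)
  then have bij: "bij_betw \<psi> (star v) {1..D v}" unfolding \<psi>_def comp_def .
  let ?p = "\<lambda>h. \<lambda>e\<in>incident_edges E v. h ` e"
  let ?f = "\<lambda>p. \<lambda>k\<in>{1..D v}. \<phi> (p (inv_into (incident_edges E v) \<phi> k))"
  have act: "?f (?p h) (\<psi> u) = \<psi> (totalise h u)" if h: "h \<in> H" "h v = v" and u: "u \<in> star v" for h u
  proof -
    have e: "{v, u} \<in> incident_edges E v" using inc u by blast
    have k: "\<psi> u \<in> {1..D v}" using bij u bij_betwE by blast
    have "inv_into (incident_edges E v) \<phi> (\<psi> u) = {v, u}"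
      unfolding \<psi>_def using \<phi>(1) e by (simp add: bij_betw_def inv_into_f_f)
    moreover have "u \<in> V" using u adj_V2 star_iff by blast
    ultimately show ?thesis using k e h(2) by (simp add: \<psi>_def totalise_def)
  qed
  have "\<exists>f\<in>F v. \<forall>u\<in>star v. \<psi> (g u) = f (\<psi> u)" if g: "g \<in> fixator {v}" for g
  proof -
    obtain h where h: "h \<in> H" "g = totalise h" using g unfolding fixator_def by blast
    have hv: "h v = v" using fixatorD(2)[OF g, of v] h(2) v by (simp add: totalise_def)
    have "?f (?p h) \<in> F v"
      unfolding \<phi>(2) local_action_def point_stabilizer_def using h(1) hv by blast
    moreover have "\<forall>u\<in>star v. \<psi> (g u) = ?f (?p h) (\<psi> u)" using act[OF h(1) hv] h(2) by simp
    ultimately show ?thesis by blast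
  qed
  moreover have "\<exists>g\<in>fixator {v}. \<forall>u\<in>star v. \<psi> (g u) = f (\<psi> u)" if f: "f \<in> F v" for f
  proof -
    obtain h where h: "h \<in> H" "h v = v" "f = ?f (?p h)"
      using f unfolding \<phi>(2) local_action_def point_stabilizer_def by blast
    have "totalise h \<in> fixator {v}" using h v by (intro fixatorI) (auto simp: totalise_def)
    moreover have "\<forall>u\<in>star v. \<psi> (totalise h u) = f (\<psi> u)" using act[OF h(1,2)] h(3) by simp
    ultimately show ?thesis by blast
  qed
  ultimately show ?thesis using bij unfolding local_chart_def by blast
qed

text \<open>Simplicity is assumed for the stabiliser of 1, whereas \<open>p\<close> is an arbitrary
  neighbour of \<open>z\<close>; transitivity of \<open>F z\<close> allows a chart in which
  \<open>p\<close> has colour 1.\<close>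

lemma based_chart:
  assumes pz: "adj p z"
  obtains \<psi> where "local_chart z \<psi> (D z) (F z)" "\<psi> p = 1"
proof -
  have z: "z \<in> V" and ps: "p \<in> star z" using pz adj_V2 adj_sym star_iff by blast+
  obtain \<psi> where c: "local_chart z \<psi> (D z) (F z)" using charts_exist[OF z] by blast
  obtain f where f: "f \<in> F z" "f (\<psi> p) = 1"
    using local_chart_transitive[OF c z ps, of 1] D_ge_3[of z] by auto
  have "local_chart z (f \<circ> \<psi>) (D z) (F z)" using local_chart_change[OF c f(1)] by simp
  then show thesis using that f(2) by simp
qed

sublocale locally_simple_group "V0 \<union> V1" adj td "totalise ` H"
proof
  show "finite (star x)" if "x \<in> V" for x using degree(1)[OF that] by (simp add: star_def)
next
  fix p z N
  assume pz: "adj p z" and N: "closed_subgroup N" "N \<subseteq> fixator {p, z}"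
    and nrm: "\<And>g n. g \<in> fixator {p, z} \<Longrightarrow> n \<in> N \<Longrightarrow> \<exists>m\<in>N. \<forall>v\<in>star z. m v = g (n (finv g v))"
  obtain \<psi> where c: "local_chart z \<psi> (D z) (F z)" "\<psi> p = 1" using based_chart[OF pz] .
  show "trivial_at z N \<or> full_at p z N"
    by (rule trivial_or_full_of_simple[OF pz c(1) F_Bij c(2) simple_F N nrm])
next
  fix p z
  assume pz: "adj p z"
  obtain \<psi> where c: "local_chart z \<psi> (D z) (F z)" "\<psi> p = 1" using based_chart[OF pz] .
  show "\<exists>g\<in>fixator {p, z}. \<exists>h\<in>fixator {p, z}. \<exists>v\<in>star z. g (h v) \<noteq> h (g v)"
    by (rule noncommuting_of_nonabelian[OF pz c(1) F_Bij c(2) simple_F nonab_F])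
qed

text \<open>Legal colorings refer to \<open>graph_dist\<close> at distance 1 only, where the sphere
  is the neighbourhood. This links their definition to \<open>star\<close>.\<close>

lemma sphere_1: "v \<in> V \<Longrightarrow> graph_sphere V E v 1 = star v"
  using graph_sphere_1[of V E v] graph_tree unfolding graph_tree_def star_def adj_def by blast

lemma even_td_type: "x \<in> V \<Longrightarrow> y \<in> V \<Longrightarrow> even (td x y) \<longleftrightarrow> (x \<in> V0 \<longleftrightarrow> y \<in> V0)"
proof (induction "td x y" arbitrary: y)
  case 0
  then show ?case using td_0 by simp
next
  case (Suc n)
  then have "x \<noteq> y" by auto
  then obtain p where p: "adj p y" "td x y = Suc (td x p)" using parent_ex Suc.prems by blast
  then have "even (td x p) \<longleftrightarrow> (x \<in> V0 \<longleftrightarrow> p \<in> V0)"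
    using Suc.hyps Suc.prems(1) adj_V[OF p(1)] by simp
  then show ?case using p(2) edge_types[OF p(1)] by auto
qed

lemma local_perm_eq:
  assumes v: "v \<in> V" and c: "local_chart v i (D v) (F v)"
  shows "local_perm V E i g v = (\<lambda>k\<in>{1..D v}. i (g (inv_into (star v) i k)))"
  using local_chartD(1)[OF c] unfolding local_perm_def sphere_1[OF v] bij_betw_def by simp

lemma local_perm_apply:
  assumes v: "v \<in> V" and c: "local_chart v i (D v) (F v)" and u: "u \<in> star v"
  shows "local_perm V E i g v (i u) = i (g u)"
  using local_chartD(1)[OF c] local_chart_in[OF c u] u
  unfolding local_perm_eq[OF v c] bij_betw_def by (simp add: inv_into_f_f)

lemma legal_colouring_of_charts:
  assumes c: "\<And>v. v \<in> V \<Longrightarrow> local_chart v i (D v) (F v)"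
  shows "legal_coloring V0 V1 E d0 d1 i"
proof -
  have bij: "bij_betw i (graph_sphere V E v 1) {1..D v}" if "v \<in> V" for v
    using local_chartD(1)[OF c[OF that]] sphere_1[OF that] by simp
  have range: "\<exists>w\<in>V. (w \<in> V0 \<longleftrightarrow> v \<notin> V0) \<and> i v \<in> {1..D w}" if v: "v \<in> V" for v
  proof -
    obtain w where w: "adj v w" using thick[OF v] by blast
    have wV: "w \<in> V" using w adj_V2 by blast
    have "v \<in> star w" using adj_sym[OF w] star_iff by simp
    then show ?thesis using local_chart_in[OF c[OF wV]] edge_types[OF w] wV by blast
  qed
  have "i v \<in> {1..d1}" if "v \<in> V0" for v
    using range[of v] that by (auto simp: D_def)
  moreover have "i v \<in> {1..d0}" if "v \<in> V1" for v
    using range[of v] that disjoint_types by (auto simp: D_def)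
  moreover have "D v = d1" if "v \<in> V1" for v using that disjoint_types by (auto simp: D_def)
  moreover have "bij_betw i (graph_sphere V E v 1) {1..d1}" if "v \<in> V1" for v
    using bij[of v] that \<open>\<And>v. v \<in> V1 \<Longrightarrow> D v = d1\<close>[OF that] by simp
  moreover have "bij_betw i (graph_sphere V E v 1) {1..d0}" if "v \<in> V0" for v
    using bij[of v] that by (simp add: D_def)
  ultimately show ?thesis unfolding legal_coloring_def by blast
qed

lemma universal_group_eq:
  assumes c: "\<And>v. v \<in> V \<Longrightarrow> local_chart v i (D v) (F v)"
    and loc: "\<And>g v. g \<in> G \<Longrightarrow> v \<in> V \<Longrightarrow> \<exists>f\<in>F v. \<forall>u\<in>star v. i (g u) = f (i u)"
  shows "H = U_plus V0 V1 E i F0 F1"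
proof
  have Fv: "F v = F0" if "v \<in> V0" for v using that by (simp add: F_def)
  have Fv': "F v = F1" if "v \<in> V1" for v using that disjoint_types by (auto simp: F_def)
  have star_V: "u \<in> V" if "u \<in> star v" for u v using that adj_V2 star_iff by blast
  show "H \<subseteq> U_plus V0 V1 E i F0 F1"
  proof
    fix h assume h: "h \<in> H"
    have lp: "local_perm V E i h v \<in> F v" if v: "v \<in> V" for v
    proof -
      obtain f where f: "f \<in> F v" "\<And>u. u \<in> star v \<Longrightarrow> i (totalise h u) = f (i u)" using loc h v by blast
      have "local_perm V E i h v = f"
      proof (rule extensionalityI[of _ "{1..D v}"])
        show "local_perm V E i h v \<in> extensional {1..D v}" by (simp add: local_perm_eq[OF v c[OF v]])
        show "f \<in> extensional {1..D v}" using f(1) F_Bij Bij_imp_extensional by blast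
        fix k assume "k \<in> {1..D v}"
        then obtain u where u: "u \<in> star v" "k = i u"
          using local_chartD(1)[OF c[OF v]] unfolding bij_betw_def by blast
        have "totalise h u = h u" using star_V[OF u(1)] by (simp add: totalise_def)
        then show "local_perm V E i h v k = f k" using local_perm_apply[OF v c[OF v] u(1)] f(2)[OF u(1)] u(2) by simp
      qed
      then show ?thesis using f(1) by simp
    qed
    have "local_perm V E i h x \<in> F0" if "x \<in> V0" for x using lp[of x] Fv[OF that] that by simp
    moreover have "local_perm V E i h y \<in> F1" if "y \<in> V1" for y using lp[of y] Fv'[OF that] that by simp
    ultimately show "h \<in> U_plus V0 V1 E i F0 F1"
      unfolding U_plus_def using subsetD[OF H_plus h] by blast
  qed
  show "U_plus V0 V1 E i F0 F1 \<subseteq> H"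
  proof
    fix u assume u: "u \<in> U_plus V0 V1 E i F0 F1"
    have ua: "u \<in> tree_aut V E" and uV0: "u ` V0 = V0" "u ` V1 = V1"
      and ul: "\<And>v. v \<in> V \<Longrightarrow> local_perm V E i u v \<in> F v"
      using u Fv Fv' unfolding U_plus_def tree_aut_plus_def by auto
    have uV: "u v \<in> V" if "v \<in> V" for v using that uV0 by blast
    have ut: "u v \<in> V0 \<longleftrightarrow> v \<in> V0" if "v \<in> V" for v using that uV0 disjoint_types by blast
    obtain \<rho> where \<rho>: "\<rho> \<in> V" using graph_tree unfolding graph_tree_def by blast
    \<comment> \<open>Elements of the universal group preserve types, which yields both the
      invariance of \<open>F\<close> and the parity condition at the root.\<close>
    have appr: "\<exists>k\<in>G. \<forall>v\<in>tball \<rho> n. k v = u v" for n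
    proof (rule agree_on_ball[OF c loc \<rho> uV])
      show "adj (u v) (u s)" if "adj v s" for v s
      proof -
        have "v \<in> V" "s \<in> V" using that adj_V adj_V2 by blast+
        then show ?thesis using ua that unfolding tree_aut_def adj_def by blast
      qed
      show "F (u v) = F v" if "v \<in> V" for v using ut[OF that] by (simp add: F_def)
      show "\<exists>f\<in>F v. \<forall>s\<in>star v. i (u s) = f (i s)" if "v \<in> V" for v
        using ul[OF that] local_perm_apply[OF that c[OF that], of _ u] by (intro bexI[of _ "local_perm V E i u v"]) simp_all
      show "even (td \<rho> (u \<rho>))" using even_td_type[OF \<rho> uV[OF \<rho>]] ut[OF \<rho>] by simp
    qed
    show "u \<in> H"
    proof (rule closedin_aut_topologyD[OF H_closed ua])
      fix A :: "'a set" assume A: "finite A" "A \<subseteq> V"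
      \<comment> \<open>Inserting 0 makes the maximum well defined for empty
        \<open>A\<close>.\<close>
      define n where "n = Max (insert 0 (td \<rho> ` A))"
      have "td \<rho> v \<le> n" if "v \<in> A" for v unfolding n_def using A(1) that by (intro Max_ge) auto
      then have At: "A \<subseteq> tball \<rho> n" using A(2) unfolding tball_def by blast
      obtain h where h: "h \<in> H" "\<And>v. v \<in> tball \<rho> n \<Longrightarrow> totalise h v = u v" using appr[of n] by blast
      have "h v = u v" if "v \<in> A" for v
      proof -
        have "totalise h v = u v" using h(2) At that by blast
        moreover have "v \<in> V" using A(2) that by blast
        ultimately show ?thesis unfolding totalise_def by simp
      qed
      then show "\<exists>h\<in>H. \<forall>v\<in>A. h v = u v" using h(1) by blast
    qed
  qed
qed

lemma universal: "\<exists>i. legal_coloring V0 V1 E d0 d1 i \<and> H = U_plus V0 V1 E i F0 F1"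
proof -
  have ne: "V \<noteq> {}" using graph_tree unfolding graph_tree_def by blast
  obtain i where i: "\<And>v. v \<in> V \<Longrightarrow> local_chart v i (D v) (F v)"
      "\<And>g v. g \<in> G \<Longrightarrow> v \<in> V \<Longrightarrow> \<exists>f\<in>F v. \<forall>u\<in>star v. i (g u) = f (i u)"
  proof (rule colouring_exists[of D F])
    show "\<exists>\<psi>. local_chart v \<psi> (D v) (F v)" if "v \<in> V" for v using charts_exist[OF that] .
    show "D (g v) = D v" "F (g v) = F v" if "g \<in> G" "v \<in> V" for g v
      using D_inv[OF that] F_inv[OF that] by simp_all
    show "V \<noteq> {}" by (rule ne)
  qed blast
  show ?thesis using legal_colouring_of_charts[of i, OF i(1)] universal_group_eq[of i, OF i] by blast
qed

end

theorem theorem6: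
  fixes V0 V1 :: "'a set" and E :: "'a set set" and d0 d1 :: nat
    and F0 F1 :: "(nat \<Rightarrow> nat) set" and H :: "('a \<Rightarrow> 'a) set"
  assumes "semiregular_tree V0 V1 E d0 d1"
    and "subgroup F0 (Sym d0)"
    and "subgroup F1 (Sym d1)"
    and "H \<in> HT_plus V0 V1 E"
    and "\<And>x. x \<in> V0 \<Longrightarrow>
           permutation_isomorphic (incident_edges E x) (local_action E H x) {1..d0} F0"
    and "\<And>y. y \<in> V1 \<Longrightarrow>
           permutation_isomorphic (incident_edges E y) (local_action E H y) {1..d1} F1"
    and "simple_group ((Sym d0)\<lparr>carrier := point_stabilizer F0 1\<rparr>)"
    and "\<not> comm_group ((Sym d0)\<lparr>carrier := point_stabilizer F0 1\<rparr>)"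
    and "simple_group ((Sym d1)\<lparr>carrier := point_stabilizer F1 1\<rparr>)"
    and "\<not> comm_group ((Sym d1)\<lparr>carrier := point_stabilizer F1 1\<rparr>)"
  shows "\<exists>i. legal_coloring V0 V1 E d0 d1 i \<and> H = U_plus V0 V1 E i F0 F1"
proof -
  interpret boundary_two_transitive_group V0 V1 E d0 d1 F0 F1 H
    by (rule boundary_two_transitive_group.intro) (rule assms; assumption)+
  show ?thesis by (rule universal)
qed

end
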